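(* (i) For every $n\ge1$, the map $\mathrm{Match}\circ\widehat{\mathrm{RSK}}:\mathcal S_n(321)\to\mathcal N_n$ restricts to a bijection between $\{\pi\in\mathcal S_n(321):\pi=(\pi^{rc})^{-1}\}$ and $\mathcal N^S_n$. (ii) Consequently, for every $m\ge1$, the map $\mathrm{AST}_B$ is a bijection between $\mathcal A(\mathbf B^m)$ and $\mathcal N^S_{2m}$.
   Context: $\mathcal S_n(321)$ is the set of permutations $\pi$ of $\{1,\dots,n\}$ with no $i<j<k$ such that $\pi(i)>\pi(j)>\pi(k)$. The reverse-complement $\pi^{rc}$ of a permutation $\pi$ of $\{1,\dots,n\}$ is given by $\pi^{rc}(i)=n+1-\pi(n+1-i)$. $\mathcal N_n$ is the set of noncrossing perfect matchings of $\{1,\dots,2n\}$ (there are no $i<j<k<\ell$ with $i$ matched to $k$ and $j$ matched to $\ell$). The points are placed, equally spaced, around a circle in clockwise order $1,2,\dots,2n$; write $\overline{i}$ for the point $2n+1-i$, $1\le i\le n$. $\mathcal N_n^S\subseteq\mathcal N_n$ is the set of centrally symmetric matchings, i.e. those fixed under rotation by $180^\circ$ (replacing each point $x$ by $x+n$ modulo $2n$). $\mathcal D_n$ is the set of Dyck words: words with $n$ letters $\mathtt u$ and $n$ letters $\mathtt d$ such that every prefix has at least as many $\mathtt u$'s as $\mathtt d$'s. Viewing $\mathtt u$ and $\mathtt d$ as opening and closing parentheses, a pair of matched steps is called a tunnel. $\mathrm{Match}:\mathcal D_n\to\mathcal N_n$ matches $x$ and $y$ in $\mathrm{Match}(D)$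 if and only if the steps of $D$ in positions $x$ and $y$ form a tunnel. $\mathrm{RSK}(\pi)=(P,Q)$ denotes the Robinson--Schensted--Knuth (row insertion) correspondence, with $P$ the insertion tableau and $Q$ the recording tableau; for $\pi\in\mathcal S_n(321)$ both have at most two rows. $\widehat{\mathrm{RSK}}:\mathcal S_n(321)\to\mathcal D_n$ is defined as follows: for $1\le i\le n$, the $i$th step of $\widehat{\mathrm{RSK}}(\pi)$ is $\mathtt u$ if $i$ is in the top row of $P$ and $\mathtt d$ otherwise; the $(2n+1-i)$th step is $\mathtt d$ if $i$ is in the top row of $Q$ and $\mathtt u$ otherwise. $\mathbf A^{n-1}$ is the poset of intervals $\{[i,j]:1\le i\le j\le n-1\}$ ordered by inclusion. $\mathbf B^m$ is the poset of intervals $\{[i,j]:1\le i\le j\le 2m-1,\ i+j\le 2m\}$ ordered by inclusion (type $B$ positive root poset). $\mathcal A(\cdot)$ denotes the set of antichains. For $A\in\mathcal A(\mathbf B^m)$ put $\hat A=\{[i,j]:[i,j]\in A\text{ or }[2m-j,2m-i]\in A\}\in\mathcal A(\mathbf A^{2m-1})$. $\mathrm{AST}:\mathcal A(\mathbf A^{n-1})\to\mathcal N_n$ (Armstrong--Stump--Thomas bijection, type $A$): given an antichain $A$, start with no matched points, and for $i=1,2,\dots,n$ in order: if $[i,j-1]\in A$ for some $j$, match the vertex $j$ with the nearest unmatched vertex in counterclockwise direction; otherwise match the vertex $\overline i$ with the nearest unmatched vertex in clockwise direction. In type $B$, $\mathrm{AST}_B(A)=\mathrm{AST}(\hat A)$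 for $A\in\mathcal A(\mathbf B^m)$ (with $n=2m$). *)

theory Defs
  imports Main "HOL-Combinatorics.Permutations" "HOL-Library.Disjoint_Sets"
begin

section \<open>321-avoiding permutations\<close>

definition S321 :: "nat \<Rightarrow> (nat \<Rightarrow> nat) set" where
  "S321 n = {\<pi>. \<pi> permutes {1..n} \<and>
     \<not> (\<exists>i\<in>{1..n}. \<exists>j\<in>{1..n}. \<exists>k\<in>{1..n}. i < j \<and> j < k \<and> \<pi> i > \<pi> j \<and> \<pi> j > \<pi> k)}"

text \<open>Outside \<open>{1..n}\<close> the result is the identity, so that it permutes \<open>{1..n}\<close> again.\<close>

definition rev_compl :: "nat \<Rightarrow> (nat \<Rightarrow> nat) \<Rightarrow> nat \<Rightarrow> nat" where
  "rev_compl n \<pi> i = (if i \<in> {1..n} then n + 1 - \<pi> (n + 1 - i) else i)"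

section \<open>Noncrossing perfect matchings\<close>

text \<open>A matching is the set of its edges, each edge being a two-element set of points.\<close>

definition perfect_matchings :: "nat \<Rightarrow> nat set set set" where
  "perfect_matchings n = {M. partition_on {1..2 * n} M \<and> (\<forall>e\<in>M. card e = 2)}"

definition noncrossing_matchings :: "nat \<Rightarrow> nat set set set" where
  "noncrossing_matchings n = {M \<in> perfect_matchings n.
     \<not> (\<exists>i j k l. i < j \<and> j < k \<and> k < l \<and> {i, k} \<in> M \<and> {j, l} \<in> M)}"

definition half_turn :: "nat \<Rightarrow> nat \<Rightarrow> nat" where
  "half_turn n x = (if x \<le> n then x + n else x - n)"

definition symmetric_matchings :: "nat \<Rightarrow> nat set set set" where
  "symmetric_matchings n =
     {M \<in> noncrossing_matchings n. (\<lambda>e. half_turn n ` e) ` M = M}"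

section \<open>Dyck words and tunnels\<close>

datatype step = U | D

definition Dyck :: "nat \<Rightarrow> step list set" where
  "Dyck n = {w. count_list w U = n \<and> count_list w D = n \<and>
     (\<forall>k \<le> length w. count_list (take k w) D \<le> count_list (take k w) U)}"

text \<open>
  Positions are counted from 1. The steps \<open>x < y\<close> are an opening parenthesis and its matching
  closing one; \<open>take (y - x - 1) (drop x w)\<close> is the word strictly between them.
\<close>

definition tunnel :: "step list \<Rightarrow> nat \<Rightarrow> nat \<Rightarrow> bool" where
  "tunnel w x y \<longleftrightarrow> 1 \<le> x \<and> x < y \<and> y \<le> length w \<and> w ! (x - 1) = U \<and> w ! (y - 1) = D \<and>
     (\<exists>k. take (y - x - 1) (drop x w) \<in> Dyck k)"

definition Match :: "step list \<Rightarrow> nat set set" where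
  "Match w = {{x, y} | x y. tunnel w x y}"

section \<open>The Robinson--Schensted--Knuth correspondence\<close>

text \<open>A tableau is the list of its rows, from top to bottom.\<close>

text \<open>The new row, together with the bumped entry, if any.\<close>

fun row_insert :: "nat \<Rightarrow> nat list \<Rightarrow> nat list \<times> nat option" where
  "row_insert x [] = ([x], None)"
| "row_insert x (y # ys) =
     (if x < y then (x # ys, Some y)
      else let (r, b) = row_insert x ys in (y # r, b))"

text \<open>The new tableau, together with the index (from 0) of the row that became longer.\<close>

fun tab_insert :: "nat \<Rightarrow> nat list list \<Rightarrow> nat list list \<times> nat" where
  "tab_insert x [] = ([[x]], 0)"
| "tab_insert x (r # T) =
     (case row_insert x r of
        (r', None) \<Rightarrow> (r' # T, 0)
      | (r', Some y) \<Rightarrow> let (T', d) = tab_insert y T in (r' # T', Suc d))"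

definition append_to_row :: "nat \<Rightarrow> nat \<Rightarrow> nat list list \<Rightarrow> nat list list" where
  "append_to_row k d T = (if d < length T then T[d := T ! d @ [k]] else T @ [[k]])"

definition rsk_step ::
    "(nat \<Rightarrow> nat) \<Rightarrow> nat \<Rightarrow> nat list list \<times> nat list list \<Rightarrow> nat list list \<times> nat list list" where
  "rsk_step \<pi> k PQ =
     (let (P', d) = tab_insert (\<pi> k) (fst PQ) in (P', append_to_row k d (snd PQ)))"

definition RSK :: "nat \<Rightarrow> (nat \<Rightarrow> nat) \<Rightarrow> nat list list \<times> nat list list" where
  "RSK n \<pi> = fold (rsk_step \<pi>) [1..<n + 1] ([], [])"

definition RSK_hat :: "nat \<Rightarrow> (nat \<Rightarrow> nat) \<Rightarrow> step list" where
  "RSK_hat n \<pi> =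
     (let (P, Q) = RSK n \<pi> in
        map (\<lambda>i. if i \<in> set (hd P) then U else D) [1..<n + 1] @
        map (\<lambda>i. if i \<in> set (hd Q) then D else U) (rev [1..<n + 1]))"

section \<open>Root posets and their antichains\<close>

text \<open>The pair \<open>(i, j)\<close> stands for the interval \<open>[i, j]\<close>.\<close>

definition root_poset_A :: "nat \<Rightarrow> (nat \<times> nat) set" where
  "root_poset_A N = {(i, j). 1 \<le> i \<and> i \<le> j \<and> j \<le> N}"

definition root_poset_B :: "nat \<Rightarrow> (nat \<times> nat) set" where
  "root_poset_B m = {(i, j). 1 \<le> i \<and> i \<le> j \<and> j \<le> 2 * m - 1 \<and> i + j \<le> 2 * m}"

definition interval_le :: "nat \<times> nat \<Rightarrow> nat \<times> nat \<Rightarrow> bool" where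
  "interval_le a b \<longleftrightarrow> {fst a..snd a} \<subseteq> {fst b..snd b}"

definition antichains :: "(nat \<times> nat) set \<Rightarrow> (nat \<times> nat) set set" where
  "antichains X = {A. A \<subseteq> X \<and> (\<forall>a\<in>A. \<forall>b\<in>A. interval_le a b \<longrightarrow> a = b)}"

definition unfold_B :: "nat \<Rightarrow> (nat \<times> nat) set \<Rightarrow> (nat \<times> nat) set" where
  "unfold_B m A =
     {(i, j) \<in> root_poset_A (2 * m - 1). (i, j) \<in> A \<or> (2 * m - j, 2 * m - i) \<in> A}"

section \<open>The Armstrong--Stump--Thomas bijection\<close>

text \<open>
  The points \<open>1, \<dots>, 2 * n\<close> are placed clockwise around a circle;
  \<open>cw_dist n x y\<close> is the number of unit steps from \<open>x\<close> clockwise to \<open>y\<close>.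
\<close>

definition cw_dist :: "nat \<Rightarrow> nat \<Rightarrow> nat \<Rightarrow> nat" where
  "cw_dist n x y = (2 * n + y - x) mod (2 * n)"

definition nearest_cw :: "nat \<Rightarrow> nat set set \<Rightarrow> nat \<Rightarrow> nat" where
  "nearest_cw n M v = arg_min (\<lambda>u. cw_dist n v u) (\<lambda>u. u \<in> {1..2 * n} - \<Union>M - {v})"

definition nearest_ccw :: "nat \<Rightarrow> nat set set \<Rightarrow> nat \<Rightarrow> nat" where
  "nearest_ccw n M v = arg_min (\<lambda>u. cw_dist n u v) (\<lambda>u. u \<in> {1..2 * n} - \<Union>M - {v})"

text \<open>
  In an antichain at most one interval starts at \<open>i\<close>, so the description below determines \<open>j\<close>.
  Since intervals have positive endpoints, \<open>j - 1\<close> does not truncate when \<open>(i, j - 1) \<in> A\<close>.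
\<close>

definition ast_step :: "nat \<Rightarrow> (nat \<times> nat) set \<Rightarrow> nat \<Rightarrow> nat set set \<Rightarrow> nat set set" where
  "ast_step n A i M =
     (if \<exists>j. (i, j - 1) \<in> A
      then let j = (THE j. (i, j - 1) \<in> A) in insert {j, nearest_ccw n M j} M
      else let v = 2 * n + 1 - i in insert {v, nearest_cw n M v} M)"

definition AST :: "nat \<Rightarrow> (nat \<times> nat) set \<Rightarrow> nat set set" where
  "AST n A = fold (ast_step n A) [1..<n + 1] {}"

definition AST_B :: "nat \<Rightarrow> (nat \<times> nat) set \<Rightarrow> nat set set" where
  "AST_B m A = AST (2 * m) (unfold_B m A)"

end

theory Submission
  imports Defs "HOL-Library.Infinite_Set"
begin

text \<open>
  Write \<open>bar k\<close> for the point \<open>2 * n + 1 - k\<close> and order the points along the spiral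
  \<open>1, bar 1, 2, bar 2, \<dots>\<close>. A noncrossing matching is determined by its set of closers, the
  larger end points of its edges in this order, since the points up to a given one always form an
  arc of the circle. The closers of the AST matching of an antichain are the points \<open>j\<close> with
  \<open>[i, j - 1] \<in> A\<close> and the points \<open>bar i\<close> for which no interval of \<open>A\<close> starts at \<open>i\<close>. A half turn
  reverses the spiral and so exchanges closers and openers; hence it corresponds to the reflection
  \<open>[i, j] \<mapsto> [n - j, n - i]\<close> of the antichain. Reading the antichain as the excedances of a
  321-avoiding permutation turns this reflection into \<open>\<pi> \<mapsto> (\<pi>\<^sup>r\<^sup>c)\<^sup>-\<^sup>1\<close>. Finally, running AST and row
  insertion in parallel shows that both produce the same matching: an excedance value is eventually
  bumped iff AST matches it to a smaller value, and step \<open>i\<close> bumps iff AST matches \<open>bar i\<close> to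
  some \<open>bar k\<close> with \<open>k < i\<close>.
\<close>

text \<open>The circle is cut between n and n+1: comparing points by \<open>half_turn n\<close>
  lists them as n+1, ..., 2n, 1, ..., n. With this cut every initial segment of the spiral is an
  interval around the middle and the next point is attached at one of its ends, so the AST search
  never wraps around. The keys run from 2 to 2n+1, which is why a point and its half turn have keys
  with sum 2n+3. Surjectivity onto matchings and onto antichains is a matter of counting: an
  increasing bijection joins two sets of equal size, and a ballot inequality shows that it moves
  every element in the required direction. The obstacle in the comparison with row insertion is
  time: AST joins two values as soon as the larger one is read, whereas the corresponding bump
  happens later and depends on values still to come. The invariant therefore carries a forecast, by
  counting the values to come below an entry of the first row, and it balances the pending bumps
  against the bars not yet matched.\<close>

definition key :: "nat \<Rightarrow> nat \<Rightarrow> nat" where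
  "key n x = (if x \<le> n then 2 * x else 2 * (2 * n + 1 - x) + 1)"

lemma key_inj:
  assumes "x \<in> {1..2 * n}" "y \<in> {1..2 * n}" "key n x = key n y"
  shows "x = y"
proof -
  have "(x \<le> n) = (y \<le> n)"
    using assms(3) unfolding key_def by (auto split: if_splits) presburger+
  then show ?thesis using assms unfolding key_def by (auto split: if_splits)
qed

lemma half_turn_in: "x \<in> {1..2 * n} \<Longrightarrow> half_turn n x \<in> {1..2 * n}"
  unfolding half_turn_def by auto

lemma half_turn_twice: "x \<in> {1..2 * n} \<Longrightarrow> half_turn n (half_turn n x) = x"
  unfolding half_turn_def by auto

lemma half_turn_inj_on: "inj_on (half_turn n) {1..2 * n}"
  by (metis half_turn_twice inj_onI)

lemma half_turn_image: "half_turn n ` {1..2 * n} = {1..2 * n}"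
  by (metis half_turn_in half_turn_inj_on endo_inj_surj finite_atLeastAtMost image_subsetI)

lemma key_half_turn: "x \<in> {1..2 * n} \<Longrightarrow> key n (half_turn n x) + key n x = 2 * n + 3"
  unfolding key_def half_turn_def by auto

section \<open>Pairings\<close>

text \<open>Unlike a perfect matching this leaves open which points are covered, because the partial
  matchings of the single AST rounds have to be covered as well.\<close>

definition pairing :: "'a set set \<Rightarrow> bool" where
  "pairing M \<longleftrightarrow> disjoint M \<and> (\<forall>e\<in>M. card e = 2)"

lemma pairing_unique:
  assumes "pairing M" "{x, y} \<in> M" "{x, z} \<in> M"
  shows "y = z"
proof -
  have "{x, y} = {x, z}"
    using assms disjointD[of M "{x, y}" "{x, z}"] unfolding pairing_def by auto
  then show ?thesis by (auto simp: doubleton_eq_iff)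
qed

lemma pairing_neq: "pairing M \<Longrightarrow> {x, y} \<in> M \<Longrightarrow> x \<noteq> y"
  unfolding pairing_def by fastforce

lemma pairing_edge:
  assumes "pairing M" "e \<in> M"
  obtains x y where "e = {x, y}" "x \<noteq> y"
  using assms unfolding pairing_def by (meson card_2_iff)

lemma pairing_partner:
  assumes "pairing M" "x \<in> \<Union>M"
  obtains y where "{x, y} \<in> M"
proof -
  obtain e where "e \<in> M" "x \<in> e" using assms(2) by auto
  moreover obtain a b where "e = {a, b}" using pairing_edge[OF assms(1) \<open>e \<in> M\<close>] by blast
  ultimately have "\<exists>y. {x, y} \<in> M" by (auto simp: insert_commute)
  then show ?thesis using that by blast
qed

lemma pairing_empty: "pairing {}"
  unfolding pairing_def by auto

lemma pairing_insert:
  assumes "pairing M" "a \<notin> \<Union>M" "b \<notin> \<Union>M" "a \<noteq> b"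
  shows "pairing (insert {a, b} M)"
  using assms unfolding pairing_def disjoint_def by auto

lemma pairing_card:
  assumes "pairing M" "finite M"
  shows "card (\<Union>M) = 2 * card M"
proof -
  have "card (\<Union>M) = (\<Sum>e\<in>M. card e)"
    using assms unfolding pairing_def
    by (intro card_Union_disjoint) (auto intro: card_ge_0_finite simp: disjoint_def pairwise_def disjnt_def)
  then show ?thesis using assms unfolding pairing_def by simp
qed

lemma perfect_matchings_iff: "M \<in> perfect_matchings n \<longleftrightarrow> pairing M \<and> \<Union>M = {1..2 * n}"
  unfolding perfect_matchings_def pairing_def partition_on_def by fastforce

section \<open>Crossings and nesting with respect to an arbitrary numbering of the points\<close>

definition crossing_free :: "('a \<Rightarrow> nat) \<Rightarrow> 'a set set \<Rightarrow> bool" where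
  "crossing_free f M \<longleftrightarrow>
     \<not> (\<exists>a b c d. f a < f b \<and> f b < f c \<and> f c < f d \<and> {a, c} \<in> M \<and> {b, d} \<in> M)"

lemma crossing_freeD:
  assumes "crossing_free f M" "{a, c} \<in> M" "{b, d} \<in> M" "f a < f b" "f b < f c" "f c < f d"
  shows False
  using assms unfolding crossing_free_def by blast

text \<open>Here \<open>X\<close> may be larger than \<open>\<Union>M\<close>: no edge passes over an unmatched point of \<open>X\<close>.\<close>

definition nested :: "('a \<Rightarrow> nat) \<Rightarrow> 'a set \<Rightarrow> 'a set set \<Rightarrow> bool" where
  "nested f X M \<longleftrightarrow> (\<forall>a b c. {a, b} \<in> M \<longrightarrow> c \<in> X \<longrightarrow> f a < f c \<longrightarrow> f c < f b \<longrightarrow>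
     (\<exists>d. {c, d} \<in> M \<and> f a < f d \<and> f d < f b))"

lemma nestedD:
  assumes "nested f X M" "{a, b} \<in> M" "c \<in> X" "f a < f c" "f c < f b"
  obtains d where "{c, d} \<in> M" "f a < f d" "f d < f b"
  using assms unfolding nested_def by blast

text \<open>The partner d of a point c under the edge {a, b} could only lie below a or above b, and
  either way the two edges cross; a and b themselves are taken.\<close>

lemma crossing_free_imp_nested:
  assumes M: "pairing M" "\<Union>M = X" "inj_on f X" and cf: "crossing_free f M"
  shows "nested f X M"
  unfolding nested_def
proof (intro allI impI)
  fix a b c assume *: "{a, b} \<in> M" "c \<in> X" "f a < f c" "f c < f b"
  obtain d where d: "{c, d} \<in> M" using pairing_partner[OF M(1)] * M(2) by blast
  have in_X: "a \<in> X" "b \<in> X" "d \<in> X" using * d M(2) by auto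
  have "d \<noteq> a" "d \<noteq> b"
    using d * pairing_unique[OF M(1)] by (metis insert_commute less_irrefl)+
  then have ne: "f d \<noteq> f a" "f d \<noteq> f b" using in_X M(3) by (auto simp: inj_on_eq_iff)
  have d': "{d, c} \<in> M" using d by (simp add: insert_commute)
  have "\<not> f d < f a" using crossing_freeD[OF cf d' *(1) _ *(3,4)] by blast
  moreover have "\<not> f b < f d" using crossing_freeD[OF cf *(1) d *(3,4)] by blast
  ultimately show "\<exists>d. {c, d} \<in> M \<and> f a < f d \<and> f d < f b" using d ne by (meson linorder_neqE_nat)
qed

lemma nested_imp_crossing_free:
  assumes "pairing M" "\<Union>M \<subseteq> X" "nested f X M"
  shows "crossing_free f M"
  unfolding crossing_free_def
proof (intro notI, elim exE conjE)
  fix a b c d assume *: "f a < f b" "f b < f c" "f c < f d" "{a, c} \<in> M" "{b, d} \<in> M"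
  have "b \<in> X" using * assms(2) by auto
  then obtain d' where "{b, d'} \<in> M" "f d' < f c" using nestedD[OF assms(3)] * by metis
  then show False using * pairing_unique[OF assms(1)] by (metis not_less_iff_gr_or_eq)
qed

section \<open>Noncrossing matchings under a half turn\<close>

text \<open>The cut at n splits the four points into a lower and an upper block; the half turn swaps
  the blocks and keeps the order inside each.\<close>

lemma half_turn_cyclic:
  assumes X: "a \<in> {1..2 * n}" "b \<in> {1..2 * n}" "c \<in> {1..2 * n}" "d \<in> {1..2 * n}"
    and less: "a < b" "b < c" "c < d"
  defines "h \<equiv> half_turn n"
  shows "(h a < h b \<and> h b < h c \<and> h c < h d) \<or> (h b < h c \<and> h c < h d \<and> h d < h a) \<or>
    (h c < h d \<and> h d < h a \<and> h a < h b) \<or> (h d < h a \<and> h a < h b \<and> h b < h c)"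
proof -
  consider (1) "d \<le> n \<or> n < a" | (2) "a \<le> n" "n < b" | (3) "b \<le> n" "n < c" | (4) "c \<le> n" "n < d"
    by linarith
  then show ?thesis
  proof cases
    case 1
    then have "h a < h b \<and> h b < h c \<and> h c < h d" using X less by (auto simp: h_def half_turn_def)
    then show ?thesis by blast
  next
    case 2
    then have "h b < h c \<and> h c < h d \<and> h d < h a" using X less by (auto simp: h_def half_turn_def)
    then show ?thesis by blast
  next
    case 3
    then have "h c < h d \<and> h d < h a \<and> h a < h b" using X less by (auto simp: h_def half_turn_def)
    then show ?thesis by blast
  next
    case 4
    then have "h d < h a \<and> h a < h b \<and> h b < h c" using X less by (auto simp: h_def half_turn_def)
    then show ?thesis by blast
  qed
qed

text \<open>A cyclic shift of a, b, c, d by one place exchanges the chords {a, c} and {b, d}, so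
  crossing does not depend on where the circle is cut.\<close>

lemma crossing_free_half_turn:
  assumes M: "\<Union>M \<subseteq> {1..2 * n}"
  shows "crossing_free (half_turn n) M \<longleftrightarrow> crossing_free (\<lambda>x. x) M"
proof -
  let ?h = "half_turn n"
  have X: "x \<in> {1..2 * n}" "y \<in> {1..2 * n}" if "{x, y} \<in> M" for x y using M that by auto
  show ?thesis
  proof
    assume cf: "crossing_free ?h M"
    show "crossing_free (\<lambda>x. x) M"
      unfolding crossing_free_def
    proof (intro notI, elim exE conjE)
      fix a b c d assume *: "a < b" "b < c" "c < d" and e: "{a, c} \<in> M" "{b, d} \<in> M"
      have e': "{c, a} \<in> M" "{d, b} \<in> M" using e by (auto simp: insert_commute)
      show False
        using half_turn_cyclic[OF X(1)[OF e(1)] X(1)[OF e(2)] X(2)[OF e(1)] X(2)[OF e(2)] *]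
          crossing_freeD[OF cf e] crossing_freeD[OF cf e(2) e'(1)]
          crossing_freeD[OF cf e'] crossing_freeD[OF cf e'(2) e(1)] by blast
    qed
  next
    assume cf: "crossing_free (\<lambda>x. x) M"
    show "crossing_free ?h M"
      unfolding crossing_free_def
    proof (intro notI, elim exE conjE)
      fix a b c d assume *: "?h a < ?h b" "?h b < ?h c" "?h c < ?h d"
        and e: "{a, c} \<in> M" "{b, d} \<in> M"
      have e': "{c, a} \<in> M" "{d, b} \<in> M" using e by (auto simp: insert_commute)
      note mem = X(1)[OF e(1)] X(1)[OF e(2)] X(2)[OF e(1)] X(2)[OF e(2)]
      show False
        using half_turn_cyclic[OF mem[THEN half_turn_in] *] mem[THEN half_turn_twice]
          crossing_freeD[OF cf e] crossing_freeD[OF cf e(2) e'(1)]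
          crossing_freeD[OF cf e'] crossing_freeD[OF cf e'(2) e(1)] by (simp only:) blast
    qed
  qed
qed

lemma noncrossing_matchings_iff:
  "M \<in> noncrossing_matchings n \<longleftrightarrow> pairing M \<and> \<Union>M = {1..2 * n} \<and> crossing_free (\<lambda>x. x) M"
  unfolding noncrossing_matchings_def crossing_free_def
  by (auto simp: perfect_matchings_iff)

lemma noncrossing_pairing: "M \<in> noncrossing_matchings n \<Longrightarrow> pairing M"
  and noncrossing_Union: "M \<in> noncrossing_matchings n \<Longrightarrow> \<Union>M = {1..2 * n}"
  by (auto simp: noncrossing_matchings_iff)

lemma noncrossing_nested:
  assumes "M \<in> noncrossing_matchings n"
  shows "nested (\<lambda>x. x) {1..2 * n} M" and "nested (half_turn n) {1..2 * n} M"
proof -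
  have M: "pairing M" "\<Union>M = {1..2 * n}" "crossing_free (\<lambda>x. x) M"
    using assms by (auto simp: noncrossing_matchings_iff)
  then have cf: "crossing_free (half_turn n) M" using crossing_free_half_turn[of M n] by simp
  show "nested (\<lambda>x. x) {1..2 * n} M"
    using crossing_free_imp_nested[OF M(1,2) _ M(3)] by simp
  show "nested (half_turn n) {1..2 * n} M"
    by (rule crossing_free_imp_nested[OF M(1,2) half_turn_inj_on cf])
qed

lemma noncrossing_mem:
  assumes "M \<in> noncrossing_matchings n" "{x, y} \<in> M"
  shows "x \<in> {1..2 * n}" "y \<in> {1..2 * n}" "x \<noteq> y"
  using assms noncrossing_Union[OF assms(1)] pairing_neq[OF noncrossing_pairing[OF assms(1)]] by auto

abbreviation rotate :: "nat \<Rightarrow> nat set set \<Rightarrow> nat set set" where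
  "rotate n M \<equiv> (\<lambda>e. half_turn n ` e) ` M"

lemma rotate_edge:
  assumes "\<Union>M \<subseteq> {1..2 * n}" "x \<in> {1..2 * n}" "y \<in> {1..2 * n}"
  shows "{x, y} \<in> rotate n M \<longleftrightarrow> {half_turn n x, half_turn n y} \<in> M"
proof
  assume "{x, y} \<in> rotate n M"
  then obtain e where e: "e \<in> M" "{x, y} = half_turn n ` e" by auto
  have "e \<subseteq> {1..2 * n}" using e(1) assms(1) by blast
  then have "half_turn n ` half_turn n ` e = (\<lambda>x. x) ` e"
    unfolding image_image by (intro image_cong[OF refl]) (use half_turn_twice in blast)
  then have "e = half_turn n ` {x, y}" using e(2) by simp
  then show "{half_turn n x, half_turn n y} \<in> M" using e(1) by (simp only: image_insert image_empty)
next
  assume "{half_turn n x, half_turn n y} \<in> M"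
  then have "half_turn n ` {half_turn n x, half_turn n y} \<in> rotate n M" by blast
  then show "{x, y} \<in> rotate n M"
    by (simp only: image_insert image_empty half_turn_twice[OF assms(2)] half_turn_twice[OF assms(3)])
qed

lemma rotate_noncrossing:
  assumes "M \<in> noncrossing_matchings n"
  shows "rotate n M \<in> noncrossing_matchings n"
proof -
  have M: "pairing M" "\<Union>M = {1..2 * n}" using assms by (auto simp: noncrossing_matchings_iff)
  have cf: "crossing_free (half_turn n) M"
    using assms crossing_free_half_turn[of M n] by (auto simp: noncrossing_matchings_iff)
  have inj: "inj_on (half_turn n) (\<Union>M)" using M half_turn_inj_on by simp
  have "pairing (rotate n M)"
    unfolding pairing_def
  proof
    show "disjoint (rotate n M)"
      using M(1) disjoint_image[OF inj] unfolding pairing_def by blast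
    show "\<forall>e\<in>rotate n M. card e = 2"
      using M(1) inj card_image inj_on_subset unfolding pairing_def by (metis Union_upper imageE)
  qed
  moreover have U: "\<Union>(rotate n M) = {1..2 * n}"
    using M half_turn_image[of n] by (metis image_Union)
  moreover have "crossing_free (\<lambda>x. x) (rotate n M)"
    unfolding crossing_free_def
  proof (intro notI, elim exE conjE)
    fix a b c d assume *: "a < b" "b < c" "c < d" "{a, c} \<in> rotate n M" "{b, d} \<in> rotate n M"
    have in_X: "a \<in> {1..2*n}" "b \<in> {1..2*n}" "c \<in> {1..2*n}" "d \<in> {1..2*n}"
      using *(4,5) U by blast+
    have "{half_turn n a, half_turn n c} \<in> M" "{half_turn n b, half_turn n d} \<in> M"
      using * rotate_edge M in_X by (metis order_refl)+
    then show False using crossing_freeD[OF cf, of "half_turn n a" "half_turn n c" "half_turn n b" "half_turn n d"]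
      * half_turn_twice in_X by simp
  qed
  ultimately show ?thesis by (simp add: noncrossing_matchings_iff)
qed

section \<open>Closers in the spiral order\<close>

definition closers :: "nat \<Rightarrow> nat set set \<Rightarrow> nat set" where
  "closers n M = {x. \<exists>y. {x, y} \<in> M \<and> key n y < key n x}"

lemma closers_rotate:
  assumes "M \<in> noncrossing_matchings n"
  shows "closers n (rotate n M) = half_turn n ` ({1..2 * n} - closers n M)"
proof -
  have M: "pairing M" "\<Union>M \<subseteq> {1..2 * n}" "\<Union>M = {1..2*n}" using assms by (auto simp: noncrossing_matchings_iff)
  have eq: "half_turn n x \<in> closers n (rotate n M) \<longleftrightarrow> x \<notin> closers n M" if x: "x \<in> {1..2 * n}" for x
  proof -
    obtain y where y: "{x, y} \<in> M" using pairing_partner[OF M(1)] M(3) x by blast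
    have yX: "y \<in> {1..2 * n}" "x \<noteq> y" using noncrossing_mem[OF assms y] by auto
    have uniq: "z = y" if "{x, z} \<in> M" for z using pairing_unique[OF M(1) that y] .
    have 1: "x \<in> closers n M \<longleftrightarrow> key n y < key n x" using y uniq unfolding closers_def by blast
    have ry: "{half_turn n x, half_turn n y} \<in> rotate n M"
      using imageI[OF y, of "\<lambda>e. half_turn n ` e"] by simp
    have uniq': "z = half_turn n y" if "{half_turn n x, z} \<in> rotate n M" for z
      using pairing_unique[OF noncrossing_pairing[OF rotate_noncrossing[OF assms]] that ry] .
    have 2: "half_turn n x \<in> closers n (rotate n M) \<longleftrightarrow> key n (half_turn n y) < key n (half_turn n x)"
      using ry uniq' unfolding closers_def by blast
    have "key n x \<noteq> key n y" using key_inj x yX by blast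
    then show ?thesis using 1 2 key_half_turn[OF x] key_half_turn[OF yX(1)] by linarith
  qed
  have sub: "closers n (rotate n M) \<subseteq> {1..2 * n}"
    using noncrossing_mem[OF rotate_noncrossing[OF assms]] unfolding closers_def by blast
  show ?thesis
  proof (intro equalityI subsetI)
    fix z assume z: "z \<in> closers n (rotate n M)"
    then have zX: "z \<in> {1..2 * n}" using sub by blast
    then have "half_turn n z \<notin> closers n M" "half_turn n z \<in> {1..2 * n}"
      using eq[of "half_turn n z"] z half_turn_twice half_turn_in by auto
    then show "z \<in> half_turn n ` ({1..2 * n} - closers n M)"
      using half_turn_twice[OF zX] by (metis DiffI imageI)
  qed (use eq in auto)
qed

text \<open>
  The points with key less than a given one form an interval in the order of \<open>half_turn\<close>, and the
  given point is adjacent to that interval.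
\<close>

lemma key_less_between:
  assumes "x \<in> {1..2 * n}" "p \<in> {1..2 * n}" "q \<in> {1..2 * n}" "key n p < key n x"
    and "(half_turn n p < half_turn n q \<and> half_turn n q < half_turn n x) \<or>
         (half_turn n x < half_turn n q \<and> half_turn n q < half_turn n p)"
  shows "key n q < key n x"
  using assms unfolding key_def half_turn_def by (auto split: if_splits)

text \<open>Values are attached at the upper end of the interval of earlier points, bars at the
  lower end. Hence two candidate partners of the same closer always lie on the same side of
  it.\<close>

lemma key_less_same_side:
  assumes "x \<in> {1..2 * n}" "p \<in> {1..2 * n}" "key n p < key n x"
  shows "half_turn n p < half_turn n x \<longleftrightarrow> x \<le> n"
  using assms unfolding key_def half_turn_def by (auto split: if_splits)

text \<open>Induction along the spiral: the matchings agree on edges among the points before the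
  closer x, and two different partners for x would force an edge out of its span.\<close>

lemma closers_edge_transfer:
  assumes M: "M \<in> noncrossing_matchings n" and N: "N \<in> noncrossing_matchings n"
    and c: "closers n M = closers n N"
  shows "{x, y} \<in> M \<Longrightarrow> key n y < key n x \<Longrightarrow> {x, y} \<in> N"
    and "{x, y} \<in> N \<Longrightarrow> key n y < key n x \<Longrightarrow> {x, y} \<in> M"
proof -
  have "\<forall>x y. key n x = k \<longrightarrow> key n y < key n x \<longrightarrow> ({x, y} \<in> M \<longleftrightarrow> {x, y} \<in> N)" for k
  proof (induction k rule: less_induct)
    case (less k)
    have edge: "{p, q} \<in> M \<longleftrightarrow> {p, q} \<in> N"
      if "key n p < k" "key n q < k" "p \<in> {1..2 * n}" "q \<in> {1..2 * n}" "p \<noteq> q" for p q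
    proof -
      have "key n p \<noteq> key n q" using key_inj that by blast
      then show ?thesis using less.IH[OF that(1)] less.IH[OF that(2)] insert_commute[of p q "{}"]
        by (metis linorder_neqE_nat)
    qed
    \<comment> \<open>By \<open>side\<close>, q is at least as near to x as p. \<open>A\<close> and
      \<open>B\<close> stand for \<open>M\<close> and \<open>N\<close> in either order, so that one
      argument serves both comparisons.\<close>
    have key_step: "p = q"
      if A: "A \<in> noncrossing_matchings n" and B: "B \<in> noncrossing_matchings n"
        and p: "{x, p} \<in> A" "key n p < key n x" and q: "{x, q} \<in> B" "key n q < key n x"
        and k: "key n x = k"
        and ed: "\<And>p q. key n p < k \<Longrightarrow> key n q < k \<Longrightarrow> p \<in> {1..2 * n} \<Longrightarrow> q \<in> {1..2 * n} \<Longrightarrow>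
            p \<noteq> q \<Longrightarrow> {p, q} \<in> A \<longleftrightarrow> {p, q} \<in> B"
        and side: "(half_turn n p \<le> half_turn n q \<and> half_turn n q < half_turn n x) \<or>
                   (half_turn n x < half_turn n q \<and> half_turn n q \<le> half_turn n p)"
      for A B x p q
    proof (rule ccontr)
      assume "p \<noteq> q"
      have xX: "x \<in> {1..2 * n}" "p \<in> {1..2 * n}" "q \<in> {1..2 * n}"
        using noncrossing_mem[OF A p(1)] noncrossing_mem[OF B q(1)] by auto
      have "half_turn n p \<noteq> half_turn n q"
        using \<open>p \<noteq> q\<close> half_turn_twice xX by metis
      then have bt: "(half_turn n p < half_turn n q \<and> half_turn n q < half_turn n x) \<or>
                   (half_turn n x < half_turn n q \<and> half_turn n q < half_turn n p)"
        using side by linarith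
      \<comment> \<open>q lies under the edge {x, p} of \<open>A\<close>, so its partner r in
        \<open>A\<close> lies there too and comes before x in the spiral. By induction {q, r} is an
        edge of \<open>B\<close>, where q is already joined to x.\<close>
      have "\<exists>r. {q, r} \<in> A \<and> ((half_turn n p < half_turn n r \<and> half_turn n r < half_turn n x) \<or>
                   (half_turn n x < half_turn n r \<and> half_turn n r < half_turn n p))"
        using bt
      proof
        assume *: "half_turn n p < half_turn n q \<and> half_turn n q < half_turn n x"
        have "{p, x} \<in> A" using p by (simp add: insert_commute)
        then show ?thesis using nestedD[OF noncrossing_nested(2)[OF A] _ xX(3)] * by metis
      next
        assume *: "half_turn n x < half_turn n q \<and> half_turn n q < half_turn n p"
        show ?thesis using nestedD[OF noncrossing_nested(2)[OF A] p(1) xX(3)] * by metis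
      qed
      then obtain r where r: "{q, r} \<in> A" and rb:
         "(half_turn n p < half_turn n r \<and> half_turn n r < half_turn n x) \<or>
          (half_turn n x < half_turn n r \<and> half_turn n r < half_turn n p)" by blast
      have rX: "r \<in> {1..2 * n}" "q \<noteq> r" using noncrossing_mem[OF A r] by auto
      have "key n r < key n x" using key_less_between[OF xX(1,2) rX(1) p(2) rb] .
      then have "{q, r} \<in> B" using ed[of q r] r rX xX q k by blast
      then have "r = x" using q pairing_unique[OF noncrossing_pairing[OF B]] by (metis insert_commute)
      then show False using rb by simp
    qed
    show ?case
    proof (intro allI impI)
      fix x y assume k: "key n x = k" and less: "key n y < key n x"
      have main: "{x, y} \<in> B"
        if A: "A \<in> noncrossing_matchings n" and B: "B \<in> noncrossing_matchings n"
        and e: "{x, y} \<in> A" and cc: "closers n A = closers n B"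
        and ed: "\<And>p q. key n p < k \<Longrightarrow> key n q < k \<Longrightarrow> p \<in> {1..2 * n} \<Longrightarrow> q \<in> {1..2 * n} \<Longrightarrow>
            p \<noteq> q \<Longrightarrow> {p, q} \<in> A \<longleftrightarrow> {p, q} \<in> B"
        for A B
      proof -
        have "x \<in> closers n B" using e less cc unfolding closers_def by blast
        then obtain q where q: "{x, q} \<in> B" "key n q < key n x" unfolding closers_def by blast
        have X: "x \<in> {1..2 * n}" "y \<in> {1..2 * n}" "q \<in> {1..2 * n}"
          using noncrossing_mem[OF A e] noncrossing_mem[OF B q(1)] by auto
        have "half_turn n y \<noteq> half_turn n x" "half_turn n q \<noteq> half_turn n x"
          using X half_turn_twice less q(2) by (metis less_irrefl)+
        \<comment> \<open>Both partners lie on the side of x that is fixed by whether x is a value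
          or a bar, so one of them is at least as near as the other.\<close>
        then have "((half_turn n y \<le> half_turn n q \<and> half_turn n q < half_turn n x) \<or>
                   (half_turn n x < half_turn n q \<and> half_turn n q \<le> half_turn n y)) \<or>
            ((half_turn n q \<le> half_turn n y \<and> half_turn n y < half_turn n x) \<or>
                   (half_turn n x < half_turn n y \<and> half_turn n y \<le> half_turn n q))"
          using key_less_same_side[OF X(1,2) less] key_less_same_side[OF X(1,3) q(2)] by linarith
        then have "y = q"
          using key_step[OF A B e less q k ed] key_step[OF B A q e less k ed[symmetric]] by blast
        then show ?thesis using q by simp
      qed
      show "{x, y} \<in> M \<longleftrightarrow> {x, y} \<in> N"
        using main[OF M N _ c edge] main[OF N M _ c[symmetric] edge[symmetric]] by blast
    qed
  qed
  then show "{x, y} \<in> M \<Longrightarrow> key n y < key n x \<Longrightarrow> {x, y} \<in> N"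
    and "{x, y} \<in> N \<Longrightarrow> key n y < key n x \<Longrightarrow> {x, y} \<in> M" by blast+
qed

lemma inj_on_closers: "inj_on (closers n) (noncrossing_matchings n)"
proof (rule inj_onI)
  fix M N assume M: "M \<in> noncrossing_matchings n" and N: "N \<in> noncrossing_matchings n"
    and c: "closers n M = closers n N"
  have "A \<subseteq> B"
    if A: "A \<in> noncrossing_matchings n" and tr: "\<And>x y. {x, y} \<in> A \<Longrightarrow> key n y < key n x \<Longrightarrow> {x, y} \<in> B"
    for A B
  proof
    fix e assume e: "e \<in> A"
    obtain x y where xy: "e = {x, y}" "x \<noteq> y" using pairing_edge[OF noncrossing_pairing[OF A] e] .
    then have "key n x \<noteq> key n y" using key_inj noncrossing_mem[OF A] e by metis
    then show "e \<in> B" using tr[of x y] tr[of y x] e xy by (metis insert_commute linorder_neqE_nat)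
  qed
  then show "M = N"
    using closers_edge_transfer[OF M N c] M N by (metis subset_antisym)
qed

section \<open>Antichains of intervals\<close>

lemma antichain_less:
  assumes "A \<in> antichains X" "(i, j) \<in> A" "(i', j') \<in> A" "i < i'"
  shows "j < j'"
proof (rule ccontr)
  assume "\<not> j < j'"
  then have "interval_le (i', j') (i, j)" using assms(4) unfolding interval_le_def by auto
  then show False using assms unfolding antichains_def by fastforce
qed

lemma antichain_unique:
  assumes "A \<in> antichains X" "(i, j) \<in> A" "(i, j') \<in> A"
  shows "j = j'"
proof -
  have "interval_le (i, j) (i, j') \<or> interval_le (i, j') (i, j)" unfolding interval_le_def by auto
  then show ?thesis using assms unfolding antichains_def by fastforce
qed

lemma root_poset_A_bounds:
  assumes "A \<in> antichains (root_poset_A (n - 1))" "(i, j - 1) \<in> A"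
  shows "1 \<le> i" "i < j" "j \<le> n"
  using assms unfolding antichains_def root_poset_A_def by auto

section \<open>The Armstrong--Stump--Thomas algorithm\<close>

text \<open>For an antichain of intervals, round l commits exactly one base point, the point from
  which the search for a partner starts. Both the base points of the first i rounds and those of all
  n rounds enter the invariant.\<close>

definition actives :: "nat \<Rightarrow> (nat \<times> nat) set \<Rightarrow> nat \<Rightarrow> nat set" where
  "actives n A i =
     {j. \<exists>l\<le>i. (l, j - 1) \<in> A} \<union> {2 * n + 1 - l | l. 1 \<le> l \<and> l \<le> i \<and> (\<forall>j. (l, j) \<notin> A)}"

text \<open>The end point of an edge that is later in the spiral is a base point of a past round;
  the other one is not a base point of any round, not even of a future one. This is what keeps
  future base points free. The last two conditions confine the matched points: bars of index at most
  i, and values up to i or up to a point \<open>j\<close> of an interval already met.\<close>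

definition ast_inv :: "nat \<Rightarrow> (nat \<times> nat) set \<Rightarrow> nat \<Rightarrow> nat set set \<Rightarrow> bool" where
  "ast_inv n A i M \<longleftrightarrow> finite M \<and> pairing M \<and> card M = i \<and> \<Union>M \<subseteq> {1..2 * n} \<and>
     (\<forall>e\<in>M. \<exists>x y. e = {x, y} \<and> key n y < key n x \<and> x \<in> actives n A i \<and> y \<notin> actives n A n) \<and>
     actives n A i \<subseteq> \<Union>M \<and> nested (half_turn n) {1..2 * n} M \<and>
     (\<forall>x\<in>\<Union>M. n < x \<longrightarrow> 2 * n + 1 - i \<le> x) \<and>
     (\<forall>x\<in>\<Union>M. x \<le> n \<longrightarrow> x \<le> i \<or> (\<exists>l j. l \<le> i \<and> (l, j - 1) \<in> A \<and> x \<le> j))"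

text \<open>Turning both points by n keeps their clockwise distance; the case distinction is the
  passage across the cut between n and n+1.\<close>

lemma cw_dist_half_turn:
  assumes "x \<in> {1..2 * n}" "y \<in> {1..2 * n}"
  shows "cw_dist n x y =
    (if half_turn n x \<le> half_turn n y then half_turn n y - half_turn n x
     else 2 * n + half_turn n y - half_turn n x)"
proof -
  have eq: "cw_dist n x y = (if x \<le> y then y - x else 2 * n + y - x)"
  proof (cases "x \<le> y")
    case True
    then have "2 * n + y - x = (y - x) + 2 * n" by simp
    moreover have "y - x < 2 * n" using assms by auto
    ultimately show ?thesis using True unfolding cw_dist_def by (metis mod_add_self2 mod_less)
  next
    case False
    then have "2 * n + y - x < 2 * n" using assms by auto
    then show ?thesis using False unfolding cw_dist_def by (metis mod_less)
  qed
  consider "x \<le> n" "y \<le> n" | "x \<le> n" "n < y" | "n < x" "y \<le> n" | "n < x" "n < y"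
    by linarith
  then show ?thesis unfolding eq using assms by cases (auto simp: half_turn_def)
qed

text \<open>The unmatched point \<open>u0\<close> below \<open>v\<close> stops the search before the
  cut: any point above \<open>v\<close> is farther away. So the cyclic minimum is the greatest
  unmatched point below \<open>v\<close> in the cut order.\<close>

lemma nearest_ccw_spec:
  assumes v: "v \<in> {1..2 * n}" and u0: "u0 \<in> {1..2 * n}" "u0 \<notin> \<Union>M" "half_turn n u0 < half_turn n v"
  defines "u \<equiv> nearest_ccw n M v"
  shows "u \<in> {1..2 * n}" "u \<notin> \<Union>M" "half_turn n u0 \<le> half_turn n u" "half_turn n u < half_turn n v"
    and "c \<in> {1..2 * n} \<Longrightarrow> half_turn n u < half_turn n c \<Longrightarrow> half_turn n c < half_turn n v \<Longrightarrow> c \<in> \<Union>M"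
proof -
  let ?S = "{1..2 * n} - \<Union>M - {v}"
  let ?d = "\<lambda>w. cw_dist n w v"
  have u0S: "u0 \<in> ?S" using u0 by auto
  have uS: "u \<in> ?S" and min: "\<And>w. w \<in> ?S \<Longrightarrow> ?d u \<le> ?d w"
    using arg_min_nat_lemma[of "\<lambda>w. w \<in> ?S" u0 ?d] u0S unfolding u_def nearest_ccw_def by blast+
  then show u: "u \<in> {1..2 * n}" "u \<notin> \<Union>M" by auto
  have h: "half_turn n w \<in> {1..2 * n}" if "w \<in> {1..2 * n}" for w using half_turn_in that .
  have du0: "?d u0 = half_turn n v - half_turn n u0" using cw_dist_half_turn[OF u0(1) v] u0(3) by simp
  have "half_turn n u \<noteq> half_turn n v" using uS v half_turn_twice u(1) by (metis DiffD2 singletonI)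
  then show less: "half_turn n u < half_turn n v"
    using cw_dist_half_turn[OF u(1) v] min[OF u0S] du0 h[OF v] h[OF u(1)] h[OF u0(1)] u0(3)
    by (auto split: if_splits)
  have du: "?d u = half_turn n v - half_turn n u" using cw_dist_half_turn[OF u(1) v] less by simp
  show "half_turn n u0 \<le> half_turn n u" using min[OF u0S] du du0 less u0(3) by simp
  assume c: "c \<in> {1..2 * n}" "half_turn n u < half_turn n c" "half_turn n c < half_turn n v"
  have "?d c = half_turn n v - half_turn n c" using cw_dist_half_turn[OF c(1) v] c(3) by simp
  then have "c \<notin> ?S" using min[of c] du c by linarith
  then show "c \<in> \<Union>M" using c by auto
qed

text \<open>Mirror image of the counterclockwise search: the result is the least unmatched point
  above \<open>v\<close> in the cut order.\<close>

lemma nearest_cw_spec: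
  assumes v: "v \<in> {1..2 * n}" and u0: "u0 \<in> {1..2 * n}" "u0 \<notin> \<Union>M" "half_turn n v < half_turn n u0"
  defines "u \<equiv> nearest_cw n M v"
  shows "u \<in> {1..2 * n}" "u \<notin> \<Union>M" "half_turn n u \<le> half_turn n u0" "half_turn n v < half_turn n u"
    and "c \<in> {1..2 * n} \<Longrightarrow> half_turn n v < half_turn n c \<Longrightarrow> half_turn n c < half_turn n u \<Longrightarrow> c \<in> \<Union>M"
proof -
  let ?S = "{1..2 * n} - \<Union>M - {v}"
  let ?d = "\<lambda>w. cw_dist n v w"
  have u0S: "u0 \<in> ?S" using u0 by auto
  have uS: "u \<in> ?S" and min: "\<And>w. w \<in> ?S \<Longrightarrow> ?d u \<le> ?d w"
    using arg_min_nat_lemma[of "\<lambda>w. w \<in> ?S" u0 ?d] u0S unfolding u_def nearest_cw_def by blast+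
  then show u: "u \<in> {1..2 * n}" "u \<notin> \<Union>M" by auto
  have h: "half_turn n w \<in> {1..2 * n}" if "w \<in> {1..2 * n}" for w using half_turn_in that .
  have du0: "?d u0 = half_turn n u0 - half_turn n v" using cw_dist_half_turn[OF v u0(1)] u0(3) by simp
  have "half_turn n u \<noteq> half_turn n v" using uS v half_turn_twice u(1) by (metis DiffD2 singletonI)
  then show less: "half_turn n v < half_turn n u"
    using cw_dist_half_turn[OF v u(1)] min[OF u0S] du0 h[OF v] h[OF u(1)] h[OF u0(1)] u0(3)
    by (auto split: if_splits)
  have du: "?d u = half_turn n u - half_turn n v" using cw_dist_half_turn[OF v u(1)] less by simp
  show "half_turn n u \<le> half_turn n u0" using min[OF u0S] du du0 less u0(3) by simp
  assume c: "c \<in> {1..2 * n}" "half_turn n v < half_turn n c" "half_turn n c < half_turn n u"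
  have "?d c = half_turn n c - half_turn n v" using cw_dist_half_turn[OF v c(1)] c(2) by simp
  then have "c \<notin> ?S" using min[of c] du c by linarith
  then show "c \<in> \<Union>M" using c by auto
qed

text \<open>Since u and x are unmatched points of X, no old edge passes over them; the points
  strictly between are all matched, so their partners are trapped between u and x.\<close>

lemma nested_insert:
  assumes M: "nested f X M" "\<Union>M \<subseteq> X" and u: "u \<in> X" "u \<notin> \<Union>M" and x: "x \<in> X" "x \<notin> \<Union>M"
    and between: "\<And>c. c \<in> X \<Longrightarrow> f u < f c \<Longrightarrow> f c < f x \<Longrightarrow> c \<in> \<Union>M"
    and pm: "pairing M" and inj: "inj_on f X" and less: "f u < f x"
  shows "nested f X (insert {u, x} M)"
proof -
  have uncovered: "\<not> (f a < f y \<and> f y < f b)" if "{a, b} \<in> M" "y \<in> X" "y \<notin> \<Union>M" for a b y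
    using nestedD[OF M(1) that(1,2)] that(3) by blast
  show ?thesis
    unfolding nested_def
  proof (intro allI impI)
    fix a b c assume ab: "{a, b} \<in> insert {u, x} M" and c: "c \<in> X" "f a < f c" "f c < f b"
    show "\<exists>d. {c, d} \<in> insert {u, x} M \<and> f a < f d \<and> f d < f b"
    proof (cases "{a, b} \<in> M")
      case True
      then show ?thesis using nestedD[OF M(1) True c] by blast
    next
      case False
      then have "a = u" "b = x" using ab c less by (auto simp: doubleton_eq_iff)
      then obtain d where d: "{c, d} \<in> M" using between[OF c(1)] c pairing_partner[OF pm] by metis
      then have dX: "d \<in> X" "d \<noteq> u" "d \<noteq> x" using M(2) u(2) x(2) by auto
      have d': "{d, c} \<in> M" using d by (simp add: insert_commute)
      have "f d \<noteq> f u" "f d \<noteq> f x" using dX inj u(1) x(1) by (auto simp: inj_on_eq_iff)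
      then have "f u < f d" "f d < f x"
        using uncovered[OF d x] uncovered[OF d' u] uncovered[OF d u] uncovered[OF d' x]
          c[unfolded \<open>a = u\<close> \<open>b = x\<close>] by linarith+
      then show ?thesis using d \<open>a = u\<close> \<open>b = x\<close> by blast
    qed
  qed
qed

text \<open>Pigeonhole: the arc from bar i through bar 1 and 1 to i+1 has 2i+1 points, and i edges
  cover only 2i.\<close>

lemma ast_inv_unmatched:
  assumes inv: "ast_inv n A i M" and i: "i < n"
  obtains u where "u \<in> {1..2 * n}" "u \<notin> \<Union>M" "u \<le> Suc i \<or> 2 * n + 1 - i \<le> u"
proof -
  let ?Z = "{1..Suc i} \<union> {2 * n + 1 - i..2 * n}"
  have "card ?Z = card {1..Suc i} + card {2 * n + 1 - i..2 * n}"
    using i by (intro card_Un_disjoint) auto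
  then have "card ?Z = 2 * i + 1" using i by simp
  moreover have M: "finite M" "pairing M" "card M = i" "\<Union>M \<subseteq> {1..2 * n}"
    using inv unfolding ast_inv_def by simp_all
  have fin: "finite (\<Union>M)" using finite_subset[OF M(4)] by simp
  moreover have "card (\<Union>M) = 2 * i" using pairing_card[OF M(2,1)] M(3) by simp
  ultimately have "\<not> ?Z \<subseteq> \<Union>M" using card_mono[OF fin, of ?Z] by linarith
  then obtain u where "u \<in> ?Z" "u \<notin> \<Union>M" by blast
  then show ?thesis using that[of u] i by auto
qed

lemma ex_le_Suc_iff: "(\<exists>l\<le>Suc i. P l) \<longleftrightarrow> P (Suc i) \<or> (\<exists>l\<le>i. P l)"
  using le_Suc_eq by auto

lemma actives_mono: "i \<le> k \<Longrightarrow> actives n A i \<subseteq> actives n A k"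
  unfolding actives_def by (intro Un_mono Collect_mono) (metis le_trans)+

text \<open>The part common to both kinds of rounds: x is the base point of round i+1 and u the
  partner found. Either of them may come first in the cut order.\<close>

lemma ast_inv_insert:
  assumes inv: "ast_inv n A i M" and i: "i < n"
    and x: "x \<in> {1..2 * n}" "x \<notin> actives n A i" "actives n A (Suc i) = insert x (actives n A i)"
    and u: "u \<in> {1..2 * n}" "u \<notin> \<Union>M" "u \<notin> actives n A n" "key n u < key n x"
    and between: "\<And>c. c \<in> {1..2 * n} \<Longrightarrow> half_turn n u < half_turn n c \<and> half_turn n c < half_turn n x \<or>
       half_turn n x < half_turn n c \<and> half_turn n c < half_turn n u \<Longrightarrow> c \<in> \<Union>M"
    and bar: "\<And>z. z \<in> {x, u} \<Longrightarrow> n < z \<Longrightarrow> 2 * n + 1 - Suc i \<le> z"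
    and val: "\<And>z. z \<in> {x, u} \<Longrightarrow> z \<le> n \<Longrightarrow> z \<le> Suc i \<or> (\<exists>l j. l \<le> Suc i \<and> (l, j - 1) \<in> A \<and> z \<le> j)"
  shows "x \<notin> \<Union>M" "ast_inv n A (Suc i) (insert {x, u} M)"
proof -
  have M: "finite M" "pairing M" "card M = i" "\<Union>M \<subseteq> {1..2 * n}"
    "\<forall>e\<in>M. \<exists>x y. e = {x, y} \<and> key n y < key n x \<and> x \<in> actives n A i \<and> y \<notin> actives n A n"
    "actives n A i \<subseteq> \<Union>M" "nested (half_turn n) {1..2 * n} M"
    "\<forall>x\<in>\<Union>M. n < x \<longrightarrow> 2 * n + 1 - i \<le> x"
    "\<forall>x\<in>\<Union>M. x \<le> n \<longrightarrow> x \<le> i \<or> (\<exists>l j. l \<le> i \<and> (l, j - 1) \<in> A \<and> x \<le> j)"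
    using inv unfolding ast_inv_def by blast+
  have mono: "actives n A (Suc i) \<subseteq> actives n A n" "actives n A i \<subseteq> actives n A (Suc i)"
    using i by (auto intro!: actives_mono)
  have xn: "x \<in> actives n A n" using x(3) mono by auto
  \<comment> \<open>A matched point is a base point of an earlier round or of no round at all, while
    x is the base point of the present one.\<close>
  show xM: "x \<notin> \<Union>M"
  proof
    assume "x \<in> \<Union>M"
    then obtain e where e: "e \<in> M" "x \<in> e" by blast
    then obtain y z where "e = {y, z}" "y \<in> actives n A i" "z \<notin> actives n A n" using M(5) by meson
    then show False using e(2) x(2) xn by auto
  qed
  have ne: "x \<noteq> u" using u(4) by auto
  have hne: "half_turn n x \<noteq> half_turn n u" using ne half_turn_twice x(1) u(1) by metis
  have nest: "nested (half_turn n) {1..2 * n} (insert {x, u} M)"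
  proof (cases "half_turn n u < half_turn n x")
    case True
    then have "nested (half_turn n) {1..2 * n} (insert {u, x} M)"
      using between by (intro nested_insert[OF M(7,4) u(1,2) x(1) xM _ M(2) half_turn_inj_on]) blast+
    then show ?thesis by (simp add: insert_commute)
  next
    case False
    then show ?thesis
      using between hne by (intro nested_insert[OF M(7,4) x(1) xM u(1,2) _ M(2) half_turn_inj_on]) force+
  qed
  have "{x, u} \<notin> M" using xM by auto
  then have "card (insert {x, u} M) = Suc i" using M(1,3) by simp
  moreover have "pairing (insert {x, u} M)" using pairing_insert[OF M(2) xM u(2) ne] .
  moreover have "\<forall>e\<in>insert {x, u} M. \<exists>x y. e = {x, y} \<and> key n y < key n x \<and>
      x \<in> actives n A (Suc i) \<and> y \<notin> actives n A n"
  proof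
    fix e assume "e \<in> insert {x, u} M"
    then consider "e = {x, u}" | "e \<in> M" by blast
    then show "\<exists>x y. e = {x, y} \<and> key n y < key n x \<and> x \<in> actives n A (Suc i) \<and> y \<notin> actives n A n"
    proof cases
      case 1
      have "x \<in> actives n A (Suc i)" using x(3) by blast
      then show ?thesis using 1 u(3,4) by blast
    next
      case 2
      obtain a b where ab: "e = {a, b}" "key n b < key n a" "a \<in> actives n A i" "b \<notin> actives n A n"
        using bspec[OF M(5) 2] by blast
      have "a \<in> actives n A (Suc i)" using ab(3) mono(2) by blast
      then show ?thesis using ab by blast
    qed
  qed
  moreover have "\<Union>(insert {x, u} M) \<subseteq> {1..2 * n}" using M(4) x(1) u(1) by auto
  moreover have "actives n A (Suc i) \<subseteq> \<Union>(insert {x, u} M)" using x(3) M(6) by auto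
  moreover have "\<forall>y\<in>\<Union>(insert {x, u} M). n < y \<longrightarrow> 2 * n + 1 - Suc i \<le> y"
  proof (intro ballI impI)
    fix y assume y: "y \<in> \<Union>(insert {x, u} M)" "n < y"
    show "2 * n + 1 - Suc i \<le> y"
    proof (cases "y \<in> \<Union>M")
      case True
      then have "2 * n + 1 - i \<le> y" using M(8) y(2) by blast
      then show ?thesis by linarith
    next
      case False
      then show ?thesis using bar[of y] y by auto
    qed
  qed
  moreover have "\<forall>y\<in>\<Union>(insert {x, u} M). y \<le> n \<longrightarrow>
      y \<le> Suc i \<or> (\<exists>l j. l \<le> Suc i \<and> (l, j - 1) \<in> A \<and> y \<le> j)"
  proof (intro ballI impI)
    fix y assume y: "y \<in> \<Union>(insert {x, u} M)" "y \<le> n"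
    show "y \<le> Suc i \<or> (\<exists>l j. l \<le> Suc i \<and> (l, j - 1) \<in> A \<and> y \<le> j)"
    proof (cases "y \<in> \<Union>M")
      case True
      then show ?thesis using M(9) y(2) by (meson le_SucI)
    next
      case False
      then show ?thesis using val[of y] y by auto
    qed
  qed
  ultimately show "ast_inv n A (Suc i) (insert {x, u} M)"
    using M(1) nest unfolding ast_inv_def by simp
qed

section \<open>The two kinds of rounds\<close>

text \<open>The partner u is no base point of any round. If a value u < j came from an interval,
  this interval would start before i+1, because ends increase with starts in an antichain; and a bar
  that the search can reach has index at most i. Either way u would be matched already.\<close>

lemma ast_step_start:
  assumes A: "A \<in> antichains (root_poset_A (n - 1))" and inv: "ast_inv n A i M" and i: "i < n"
    and j: "(Suc i, j - 1) \<in> A"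
  obtains u where "ast_step n A (Suc i) M = insert {j, u} M" "u \<in> {1..2 * n}" "u \<notin> \<Union>M" "j \<notin> \<Union>M"
    "half_turn n u < half_turn n j"
    "\<And>c. c \<in> {1..2 * n} \<Longrightarrow> half_turn n u < half_turn n c \<Longrightarrow> half_turn n c < half_turn n j \<Longrightarrow> c \<in> \<Union>M"
    "n < u \<Longrightarrow> 2 * n + 1 - i \<le> u" "ast_inv n A (Suc i) (insert {j, u} M)"
proof -
  note jb = root_poset_A_bounds[OF A j]
  have act: "actives n A i \<subseteq> \<Union>M" using inv unfolding ast_inv_def by blast
  have jX: "j \<in> {1..2 * n}" using jb by auto
  \<comment> \<open>All candidates are positive, so equality after the truncated subtraction of 1
    gives equality.\<close>
  have "(THE j. (Suc i, j - 1) \<in> A) = j"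
  proof (rule the_equality[of _ j])
    fix j' assume j': "(Suc i, j' - 1) \<in> A"
    then show "j' = j" using antichain_unique[OF A j j'] root_poset_A_bounds[OF A j'] jb by linarith
  qed (rule j)
  define u where "u = nearest_ccw n M j"
  have step: "ast_step n A (Suc i) M = insert {j, u} M"
    using j \<open>(THE j. _) = j\<close> unfolding ast_step_def u_def by (auto simp: Let_def)
  obtain u0 where u0: "u0 \<in> {1..2 * n}" "u0 \<notin> \<Union>M" "u0 \<le> Suc i \<or> 2 * n + 1 - i \<le> u0"
    using ast_inv_unmatched[OF inv i] .
  have hj: "half_turn n j = j + n" using jb unfolding half_turn_def by auto
  \<comment> \<open>The arc lies below j because i+1 < j, so the search from j ends at the latest at
    the far end of the arc.\<close>
  have hu0: "half_turn n u0 < half_turn n j" "n + 1 - i \<le> half_turn n u0"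
  proof -
    consider "u0 \<le> n" "u0 \<le> Suc i" | "n < u0" "2 * n + 1 - i \<le> u0" using u0(3) i by linarith
    then have "half_turn n u0 < j + n \<and> n + 1 - i \<le> half_turn n u0"
      using u0(1) jb i by cases (auto simp: half_turn_def)
    then show "half_turn n u0 < half_turn n j" "n + 1 - i \<le> half_turn n u0" using hj by simp_all
  qed
  note u = nearest_ccw_spec[OF jX u0(1,2) hu0(1), folded u_def]
  have ubar: "2 * n + 1 - i \<le> u" if "n < u" using that hu0(2) u(1,3) i unfolding half_turn_def by auto
  have uval: "u < j" if "u \<le> n" using that u(4) hj unfolding half_turn_def by auto
  have opener: "u \<notin> actives n A n"
  proof
    assume "u \<in> actives n A n"
    then consider l where "(l, u - 1) \<in> A"
      | l where "u = 2 * n + 1 - l" "1 \<le> l" "l \<le> n" "\<forall>j. (l, j) \<notin> A"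
      unfolding actives_def by blast
    then have "u \<in> actives n A i"
    proof cases
      case 1
      note lb = root_poset_A_bounds[OF A 1]
      have "u < j" using uval lb by simp
      have "\<not> Suc i < l" using antichain_less[OF A j 1] \<open>u < j\<close> by auto
      moreover have "l \<noteq> Suc i" using antichain_unique[OF A j, of "u - 1"] 1 \<open>u < j\<close> lb jb by auto
      ultimately have "l \<le> i" by linarith
      then show ?thesis using 1 unfolding actives_def by auto
    next
      case 2
      then have "l \<le> i" using ubar by linarith
      then show ?thesis using 2 unfolding actives_def by blast
    qed
    then show False using act u(2) by blast
  qed
  have k: "key n u < key n j"
    using ubar uval u(1) jb i unfolding key_def by (cases "u \<le> n") auto
  have jact: "j \<notin> actives n A i"
  proof
    assume "j \<in> actives n A i"
    then consider l where "(l, j - 1) \<in> A" "l \<le> i" | l where "j = 2 * n + 1 - l" "l \<le> i"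
      unfolding actives_def by blast
    then show False
    proof cases
      case 1
      then show False using antichain_less[OF A 1(1) j] by simp
    qed (use jb i in linarith)
  qed
  have actS: "actives n A (Suc i) = insert j (actives n A i)"
  proof -
    have "j' = j" if "(Suc i, j' - 1) \<in> A" for j'
      using antichain_unique[OF A j that] root_poset_A_bounds[OF A that] jb by linarith
    then have "{j. \<exists>l\<le>Suc i. (l, j - 1) \<in> A} = insert j {j. \<exists>l\<le>i. (l, j - 1) \<in> A}"
      unfolding ex_le_Suc_iff using j by blast
    moreover have "{2 * n + 1 - l |l. 1 \<le> l \<and> l \<le> Suc i \<and> (\<forall>j. (l, j) \<notin> A)} =
        {2 * n + 1 - l |l. 1 \<le> l \<and> l \<le> i \<and> (\<forall>j. (l, j) \<notin> A)}"
      using j le_Suc_eq by (metis (lifting))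
    ultimately show ?thesis unfolding actives_def by simp
  qed
  have ins: "j \<notin> \<Union>M \<and> ast_inv n A (Suc i) (insert {j, u} M)"
  proof (intro conjI; rule ast_inv_insert[OF inv i jX jact actS u(1,2) opener k])
    show "z \<le> Suc i \<or> (\<exists>l ja. l \<le> Suc i \<and> (l, ja - 1) \<in> A \<and> z \<le> ja)"
      if "z \<in> {j, u}" "z \<le> n" for z using that j uval by fastforce
    then show "z \<le> Suc i \<or> (\<exists>l ja. l \<le> Suc i \<and> (l, ja - 1) \<in> A \<and> z \<le> ja)"
      if "z \<in> {j, u}" "z \<le> n" for z using that .
    show "2 * n + 1 - Suc i \<le> z" if "z \<in> {j, u}" "n < z" for z
      using that ubar jb by auto
    then show "2 * n + 1 - Suc i \<le> z" if "z \<in> {j, u}" "n < z" for z using that .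
  qed (use u(4,5) in auto)
  show ?thesis
    by (rule that[OF step u(1,2) _ u(4) u(5) ubar]) (use ins in blast)+
qed

text \<open>The arc follows bar (i+1) directly in clockwise direction, so u is a bar of index at
  most i or a value at most i+1. Such a value, if it came from an interval, would belong to one that
  starts at i or earlier and would be matched already.\<close>

lemma ast_step_other:
  assumes A: "A \<in> antichains (root_poset_A (n - 1))" and inv: "ast_inv n A i M" and i: "i < n"
    and other: "\<And>j. (Suc i, j) \<notin> A"
  defines "x \<equiv> 2 * n + 1 - Suc i"
  obtains u where "ast_step n A (Suc i) M = insert {x, u} M" "u \<in> {1..2 * n}" "u \<notin> \<Union>M" "x \<notin> \<Union>M"
    "half_turn n x < half_turn n u"
    "\<And>c. c \<in> {1..2 * n} \<Longrightarrow> half_turn n x < half_turn n c \<Longrightarrow> half_turn n c < half_turn n u \<Longrightarrow> c \<in> \<Union>M"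
    "ast_inv n A (Suc i) (insert {x, u} M)"
proof -
  have act: "actives n A i \<subseteq> \<Union>M" using inv unfolding ast_inv_def by blast
  have xX: "x \<in> {1..2 * n}" "n < x" using i unfolding x_def by auto
  define u where "u = nearest_cw n M x"
  have step: "ast_step n A (Suc i) M = insert {x, u} M"
    using other unfolding ast_step_def u_def x_def by (auto simp: Let_def)
  obtain u0 where u0: "u0 \<in> {1..2 * n}" "u0 \<notin> \<Union>M" "u0 \<le> Suc i \<or> 2 * n + 1 - i \<le> u0"
    using ast_inv_unmatched[OF inv i] .
  have hx: "half_turn n x = n - i" using i unfolding half_turn_def x_def by auto
  have hu0: "half_turn n x < half_turn n u0" "half_turn n u0 \<le> n + Suc i"
  proof -
    consider "u0 \<le> n" "u0 \<le> Suc i" | "n < u0" "2 * n + 1 - i \<le> u0" using u0(3) i by linarith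
    then have "n - i < half_turn n u0 \<and> half_turn n u0 \<le> n + Suc i"
      using u0(1) i by cases (auto simp: half_turn_def)
    then show "half_turn n x < half_turn n u0" "half_turn n u0 \<le> n + Suc i" using hx by simp_all
  qed
  note u = nearest_cw_spec[OF xX(1) u0(1,2) hu0(1), folded u_def]
  have ubar: "2 * n + 1 - i \<le> u" if "n < u" using that u(1,4) i unfolding hx unfolding half_turn_def by auto
  have uval: "u \<le> Suc i" if "u \<le> n" using that u(1,3) hu0(2) unfolding half_turn_def by auto
  have opener: "u \<notin> actives n A n"
  proof
    assume "u \<in> actives n A n"
    then consider l where "(l, u - 1) \<in> A"
      | l where "u = 2 * n + 1 - l" "1 \<le> l" "l \<le> n" "\<forall>j. (l, j) \<notin> A"
      unfolding actives_def by blast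
    then have "u \<in> actives n A i"
    proof cases
      case 1
      note lb = root_poset_A_bounds[OF A 1]
      have "l \<le> i" using uval lb by simp
      then show ?thesis using 1 unfolding actives_def by auto
    next
      case 2
      then have "l \<le> i" using ubar by linarith
      then show ?thesis using 2 unfolding actives_def by blast
    qed
    then show False using act u(2) by blast
  qed
  have k: "key n u < key n x"
    using ubar uval u(1) i unfolding key_def x_def by (cases "u \<le> n") auto
  have xact: "x \<notin> actives n A i"
  proof
    assume "x \<in> actives n A i"
    then consider l where "(l, x - 1) \<in> A" "l \<le> i" | l where "x = 2 * n + 1 - l" "l \<le> i"
      unfolding actives_def by blast
    then show False
    proof cases
      case 1
      then show False using root_poset_A_bounds[OF A 1(1)] xX by simp
    qed (use x_def i in linarith)
  qed
  have actS: "actives n A (Suc i) = insert x (actives n A i)"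
  proof -
    have "{j. \<exists>l\<le>Suc i. (l, j - 1) \<in> A} = {j. \<exists>l\<le>i. (l, j - 1) \<in> A}"
      unfolding ex_le_Suc_iff using other by blast
    moreover have "{2 * n + 1 - l |l. 1 \<le> l \<and> l \<le> Suc i \<and> (\<forall>j. (l, j) \<notin> A)} =
        insert x {2 * n + 1 - l |l. 1 \<le> l \<and> l \<le> i \<and> (\<forall>j. (l, j) \<notin> A)}" (is "?L = ?R")
    proof (intro equalityI subsetI)
      fix z assume "z \<in> ?L"
      then obtain l where l: "z = 2 * n + 1 - l" "1 \<le> l" "l \<le> Suc i" "\<forall>j. (l, j) \<notin> A" by blast
      show "z \<in> ?R"
      proof (cases "l = Suc i")
        case False
        then have "l \<le> i" using l(3) by simp
        then show ?thesis using l by blast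
      qed (use l x_def in simp)
    next
      fix z assume "z \<in> ?R"
      then consider "z = x" | l where "z = 2 * n + 1 - l" "1 \<le> l" "l \<le> i" "\<forall>j. (l, j) \<notin> A" by blast
      then show "z \<in> ?L"
      proof cases
        case 1
        have "1 \<le> Suc i" by simp
        then show ?thesis using 1 other x_def by blast
      next
        case 2
        then have "l \<le> Suc i" by simp
        then show ?thesis using 2 by blast
      qed
    qed
    ultimately show ?thesis unfolding actives_def by simp
  qed
  have ins: "x \<notin> \<Union>M \<and> ast_inv n A (Suc i) (insert {x, u} M)"
  proof (intro conjI; rule ast_inv_insert[OF inv i xX(1) xact actS u(1,2) opener k])
    show "z \<le> Suc i \<or> (\<exists>l ja. l \<le> Suc i \<and> (l, ja - 1) \<in> A \<and> z \<le> ja)"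
      if "z \<in> {x, u}" "z \<le> n" for z using that uval xX by auto
    then show "z \<le> Suc i \<or> (\<exists>l ja. l \<le> Suc i \<and> (l, ja - 1) \<in> A \<and> z \<le> ja)"
      if "z \<in> {x, u}" "z \<le> n" for z using that .
    show "2 * n + 1 - Suc i \<le> z" if "z \<in> {x, u}" "n < z" for z
      using that ubar x_def by auto
    then show "2 * n + 1 - Suc i \<le> z" if "z \<in> {x, u}" "n < z" for z using that .
  qed (use u(4,5) in auto)
  show ?thesis
    by (rule that[OF step u(1,2) _ u(4) u(5)]) (use ins in blast)+
qed

definition ast_state :: "nat \<Rightarrow> (nat \<times> nat) set \<Rightarrow> nat \<Rightarrow> nat set set" where
  "ast_state n A i = fold (ast_step n A) [1..<i + 1] {}"

lemma ast_state_0: "ast_state n A 0 = {}"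
  and ast_state_Suc: "ast_state n A (Suc i) = ast_step n A (Suc i) (ast_state n A i)"
  unfolding ast_state_def by simp_all

lemma ast_state_inv:
  assumes A: "A \<in> antichains (root_poset_A (n - 1))"
  shows "i \<le> n \<Longrightarrow> ast_inv n A i (ast_state n A i)"
proof (induction i)
  case 0
  have "actives n A 0 = {}" using root_poset_A_bounds[OF A] unfolding actives_def by fastforce
  then show ?case unfolding ast_inv_def ast_state_0 by (simp add: pairing_empty nested_def)
next
  case (Suc i)
  then have inv: "ast_inv n A i (ast_state n A i)" and i: "i < n" by auto
  show ?case
  proof (cases "\<exists>j. (Suc i, j) \<in> A")
    case True
    then obtain j where "(Suc i, j) \<in> A" by blast
    then have "(Suc i, Suc j - 1) \<in> A" by simp
    then show ?thesis using ast_step_start[OF A inv i] unfolding ast_state_Suc by metis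
  next
    case False
    then show ?thesis using ast_step_other[OF A inv i] unfolding ast_state_Suc by metis
  qed
qed

text \<open>After n rounds the disjoint edges fill all 2n points, so nestedness turns into the
  absence of crossings; each edge has exactly one end point in \<open>actives n A n\<close>, and
  this is its closer.\<close>

lemma AST_closers:
  assumes A: "A \<in> antichains (root_poset_A (n - 1))"
  shows "AST n A \<in> noncrossing_matchings n" "closers n (AST n A) = actives n A n"
proof -
  let ?M = "AST n A"
  have "?M = ast_state n A n" unfolding AST_def ast_state_def by simp
  then have "ast_inv n A n ?M" using ast_state_inv[OF A order_refl] by simp
  then have M: "finite ?M" "pairing ?M" "card ?M = n" "\<Union>?M \<subseteq> {1..2 * n}"
    "\<And>e. e \<in> ?M \<Longrightarrow> \<exists>x y. e = {x, y} \<and> key n y < key n x \<and> x \<in> actives n A n \<and> y \<notin> actives n A n"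
    "actives n A n \<subseteq> \<Union>?M" "nested (half_turn n) {1..2 * n} ?M"
    unfolding ast_inv_def by auto
  have "card (\<Union>?M) = card {1..2 * n}" using pairing_card[OF M(2,1)] M(3) by simp
  then have U: "\<Union>?M = {1..2 * n}" using M(4) card_subset_eq by blast
  have "crossing_free (half_turn n) ?M" using nested_imp_crossing_free[OF M(2,4,7)] .
  then show "?M \<in> noncrossing_matchings n"
    using M(2) U crossing_free_half_turn[of ?M n] by (simp add: noncrossing_matchings_iff)
  show "closers n ?M = actives n A n"
  proof (intro equalityI subsetI)
    fix x assume "x \<in> closers n ?M"
    then obtain y where y: "{x, y} \<in> ?M" "key n y < key n x" unfolding closers_def by blast
    then show "x \<in> actives n A n" using M(5)[OF y(1)] by (auto simp: doubleton_eq_iff)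
  next
    fix x assume x: "x \<in> actives n A n"
    then obtain e where e: "e \<in> ?M" "x \<in> e" using M(6) by blast
    then obtain a b where ab: "e = {a, b}" "key n b < key n a" "b \<notin> actives n A n" using M(5) by blast
    then have "x = a" using e(2) x by auto
    then show "x \<in> closers n ?M" using ab e unfolding closers_def by blast
  qed
qed

section \<open>Order isomorphisms between finite sets of numbers\<close>

lemma ex_strict_mono_bij_betw:
  fixes X Y :: "nat set"
  assumes "finite X" "finite Y" "card X = card Y"
  obtains f where "bij_betw f X Y" "strict_mono_on X f"
proof -
  obtain g where g: "bij_betw g {..<card X} X" "strict_mono_on {..<card X} g"
    using ex_bij_betw_strict_mono_card[OF assms(1)] .
  obtain h where h: "bij_betw h {..<card Y} Y" "strict_mono_on {..<card Y} h"
    using ex_bij_betw_strict_mono_card[OF assms(2)] .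
  let ?g' = "inv_into {..<card X} g"
  have g': "bij_betw ?g' X {..<card X}" using bij_betw_inv_into[OF g(1)] .
  have "bij_betw (h \<circ> ?g') X Y" using bij_betw_trans[OF g'] h(1) assms(3) by metis
  moreover have "strict_mono_on X (h \<circ> ?g')"
  proof (rule strict_mono_onI)
    fix r s assume rs: "r \<in> X" "s \<in> X" "r < s"
    have mem: "?g' r \<in> {..<card X}" "?g' s \<in> {..<card X}" using g' rs bij_betwE by blast+
    have inv: "g (?g' r) = r" "g (?g' s) = s" using g(1) rs by (auto simp: bij_betw_inv_into_right)
    have "?g' r < ?g' s"
    proof (rule ccontr)
      assume "\<not> ?g' r < ?g' s"
      then have "g (?g' s) \<le> g (?g' r)"
        using strict_mono_on_leD[OF g(2) mem(2) mem(1)] by simp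
      then show False using inv rs(3) by simp
    qed
    then show "(h \<circ> ?g') r < (h \<circ> ?g') s"
      using strict_mono_onD[OF h(2)] mem assms(3) by simp
  qed
  ultimately show ?thesis using that by blast
qed

text \<open>Monotonicity enters the later arguments in this form: positions and values are compared
  through the number of smaller elements.\<close>

lemma strict_mono_bij_rank:
  fixes X Y :: "nat set"
  assumes "bij_betw f X Y" "strict_mono_on X f" "x \<in> X"
  shows "card {y \<in> Y. y < f x} = card {z \<in> X. z < x}"
proof -
  have "f ` {z \<in> X. z < x} = {y \<in> Y. y < f x}"
  proof (intro equalityI subsetI)
    fix y assume "y \<in> f ` {z \<in> X. z < x}"
    then obtain z where z: "z \<in> X" "z < x" "y = f z" by blast
    then show "y \<in> {y \<in> Y. y < f x}"
      using strict_mono_onD[OF assms(2) z(1) assms(3) z(2)] bij_betwE[OF assms(1)] by blast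
  next
    fix y assume "y \<in> {y \<in> Y. y < f x}"
    then obtain z where z: "z \<in> X" "y = f z" "f z < f x" using assms(1) unfolding bij_betw_def by blast
    then have "z < x" using strict_mono_on_leD[OF assms(2,3) z(1)] by linarith
    then show "y \<in> f ` {z \<in> X. z < x}" using z by blast
  qed
  moreover have "inj_on f {z \<in> X. z < x}"
    by (rule inj_on_subset[OF bij_betw_imp_inj_on[OF assms(1)]]) blast
  ultimately show ?thesis using card_image[of f "{z \<in> X. z < x}"] by simp
qed

lemma rank_inj:
  fixes Y :: "nat set"
  assumes "finite Y" "y \<in> Y" "z \<in> Y" "card {w \<in> Y. w < y} = card {w \<in> Y. w < z}"
  shows "y = z"
proof -
  have less: "card {w \<in> Y. w < a} < card {w \<in> Y. w < b}" if "a \<in> Y" "a < b" for a b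
    using that assms(1) by (intro psubset_card_mono) auto
  show ?thesis using less[OF assms(2), of z] less[OF assms(3), of y] assms(4) by linarith
qed

text \<open>Serves to restrict a bijection to symmetric objects: \<open>f\<close> carries the
  symmetry \<open>g\<close> over to \<open>g'\<close>, and by injectivity no fixed point is gained
  or lost.\<close>

lemma bij_betw_fixed_points:
  assumes "bij_betw f X Y" "\<And>x. x \<in> X \<Longrightarrow> g x \<in> X" "\<And>x. x \<in> X \<Longrightarrow> f (g x) = g' (f x)"
  shows "bij_betw f {x \<in> X. g x = x} {y \<in> Y. g' y = y}"
  unfolding bij_betw_def
proof
  show "inj_on f {x \<in> X. g x = x}"
    by (rule inj_on_subset[OF bij_betw_imp_inj_on[OF assms(1)]]) blast
  have iff: "g x = x \<longleftrightarrow> g' (f x) = f x" if "x \<in> X" for x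
    using inj_on_eq_iff[OF bij_betw_imp_inj_on[OF assms(1)] assms(2)[OF that] that] assms(3)[OF that] by simp
  have im: "f ` X = Y" using bij_betw_imp_surj_on[OF assms(1)] .
  show "f ` {x \<in> X. g x = x} = {y \<in> Y. g' y = y}"
    using iff im by blast
qed

section \<open>Antichains are determined by their end points\<close>

text \<open>Sorting an antichain of intervals by start also sorts it by end. Hence the sets of
  starts and ends determine how they are joined.\<close>

lemma antichain_rank:
  assumes A: "A \<in> antichains X" and ij: "(i, j) \<in> A"
  shows "card {a \<in> fst ` A. a < i} = card {b \<in> snd ` A. b < j}"
proof -
  have inj: "inj_on fst A"
    using antichain_unique[OF A] by (auto simp: inj_on_def)
  have inj': "inj_on snd A"
    using antichain_less[OF A] by (auto simp: inj_on_def) (metis linorder_neqE_nat less_irrefl)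
  have "{p \<in> A. fst p < i} = {p \<in> A. snd p < j}"
  proof -
    have "a < i \<longleftrightarrow> b < j" if "(a, b) \<in> A" for a b
      using antichain_less[OF A that ij] antichain_less[OF A ij that] antichain_unique[OF A ij, of b] that
      by (metis less_asym linorder_neqE_nat less_irrefl)
    then show ?thesis by auto
  qed
  moreover have "{a \<in> fst ` A. a < i} = fst ` {p \<in> A. fst p < i}" by auto
  moreover have "{b \<in> snd ` A. b < j} = snd ` {p \<in> A. snd p < j}" by auto
  ultimately show ?thesis
    using card_image[OF inj_on_subset[OF inj, of "{p \<in> A. fst p < i}"]]
      card_image[OF inj_on_subset[OF inj', of "{p \<in> A. snd p < j}"]] by auto
qed

lemma antichain_eqI:
  assumes A: "A \<in> antichains X" and B: "B \<in> antichains X" and X: "finite X"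
    and "fst ` A = fst ` B" "snd ` A = snd ` B"
  shows "A = B"
proof -
  have "P \<subseteq> Q"
    if P: "P \<in> antichains X" and Q: "Q \<in> antichains X" and eq: "fst ` P = fst ` Q" "snd ` P = snd ` Q" for P Q
  proof
    fix p assume "p \<in> P"
    then obtain i j where p: "p = (i, j)" "(i, j) \<in> P" by (cases p) auto
    then have "i \<in> fst ` Q" using eq(1) by force
    then obtain j' where q: "(i, j') \<in> Q" by auto
    have "finite Q" using Q X finite_subset unfolding antichains_def by blast
    then have "finite (snd ` Q)" by simp
    moreover have "j \<in> snd ` Q" "j' \<in> snd ` Q" using p q eq(2) by force+
    moreover have "card {b \<in> snd ` Q. b < j} = card {b \<in> snd ` Q. b < j'}"
      using antichain_rank[OF P p(2)] antichain_rank[OF Q q] eq by simp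
    ultimately have "j = j'" by (rule rank_inj)
    then show "p \<in> Q" using p q by simp
  qed
  then show ?thesis using assms by (metis subset_antisym)
qed

lemma finite_root_poset_A: "finite (root_poset_A N)"
  by (rule finite_subset[of _ "{1..N} \<times> {1..N}"]) (auto simp: root_poset_A_def)

lemma actives_low_iff:
  assumes "v \<le> n"
  shows "v \<in> actives n A n \<longleftrightarrow> (\<exists>l\<le>n. (l, v - 1) \<in> A)"
proof -
  have "v \<noteq> 2 * n + 1 - l" if "l \<le> n" for l using assms that by linarith
  then have "v \<notin> {2 * n + 1 - l |l. 1 \<le> l \<and> l \<le> n \<and> (\<forall>j. (l, j) \<notin> A)}" by blast
  then show ?thesis unfolding actives_def Un_iff by blast
qed

lemma actives_bar_iff:
  assumes A: "A \<in> antichains (root_poset_A (n - 1))" and l: "1 \<le> l" "l \<le> n"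
  shows "2 * n + 1 - l \<in> actives n A n \<longleftrightarrow> l \<notin> fst ` A"
proof -
  have "(k, 2 * n + 1 - l - 1) \<notin> A" for k using root_poset_A_bounds[OF A, of k "2 * n + 1 - l"] l by auto
  moreover have same: "2 * n + 1 - l = 2 * n + 1 - k \<longleftrightarrow> k = l" if "k \<le> n" for k using l that by linarith
  ultimately have "2 * n + 1 - l \<in> actives n A n \<longleftrightarrow>
      (\<exists>k. 2 * n + 1 - l = 2 * n + 1 - k \<and> 1 \<le> k \<and> k \<le> n \<and> (\<forall>j. (k, j) \<notin> A))"
    unfolding actives_def by simp
  also have "\<dots> \<longleftrightarrow> (\<forall>j. (l, j) \<notin> A)"
    using l same by metis
  finally have "2 * n + 1 - l \<in> actives n A n \<longleftrightarrow> (\<forall>j. (l, j) \<notin> A)" .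
  then show ?thesis by force
qed

lemma actives_value_iff:
  assumes A: "A \<in> antichains (root_poset_A (n - 1))" and v: "1 \<le> v" "v \<le> n"
  shows "v \<in> actives n A n \<longleftrightarrow> v - 1 \<in> snd ` A"
proof -
  have "l \<le> n" if "(l, v - 1) \<in> A" for l using root_poset_A_bounds[OF A that] by simp
  then have "v \<in> actives n A n \<longleftrightarrow> (\<exists>l. (l, v - 1) \<in> A)" using actives_low_iff[OF v(2)] by blast
  also have "\<dots> \<longleftrightarrow> v - 1 \<in> snd ` A" by (simp only: image_iff Bex_def split_paired_Ex snd_conv) blast
  finally show ?thesis .
qed

lemma actives_subset:
  assumes A: "A \<in> antichains (root_poset_A (n - 1))"
  shows "actives n A n \<subseteq> {1..2 * n}"
proof
  fix x assume "x \<in> actives n A n"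
  then consider l where "(l, x - 1) \<in> A" | l where "x = 2 * n + 1 - l" "1 \<le> l" "l \<le> n"
    unfolding actives_def by blast
  then show "x \<in> {1..2 * n}"
  proof cases
    case 1
    then show ?thesis using root_poset_A_bounds[OF A 1] by simp
  qed auto
qed

text \<open>The bars show where intervals start and the values show where they end; the antichain is
  then recovered by rank.\<close>

lemma inj_on_actives: "inj_on (\<lambda>A. actives n A n) (antichains (root_poset_A (n - 1)))"
proof (rule inj_onI)
  fix A B assume A: "A \<in> antichains (root_poset_A (n - 1))" and B: "B \<in> antichains (root_poset_A (n - 1))"
    and eq: "actives n A n = actives n B n"
  have sub: "P \<subseteq> root_poset_A (n - 1)" if "P \<in> antichains (root_poset_A (n - 1))" for P
    using that unfolding antichains_def by blast
  have bounds: "1 \<le> i" "i \<le> n" "1 \<le> Suc j" "Suc j \<le> n"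
    if "P \<in> antichains (root_poset_A (n - 1))" "(i, j) \<in> P" for P i j
    using sub[OF that(1)] that(2) unfolding root_poset_A_def by auto
  have "fst ` P \<subseteq> fst ` Q \<and> snd ` P \<subseteq> snd ` Q"
    if P: "P \<in> antichains (root_poset_A (n - 1))" and Q: "Q \<in> antichains (root_poset_A (n - 1))"
      and pq: "actives n P n = actives n Q n" for P Q
  proof (intro conjI subsetI)
    fix i assume i: "i \<in> fst ` P"
    then have ib: "1 \<le> i" "i \<le> n" using bounds[OF P] by auto
    then show "i \<in> fst ` Q" using i actives_bar_iff[OF P ib] actives_bar_iff[OF Q ib] pq by simp
  next
    fix j assume j: "j \<in> snd ` P"
    then have jb: "1 \<le> Suc j" "Suc j \<le> n" using bounds[OF P] by auto
    then show "j \<in> snd ` Q" using j actives_value_iff[OF P jb] actives_value_iff[OF Q jb] pq by simp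
  qed
  then show "A = B"
    using antichain_eqI[OF A B finite_root_poset_A] A B eq by (metis subset_antisym)
qed

section \<open>Closers of noncrossing matchings\<close>

text \<open>Passing to the partner is injective.\<close>

lemma pairing_card_le:
  assumes M: "pairing M" and S: "S \<subseteq> \<Union>M" and T: "finite T"
    and ST: "\<And>x y. x \<in> S \<Longrightarrow> {x, y} \<in> M \<Longrightarrow> y \<in> T"
  shows "card S \<le> card T"
proof -
  have "\<forall>x\<in>S. \<exists>y. {x, y} \<in> M" using S pairing_partner[OF M] by (metis subsetD)
  then obtain p where p: "\<And>x. x \<in> S \<Longrightarrow> {x, p x} \<in> M" by metis
  have "inj_on p S"
  proof (rule inj_onI)
    fix x y assume xy: "x \<in> S" "y \<in> S" "p x = p y"
    then have "{p x, x} \<in> M" "{p x, y} \<in> M" using p by (metis insert_commute)+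
    then show "x = y" using pairing_unique[OF M] by blast
  qed
  moreover have "p ` S \<subseteq> T" using p ST by blast
  ultimately show ?thesis using card_inj_on_le T by blast
qed

lemma closers_edge_iff:
  assumes M: "M \<in> noncrossing_matchings n" and e: "{x, y} \<in> M"
  shows "y \<in> closers n M \<longleftrightarrow> x \<notin> closers n M" "x \<in> closers n M \<longleftrightarrow> key n y < key n x"
proof -
  have e': "{y, x} \<in> M" using e by (simp add: insert_commute)
  have x: "x \<in> closers n M \<longleftrightarrow> key n y < key n x"
    using e pairing_unique[OF noncrossing_pairing[OF M] e] unfolding closers_def by blast
  have y: "y \<in> closers n M \<longleftrightarrow> key n x < key n y"
    using e' pairing_unique[OF noncrossing_pairing[OF M] e'] unfolding closers_def by blast
  have "key n x \<noteq> key n y" using noncrossing_mem[OF M e] key_inj by blast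
  then show "y \<in> closers n M \<longleftrightarrow> x \<notin> closers n M" "x \<in> closers n M \<longleftrightarrow> key n y < key n x"
    using x y by linarith+
qed

lemma card_closers:
  assumes M: "M \<in> noncrossing_matchings n"
  shows "card (closers n M) = n"
proof -
  let ?C = "closers n M" and ?X = "{1..2 * n}"
  have CX: "?C \<subseteq> ?X" using noncrossing_mem[OF M] unfolding closers_def by blast
  note P = noncrossing_pairing[OF M] and U = noncrossing_Union[OF M]
  have "card ?C \<le> card (?X - ?C)"
    using CX U closers_edge_iff[OF M] noncrossing_mem[OF M] by (intro pairing_card_le[OF P]) auto
  moreover have "card (?X - ?C) \<le> card ?C"
    using CX U closers_edge_iff[OF M] finite_subset[OF CX] by (intro pairing_card_le[OF P]) auto
  moreover have "card (?X - ?C) = card ?X - card ?C" using CX by (meson card_Diff_subset finite_subset finite_atLeastAtMost)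
  moreover have "card ?C \<le> card ?X" using CX card_mono by blast
  ultimately show ?thesis by simp
qed

text \<open>The ballot condition along the spiral: the opener joined to a closer comes earlier, so
  it lies in the same initial segment.\<close>

lemma card_closers_key_le:
  assumes M: "M \<in> noncrossing_matchings n"
  shows "2 * card {x \<in> closers n M. key n x \<le> k} \<le> card {x \<in> {1..2 * n}. key n x \<le> k}"
proof -
  let ?C = "{x \<in> closers n M. key n x \<le> k}" and ?X = "{x \<in> {1..2 * n}. key n x \<le> k}"
  have CX: "?C \<subseteq> ?X" using noncrossing_mem[OF M] unfolding closers_def by blast
  note P = noncrossing_pairing[OF M] and U = noncrossing_Union[OF M]
  have "card ?C \<le> card (?X - ?C)"
  proof (rule pairing_card_le[OF P])
    show "?C \<subseteq> \<Union>M" using CX U by blast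
    show "finite (?X - ?C)" by simp
    fix x y assume x: "x \<in> ?C" and e: "{x, y} \<in> M"
    have "key n y < key n x" "y \<notin> closers n M" using x closers_edge_iff[OF M e] by auto
    then show "y \<in> ?X - ?C" using x noncrossing_mem[OF M e] by auto
  qed
  moreover have "card (?X - ?C) = card ?X - card ?C"
    using CX by (intro card_Diff_subset) (auto intro: finite_subset)
  moreover have "card ?C \<le> card ?X" using CX by (intro card_mono) auto
  ultimately show ?thesis by simp
qed

text \<open>The initial segment of the spiral that ends at t consists of 1, ..., t and the bars of
  1, ..., t-1. These are 2t-1 points, an odd number, so at most t-1 of them are closers. Splitting
  t-1 into closing and nonclosing bars leaves a bound for the closing values alone.\<close>

lemma closers_dominance:
  assumes M: "M \<in> noncrossing_matchings n" and t: "1 \<le> t" "t \<le> n"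
  shows "card {v \<in> closers n M. v \<le> t} \<le> card {l \<in> {1..n}. 2 * n + 1 - l \<notin> closers n M \<and> l < t}"
proof -
  let ?C = "closers n M"
  let ?V = "{v \<in> ?C. v \<le> t}" and ?N = "{l \<in> {1..<t}. 2 * n + 1 - l \<in> ?C}"
  let ?E = "{l \<in> {1..<t}. 2 * n + 1 - l \<notin> ?C}"
  let ?bar = "\<lambda>l. 2 * n + 1 - l"
  have CX: "?C \<subseteq> {1..2 * n}" using noncrossing_mem[OF M] unfolding closers_def by blast
  have inj: "inj_on ?bar {1..<t}" using t by (auto simp: inj_on_def)
  have finV: "finite ?V" by simp
  have "{x \<in> {1..2 * n}. key n x \<le> 2 * t} = {1..t} \<union> ?bar ` {1..<t}"
  proof (intro equalityI subsetI)
    fix x assume x: "x \<in> {x \<in> {1..2 * n}. key n x \<le> 2 * t}"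
    show "x \<in> {1..t} \<union> ?bar ` {1..<t}"
    proof (cases "x \<le> n")
      case True
      then show ?thesis using x by (auto simp: key_def)
    next
      case False
      then have "2 * n + 1 - x \<in> {1..<t}" "x = ?bar (2 * n + 1 - x)" using x by (auto simp: key_def)
      then show ?thesis by blast
    qed
  qed (use t in \<open>auto simp: key_def\<close>)
  moreover have "card ({1..t} \<union> ?bar ` {1..<t}) = t + (t - 1)"
    using t card_image[OF inj] by (subst card_Un_disjoint) auto
  ultimately have total: "card {x \<in> {1..2 * n}. key n x \<le> 2 * t} = 2 * t - 1" using t by simp
  have "?V \<union> ?bar ` ?N \<subseteq> {x \<in> ?C. key n x \<le> 2 * t}"
    using t by (auto simp: key_def)
  moreover have "finite {x \<in> ?C. key n x \<le> 2 * t}" using finite_subset[OF CX] by simp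
  ultimately have le: "card (?V \<union> ?bar ` ?N) \<le> card {x \<in> ?C. key n x \<le> 2 * t}"
    by (rule card_mono[rotated])
  have "card (?V \<union> ?bar ` ?N) = card ?V + card ?N"
  proof -
    have "card (?bar ` ?N) = card ?N" by (rule card_image[OF inj_on_subset[OF inj]]) blast
    moreover have "?V \<inter> ?bar ` ?N = {}" using t by auto
    ultimately show ?thesis using card_Un_disjoint[of ?V "?bar ` ?N"] finV by simp
  qed
  then have "card ?V + card ?N \<le> card {x \<in> ?C. key n x \<le> 2 * t}" using le by simp
  then have "2 * (card ?V + card ?N) \<le> 2 * card {x \<in> ?C. key n x \<le> 2 * t}" by (rule mult_le_mono2)
  also have "\<dots> \<le> 2 * t - 1" using card_closers_key_le[OF M, of "2 * t"] unfolding total .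
  finally have "2 * (card ?V + card ?N) \<le> 2 * t - 1" .
  moreover have "card ?N + card ?E = t - 1"
  proof -
    have "card (?N \<union> ?E) = card ?N + card ?E" by (rule card_Un_disjoint) auto
    moreover have "?N \<union> ?E = {1..<t}" by auto
    ultimately show ?thesis by simp
  qed
  moreover have "{l \<in> {1..n}. ?bar l \<notin> ?C \<and> l < t} = ?E" using t by auto
  ultimately show ?thesis by simp
qed

text \<open>The starts must be the indices \<open>E\<close> of the nonclosing bars, and the closing
  values \<open>V\<close> minus one must be the ends. They are joined in increasing order; the sizes
  agree because there are n closers.\<close>

lemma ex_antichain_closers:
  assumes M: "M \<in> noncrossing_matchings n"
  obtains A where "A \<in> antichains (root_poset_A (n - 1))" "actives n A n = closers n M"
proof -
  let ?C = "closers n M" and ?bar = "\<lambda>l. 2 * n + 1 - l"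
  define V where "V = {v \<in> ?C. v \<le> n}"
  define E where "E = {l \<in> {1..n}. ?bar l \<notin> ?C}"
  have CX: "?C \<subseteq> {1..2 * n}" using noncrossing_mem[OF M] unfolding closers_def by blast
  have fin: "finite V" "finite E" unfolding V_def E_def by auto
  have "card E = card V"
  proof -
    let ?N = "{l \<in> {1..n}. ?bar l \<in> ?C}"
    have inj: "inj_on ?bar ?N" by (auto simp: inj_on_def)
    have "?C = V \<union> ?bar ` ?N"
    proof (intro equalityI subsetI)
      fix x assume x: "x \<in> ?C"
      show "x \<in> V \<union> ?bar ` ?N"
      proof (cases "x \<le> n")
        case False
        then have "2 * n + 1 - x \<in> ?N" "x = ?bar (2 * n + 1 - x)" using x CX by auto
        then show ?thesis by blast
      qed (use x V_def in simp)
    qed (auto simp: V_def)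
    moreover have "V \<inter> ?bar ` ?N = {}" unfolding V_def by auto
    ultimately have "card ?C = card V + card ?N"
      using fin card_Un_disjoint[of V "?bar ` ?N"] card_image[OF inj] by simp
    moreover have "card ?N + card E = n"
    proof -
      have "card (?N \<union> E) = card ?N + card E" unfolding E_def by (rule card_Un_disjoint) auto
      moreover have "?N \<union> E = {1..n}" unfolding E_def by auto
      ultimately show ?thesis by simp
    qed
    ultimately show ?thesis using card_closers[OF M] by simp
  qed
  then obtain f where f: "bij_betw f E V" "strict_mono_on E f"
    using ex_strict_mono_bij_betw[OF fin(2,1)] by blast
  have fV: "f i \<in> V" if "i \<in> E" for i using f(1) that bij_betwE by blast
  have V: "1 \<le> v" "v \<le> n" if "v \<in> V" for v using that CX unfolding V_def by auto
  \<comment> \<open>If f i \<le> i, the closing values up to f i are one more than the elements of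
    \<open>E\<close> below i, while dominance allows no more than the elements of \<open>E\<close>
    below f i.\<close>
  have less: "i < f i" if i: "i \<in> E" for i
  proof (rule ccontr)
    assume "\<not> i < f i"
    let ?t = "f i"
    note t = V[OF fV[OF i]]
    have "{v \<in> ?C. v \<le> ?t} = insert ?t {v \<in> V. v < ?t}" using fV[OF i] t unfolding V_def by auto
    then have "card {v \<in> ?C. v \<le> ?t} = Suc (card {v \<in> V. v < ?t})" using fin by simp
    moreover have "card {l \<in> {1..n}. ?bar l \<notin> ?C \<and> l < ?t} \<le> card {l \<in> E. l < i}"
      using \<open>\<not> i < f i\<close> fin(2) unfolding E_def by (intro card_mono) auto
    ultimately show False
      using closers_dominance[OF M t] strict_mono_bij_rank[OF f i] by simp
  qed
  define A where "A = (\<lambda>i. (i, f i - 1)) ` E"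
  have mem: "(i, j) \<in> A \<longleftrightarrow> i \<in> E \<and> j = f i - 1" for i j unfolding A_def by auto
  have "A \<in> antichains (root_poset_A (n - 1))"
    unfolding antichains_def
  proof (intro CollectI conjI ballI impI)
    show "A \<subseteq> root_poset_A (n - 1)"
    proof
      fix p assume "p \<in> A"
      then obtain i where i: "i \<in> E" "p = (i, f i - 1)" unfolding A_def by blast
      then show "p \<in> root_poset_A (n - 1)"
        using less[OF i(1)] V[OF fV[OF i(1)]] unfolding root_poset_A_def E_def by auto
    qed
    fix a b assume "a \<in> A" "b \<in> A" and le: "interval_le a b"
    then obtain i k where i: "i \<in> E" "a = (i, f i - 1)" and k: "k \<in> E" "b = (k, f k - 1)"
      unfolding A_def by blast
    have "i \<le> f i - 1" using less[OF i(1)] by simp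
    then have "k \<le> i" "f i - 1 \<le> f k - 1" using le i k unfolding interval_le_def by auto
    moreover have "f k < f i" if "k < i" using strict_mono_onD[OF f(2) k(1) i(1) that] .
    ultimately have "k = i" using less[OF i(1)] less[OF k(1)] by (cases "k < i") auto
    then show "a = b" using i k by simp
  qed
  moreover have "actives n A n = ?C"
  proof (rule set_eqI)
    fix x
    show "x \<in> actives n A n \<longleftrightarrow> x \<in> ?C"
    proof (cases "x \<in> {1..2 * n}")
      case False
      then show ?thesis using CX actives_subset[OF \<open>A \<in> _\<close>] by blast
    next
      case True
      show ?thesis
      proof (cases "x \<le> n")
        case low: True
        have "snd ` A = (\<lambda>i. f i - 1) ` E" unfolding A_def image_image by simp
        then have "x - 1 \<in> snd ` A \<longleftrightarrow> (\<exists>i\<in>E. x - 1 = f i - 1)" by blast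
        also have "\<dots> \<longleftrightarrow> (\<exists>i\<in>E. x = f i)" using V[OF fV] True by (metis Suc_diff_1 atLeastAtMost_iff le_simps(2) One_nat_def less_eq_Suc_le)
        also have "\<dots> \<longleftrightarrow> x \<in> V" using f(1) unfolding bij_betw_def by blast
        finally show ?thesis
          using actives_value_iff[OF \<open>A \<in> _\<close>, of x] True low unfolding V_def by simp
      next
        case False
        define l where "l = 2 * n + 1 - x"
        have l: "1 \<le> l" "l \<le> n" "x = 2 * n + 1 - l" using True False unfolding l_def by auto
        have "l \<in> fst ` A \<longleftrightarrow> l \<in> E" unfolding A_def by force
        then show ?thesis using actives_bar_iff[OF \<open>A \<in> _\<close> l(1,2)] l unfolding E_def by simp
      qed
    qed
  qed
  ultimately show ?thesis using that by blast
qed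

text \<open>Everything passes through the closers: they determine the matching as well as the
  antichain, and the closers of any noncrossing matching come from an antichain.\<close>

lemma AST_bij_betw: "bij_betw (AST n) (antichains (root_poset_A (n - 1))) (noncrossing_matchings n)"
  unfolding bij_betw_def
proof
  let ?X = "antichains (root_poset_A (n - 1))"
  show "inj_on (AST n) ?X"
  proof (rule inj_onI)
    fix A B assume A: "A \<in> ?X" and B: "B \<in> ?X" and "AST n A = AST n B"
    then have "actives n A n = actives n B n" using AST_closers(2)[OF A] AST_closers(2)[OF B] by simp
    then show "A = B" using inj_onD[OF inj_on_actives _ A B] by blast
  qed
  show "AST n ` ?X = noncrossing_matchings n"
  proof (intro equalityI subsetI)
    fix M assume M: "M \<in> noncrossing_matchings n"
    obtain A where A: "A \<in> ?X" "actives n A n = closers n M" using ex_antichain_closers[OF M] .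
    have "closers n (AST n A) = closers n M" using AST_closers(2)[OF A(1)] A(2) by simp
    then have "AST n A = M" by (rule inj_onD[OF inj_on_closers _ AST_closers(1)[OF A(1)] M])
    then show "M \<in> AST n ` ?X" using A(1) by blast
  qed (use AST_closers(1) in blast)
qed

section \<open>The symmetry of the type A root poset\<close>

definition flip :: "nat \<Rightarrow> (nat \<times> nat) set \<Rightarrow> (nat \<times> nat) set" where
  "flip n A = (\<lambda>(i, j). (n - j, n - i)) ` A"

lemma flip_iff:
  assumes "A \<subseteq> root_poset_A (n - 1)" "1 \<le> i" "i \<le> n" "1 \<le> j" "j \<le> n"
  shows "(i, j) \<in> flip n A \<longleftrightarrow> (n - j, n - i) \<in> A"
proof
  assume "(i, j) \<in> flip n A"
  then obtain k l where kl: "(k, l) \<in> A" "i = n - l" "j = n - k" unfolding flip_def by auto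
  then have "k \<le> n" "l \<le> n" using assms(1) unfolding root_poset_A_def by auto
  then show "(n - j, n - i) \<in> A" using kl by simp
next
  assume "(n - j, n - i) \<in> A"
  then have "(n - (n - i), n - (n - j)) \<in> flip n A" unfolding flip_def by force
  then show "(i, j) \<in> flip n A" using assms by simp
qed

lemma flip_antichain:
  assumes A: "A \<in> antichains (root_poset_A (n - 1))"
  shows "flip n A \<in> antichains (root_poset_A (n - 1))"
proof -
  have bounds: "1 \<le> i" "i \<le> j" "j < n" if "(i, j) \<in> A" for i j
    using A that unfolding antichains_def root_poset_A_def by auto
  show ?thesis
    unfolding antichains_def
  proof (intro CollectI conjI ballI impI)
    show "flip n A \<subseteq> root_poset_A (n - 1)"
      using bounds unfolding flip_def root_poset_A_def by fastforce
    fix a b assume "a \<in> flip n A" "b \<in> flip n A" and le: "interval_le a b"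
    then obtain i j k l where ij: "(i, j) \<in> A" "a = (n - j, n - i)" and kl: "(k, l) \<in> A" "b = (n - l, n - k)"
      unfolding flip_def by auto
    have "interval_le (i, j) (k, l)"
      using le bounds[OF ij(1)] bounds[OF kl(1)] unfolding ij(2) kl(2) interval_le_def by auto
    then have "(i, j) = (k, l)" using A ij kl unfolding antichains_def by blast
    then show "a = b" using ij kl by simp
  qed
qed

text \<open>A value x closes if x-1 ends an interval. Reflected, that interval starts at n-(x-1),
  the index of the bar that is the half turn of x, so this bar does not close. Bars are treated in
  the same way with starts and ends exchanged.\<close>

lemma actives_flip:
  assumes A: "A \<in> antichains (root_poset_A (n - 1))"
  shows "actives n (flip n A) n = half_turn n ` ({1..2 * n} - actives n A n)"
proof -
  note F = flip_antichain[OF A]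
  have AX: "A \<subseteq> root_poset_A (n - 1)" using A unfolding antichains_def by blast
  have bounds: "1 \<le> i" "i \<le> j" "j < n" if "(i, j) \<in> A" for i j
    using A that unfolding antichains_def root_poset_A_def by auto
  have eq: "half_turn n x \<in> actives n (flip n A) n \<longleftrightarrow> x \<notin> actives n A n" if x: "x \<in> {1..2 * n}" for x
  proof (cases "x \<le> n")
    case True
    define l where "l = n + 1 - x"
    have l: "1 \<le> l" "l \<le> n" "half_turn n x = 2 * n + 1 - l" using True x unfolding l_def half_turn_def by auto
    have "l \<in> fst ` flip n A \<longleftrightarrow> x - 1 \<in> snd ` A"
    proof
      assume "l \<in> fst ` flip n A"
      then obtain i j where ij: "(i, j) \<in> A" "l = n - j" unfolding flip_def by auto
      then have "x - 1 = j" using l bounds[OF ij(1)] x True unfolding l_def by auto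
      then show "x - 1 \<in> snd ` A" using ij(1) by force
    next
      assume "x - 1 \<in> snd ` A"
      then obtain i where "(i, x - 1) \<in> A" by auto
      then have "(n - (x - 1), n - i) \<in> flip n A" unfolding flip_def by force
      moreover have "n - (x - 1) = l" using x True unfolding l_def by auto
      ultimately show "l \<in> fst ` flip n A" by force
    qed
    then show ?thesis using actives_bar_iff[OF F l(1,2)] actives_value_iff[OF A, of x] x True l(3) by simp
  next
    case False
    define l where "l = 2 * n + 1 - x"
    have l: "1 \<le> l" "l \<le> n" "x = 2 * n + 1 - l" "half_turn n x = n + 1 - l"
      using False x unfolding l_def half_turn_def by auto
    have "n - l \<in> snd ` flip n A \<longleftrightarrow> l \<in> fst ` A"
    proof
      assume "n - l \<in> snd ` flip n A"
      then obtain i j where ij: "(i, j) \<in> A" "n - l = n - i" unfolding flip_def by auto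
      then have "l = i" using l bounds[OF ij(1)] by auto
      then show "l \<in> fst ` A" using ij(1) by force
    next
      assume "l \<in> fst ` A"
      then obtain j where "(l, j) \<in> A" by auto
      then have "(n - j, n - l) \<in> flip n A" unfolding flip_def by force
      then show "n - l \<in> snd ` flip n A" by force
    qed
    then show ?thesis using actives_bar_iff[OF A l(1,2)] actives_value_iff[OF F, of "n + 1 - l"] l by simp
  qed
  show ?thesis
  proof (intro equalityI subsetI)
    fix z assume z: "z \<in> actives n (flip n A) n"
    then have zX: "z \<in> {1..2 * n}" using actives_subset[OF F] by blast
    then have "half_turn n z \<in> {1..2 * n} - actives n A n"
      using eq[OF half_turn_in[OF zX]] z half_turn_twice[OF zX] half_turn_in[OF zX] by simp
    then have "half_turn n (half_turn n z) \<in> half_turn n ` ({1..2 * n} - actives n A n)" by (rule imageI)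
    then show "z \<in> half_turn n ` ({1..2 * n} - actives n A n)" using half_turn_twice[OF zX] by simp
  qed (use eq in blast)
qed

text \<open>The run of the algorithm on the reflected antichain need not be followed: equal closers
  already force equal matchings.\<close>

lemma AST_flip:
  assumes A: "A \<in> antichains (root_poset_A (n - 1))"
  shows "AST n (flip n A) = rotate n (AST n A)"
proof (rule inj_onD[OF inj_on_closers])
  note F = flip_antichain[OF A]
  show "closers n (AST n (flip n A)) = closers n (rotate n (AST n A))"
    unfolding AST_closers(2)[OF F] closers_rotate[OF AST_closers(1)[OF A]] AST_closers(2)[OF A]
    by (rule actives_flip[OF A])
  show "AST n (flip n A) \<in> noncrossing_matchings n" using AST_closers(1)[OF F] .
  show "rotate n (AST n A) \<in> noncrossing_matchings n" using rotate_noncrossing[OF AST_closers(1)[OF A]] .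
qed

lemma AST_bij_betw_symmetric:
  "bij_betw (AST n) {A \<in> antichains (root_poset_A (n - 1)). flip n A = A} (symmetric_matchings n)"
  unfolding symmetric_matchings_def
  by (rule bij_betw_fixed_points[where g' = "rotate n", OF AST_bij_betw]) (fact flip_antichain AST_flip)+

section \<open>Type B antichains as the reflection-invariant antichains of type A\<close>

lemma unfold_B_iff:
  "(i, j) \<in> unfold_B m A \<longleftrightarrow>
     (i, j) \<in> root_poset_A (2 * m - 1) \<and> ((i, j) \<in> A \<or> (2 * m - j, 2 * m - i) \<in> A)"
  unfolding unfold_B_def by simp

text \<open>The reflection exchanges i + j \<le> 2m with i + j \<ge> 2m, so the type B poset is one
  half of the type A poset including the axis, and a symmetric antichain is recovered from its part
  in this half.\<close>

lemma unfold_B_bij_betw: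
  "bij_betw (unfold_B m) (antichains (root_poset_B m))
     {A \<in> antichains (root_poset_A (2 * m - 1)). flip (2 * m) A = A}"
proof (rule bij_betw_byWitness[where f' = "\<lambda>S. S \<inter> root_poset_B m"])
  let ?X = "{A \<in> antichains (root_poset_A (2 * m - 1)). flip (2 * m) A = A}"
  have B: "1 \<le> i" "i \<le> j" "j < 2 * m" "i + j \<le> 2 * m"
    if "A \<in> antichains (root_poset_B m)" "(i, j) \<in> A" for A i j
    using that unfolding antichains_def root_poset_B_def by auto
  show "\<forall>A\<in>antichains (root_poset_B m). unfold_B m A \<inter> root_poset_B m = A"
  proof (intro ballI equalityI subrelI)
    fix A i j assume A: "A \<in> antichains (root_poset_B m)"
    show "(i, j) \<in> A" if "(i, j) \<in> unfold_B m A \<inter> root_poset_B m"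
    proof -
      have ij: "(i, j) \<in> A \<or> (2 * m - j, 2 * m - i) \<in> A" "1 \<le> i" "i \<le> j" "j < 2 * m" "i + j \<le> 2 * m"
        using that unfolding Int_iff unfold_B_iff root_poset_B_def by auto
      show ?thesis
      proof (cases "(i, j) \<in> A")
        case False
        then have f: "(2 * m - j, 2 * m - i) \<in> A" using ij(1) by blast
        \<comment> \<open>The interval and its mirror image both lie in the half i + j \<le> 2m, so
          the interval lies on the axis and is its own mirror image.\<close>
        have "i + j = 2 * m" using B(4)[OF A f] ij by linarith
        then have "2 * m - j = i" "2 * m - i = j" by auto
        then show ?thesis using f by simp
      qed
    qed
    show "(i, j) \<in> unfold_B m A \<inter> root_poset_B m" if ij: "(i, j) \<in> A"
      using B[OF A ij] ij unfolding Int_iff unfold_B_iff root_poset_B_def root_poset_A_def by auto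
  qed
  have sym: "(2 * m - j, 2 * m - i) \<in> S \<longleftrightarrow> (i, j) \<in> S"
    if "S \<in> ?X" "(i, j) \<in> root_poset_A (2 * m - 1)" for S i j
  proof -
    have "S \<subseteq> root_poset_A (2 * m - 1)" using that(1) unfolding antichains_def by blast
    then have "(i, j) \<in> flip (2 * m) S \<longleftrightarrow> (2 * m - j, 2 * m - i) \<in> S"
      using that(2) by (intro flip_iff) (auto simp: root_poset_A_def)
    then show ?thesis using that(1) by simp
  qed
  show "\<forall>S\<in>?X. unfold_B m (S \<inter> root_poset_B m) = S"
  proof (intro ballI equalityI subrelI)
    fix S i j assume S: "S \<in> ?X"
    show "(i, j) \<in> S" if "(i, j) \<in> unfold_B m (S \<inter> root_poset_B m)"
      using that sym[OF S] unfolding unfold_B_iff by blast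
    show "(i, j) \<in> unfold_B m (S \<inter> root_poset_B m)" if ij: "(i, j) \<in> S"
    proof -
      have r: "(i, j) \<in> root_poset_A (2 * m - 1)" using S ij unfolding antichains_def by blast
      then have "(i, j) \<in> root_poset_B m \<or> (2 * m - j, 2 * m - i) \<in> root_poset_B m"
        unfolding root_poset_A_def root_poset_B_def by auto
      then show ?thesis using ij r sym[OF S r] unfolding unfold_B_iff by blast
    qed
  qed
  show "(\<lambda>S. S \<inter> root_poset_B m) ` ?X \<subseteq> antichains (root_poset_B m)"
    unfolding antichains_def by blast
  show "unfold_B m ` antichains (root_poset_B m) \<subseteq> ?X"
  proof (intro subsetI, elim imageE)
    fix S A assume A: "A \<in> antichains (root_poset_B m)" and S: "S = unfold_B m A"
    have SX: "S \<subseteq> root_poset_A (2 * m - 1)" unfolding S unfold_B_def by blast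
    have S_iff: "(i, j) \<in> S \<longleftrightarrow> (i, j) \<in> A \<or> (2 * m - j, 2 * m - i) \<in> A"
      if "1 \<le> i" "i \<le> j" "j < 2 * m" for i j
      using that unfolding S unfold_B_iff root_poset_A_def by auto
    have Sb: "1 \<le> i" "i \<le> j" "j < 2 * m" if "(i, j) \<in> S" for i j
      using SX that unfolding root_poset_A_def by auto
    have anti: "(i, j) = (k, l)" if "(i, j) \<in> A" "(k, l) \<in> A" "k \<le> i" "j \<le> l" for i j k l
    proof -
      have "interval_le (i, j) (k, l)" using that unfolding interval_le_def by auto
      then show ?thesis using that A unfolding antichains_def by blast
    qed
    have "S \<in> antichains (root_poset_A (2 * m - 1))"
      unfolding antichains_def
    proof (intro CollectI conjI ballI impI)
      fix a b assume ab: "a \<in> S" "b \<in> S" "interval_le a b"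
      obtain i j k l where e: "a = (i, j)" "b = (k, l)" by (cases a; cases b) auto
      note ij = Sb[OF ab(1)[unfolded e]] and kl = Sb[OF ab(2)[unfolded e]]
      have le: "k \<le> i" "j \<le> l" using ab(3) ij unfolding e interval_le_def by auto
      consider "(i, j) \<in> A" "(k, l) \<in> A" | "(i, j) \<in> A" "(2 * m - l, 2 * m - k) \<in> A"
        | "(2 * m - j, 2 * m - i) \<in> A" "(k, l) \<in> A"
        | "(2 * m - j, 2 * m - i) \<in> A" "(2 * m - l, 2 * m - k) \<in> A"
        using ab S_iff ij kl unfolding e by blast
      then have "i = k \<and> j = l"
      proof cases
        case 1
        then show ?thesis using anti[OF 1 le] by simp
      next
        case 2
        \<comment> \<open>Since [i, j] and the mirror image of [k, l] lie in the type B half,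
          containment of [i, j] in [k, l] also gives containment in that mirror image. The antichain
          property makes these two equal, which puts [k, l] on the axis.\<close>
        have "2 * m - l \<le> i" "j \<le> 2 * m - k" using B(4)[OF A 2(1)] B(4)[OF A 2(2)] le kl by linarith+
        then have "i = 2 * m - l" "j = 2 * m - k" using anti[OF 2] by auto
        then show ?thesis using B(4)[OF A 2(1)] B(4)[OF A 2(2)] le kl by linarith
      next
        case 3
        have "k \<le> 2 * m - j" "2 * m - i \<le> l" using B(4)[OF A 3(1)] B(4)[OF A 3(2)] le ij by linarith+
        then have "k = 2 * m - j" "l = 2 * m - i" using anti[OF 3] by auto
        then show ?thesis using B(4)[OF A 3(1)] B(4)[OF A 3(2)] le ij by linarith
      next
        case 4
        have "2 * m - l \<le> 2 * m - j" "2 * m - i \<le> 2 * m - k" using le by auto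
        then show ?thesis using anti[OF 4] ij kl by auto
      qed
      then show "a = b" using e by simp
    qed (rule SX)
    moreover have "flip (2 * m) S = S"
    proof (intro equalityI subrelI)
      fix i j
      have fl: "(i, j) \<in> flip (2 * m) S \<longleftrightarrow> (2 * m - j, 2 * m - i) \<in> S" if "1 \<le> i" "i \<le> j" "j < 2 * m"
        using that by (intro flip_iff[OF SX]) auto
      have eq: "(2 * m - j, 2 * m - i) \<in> S \<longleftrightarrow> (i, j) \<in> S" if "1 \<le> i" "i \<le> j" "j < 2 * m"
        using that S_iff[of i j] S_iff[of "2 * m - j" "2 * m - i"] by auto
      have "1 \<le> i" "i \<le> j" "j < 2 * m" if "(i, j) \<in> flip (2 * m) S"
      proof -
        obtain k l where kl: "(k, l) \<in> S" "i = 2 * m - l" "j = 2 * m - k"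
          using \<open>(i, j) \<in> flip (2 * m) S\<close> unfolding flip_def by auto
        then show "1 \<le> i" "i \<le> j" "j < 2 * m" using Sb[OF kl(1)] by auto
      qed
      then show "(i, j) \<in> flip (2 * m) S \<Longrightarrow> (i, j) \<in> S" using fl eq by blast
      show "(i, j) \<in> S \<Longrightarrow> (i, j) \<in> flip (2 * m) S" using fl eq Sb[of i j] by blast
    qed
    ultimately show "S \<in> ?X" by blast
  qed
qed

lemma AST_B_bij_betw: "bij_betw (AST_B m) (antichains (root_poset_B m)) (symmetric_matchings (2 * m))"
proof -
  have "AST_B m = AST (2 * m) \<circ> unfold_B m" by (rule ext) (simp add: AST_B_def)
  then show ?thesis using bij_betw_trans[OF unfold_B_bij_betw AST_bij_betw_symmetric] by simp
qed

section \<open>Excedances of 321-avoiding permutations\<close>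

text \<open>Lowering the value by one turns the strict inequality i < \<pi> i into the weak one of
  an interval and keeps its end at most n-1.\<close>

definition excedances :: "nat \<Rightarrow> (nat \<Rightarrow> nat) \<Rightarrow> (nat \<times> nat) set" where
  "excedances n \<pi> = {(i, \<pi> i - 1) | i. i \<in> {1..n} \<and> i < \<pi> i}"

lemma S321_permutes: "\<pi> \<in> S321 n \<Longrightarrow> \<pi> permutes {1..n}"
  unfolding S321_def by blast

lemma S321_avoids:
  assumes "\<pi> \<in> S321 n" "i \<in> {1..n}" "j \<in> {1..n}" "k \<in> {1..n}" "i < j" "j < k" "\<pi> j < \<pi> i" "\<pi> k < \<pi> j"
  shows False
  using assms unfolding S321_def by blast

lemma S321_mem:
  assumes "\<pi> \<in> S321 n" "i \<in> {1..n}"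
  shows "\<pi> i \<in> {1..n}"
  using permutes_in_image[OF S321_permutes[OF assms(1)]] assms(2) by blast

lemma S321_inj:
  assumes "\<pi> \<in> S321 n" "\<pi> i = \<pi> j"
  shows "i = j"
  using permutes_inj[OF S321_permutes[OF assms(1)]] assms(2) by (rule injD)

text \<open>As \<pi> k > k takes up one of the values beyond k, the positions after k cannot all
  have values beyond k. If \<pi> i were larger than \<pi> k, a later position with value at most k
  would complete a 321 pattern.\<close>

lemma S321_excedance_less:
  assumes \<pi>: "\<pi> \<in> S321 n" and ik: "i \<in> {1..n}" "k \<in> {1..n}" "i < k" "k < \<pi> k"
  shows "\<pi> i < \<pi> k"
proof (rule ccontr)
  assume "\<not> \<pi> i < \<pi> k"
  then have less: "\<pi> k < \<pi> i" using S321_inj[OF \<pi>, of i k] ik(3) by fastforce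
  have "\<exists>l\<in>{1..n}. k < l \<and> \<pi> l \<le> k"
  proof (rule ccontr)
    assume *: "\<not> (\<exists>l\<in>{1..n}. k < l \<and> \<pi> l \<le> k)"
    have "\<pi> ` {k<..n} \<subseteq> {k<..n}"
    proof
      fix y assume "y \<in> \<pi> ` {k<..n}"
      then obtain l where l: "l \<in> {k<..n}" "y = \<pi> l" by blast
      then have "l \<in> {1..n}" by auto
      then show "y \<in> {k<..n}" using * l S321_mem[OF \<pi>, of l] by force
    qed
    moreover have "inj_on \<pi> {k<..n}" using S321_inj[OF \<pi>] by (rule inj_onI)
    ultimately have "\<pi> ` {k<..n} = {k<..n}" by (intro endo_inj_surj) auto
    moreover have "\<pi> k \<in> {k<..n}" using S321_mem[OF \<pi> ik(2)] ik(4) by auto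
    ultimately obtain l where "l \<in> {k<..n}" "\<pi> k = \<pi> l" by blast
    then show False using S321_inj[OF \<pi>] by fastforce
  qed
  then obtain l where l: "l \<in> {1..n}" "k < l" "\<pi> l \<le> k" by blast
  then have "\<pi> l < \<pi> k" using ik(4) by simp
  then show False using S321_avoids[OF \<pi> ik(1,2) l(1) ik(3) l(2) less] by blast
qed

text \<open>If \<pi> k were smaller than \<pi> i \<le> i, one of the values below \<pi> i would be
  used after i, so some position before i has a value above \<pi> i and starts a 321 pattern. Fixed
  points are included.\<close>

lemma S321_nonexcedance_less:
  assumes \<pi>: "\<pi> \<in> S321 n" and ik: "i \<in> {1..n}" "k \<in> {1..n}" "i < k" "\<pi> i \<le> i"
  shows "\<pi> i < \<pi> k"
proof (rule ccontr)
  assume "\<not> \<pi> i < \<pi> k"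
  then have less: "\<pi> k < \<pi> i" using S321_inj[OF \<pi>, of i k] ik(3) by fastforce
  have "\<exists>l\<in>{1..n}. l < i \<and> \<pi> i < \<pi> l"
  proof (rule ccontr)
    assume *: "\<not> (\<exists>l\<in>{1..n}. l < i \<and> \<pi> i < \<pi> l)"
    have "\<pi> ` {1..<i} \<subseteq> {1..<i}"
    proof
      fix y assume "y \<in> \<pi> ` {1..<i}"
      then obtain l where l: "l \<in> {1..<i}" "y = \<pi> l" by blast
      then have ln: "l \<in> {1..n}" "l < i" using ik by auto
      then have "\<pi> l \<le> \<pi> i" "\<pi> l \<noteq> \<pi> i" using * S321_inj[OF \<pi>, of l i] by force+
      then show "y \<in> {1..<i}" using l S321_mem[OF \<pi> ln(1)] ik(4) by auto
    qed
    moreover have "inj_on \<pi> {1..<i}" using S321_inj[OF \<pi>] by (rule inj_onI)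
    ultimately have "\<pi> ` {1..<i} = {1..<i}" by (intro endo_inj_surj) auto
    moreover have "\<pi> k \<in> {1..<i}" using S321_mem[OF \<pi> ik(2)] ik(4) less by auto
    ultimately obtain l where "l \<in> {1..<i}" "\<pi> k = \<pi> l" by blast
    then show False using S321_inj[OF \<pi>] ik(3) by fastforce
  qed
  then obtain l where l: "l \<in> {1..n}" "l < i" "\<pi> i < \<pi> l" by blast
  then show False using S321_avoids[OF \<pi> l(1) ik(1,2) l(2) ik(3)] less by blast
qed

lemma excedances_iff: "(i, j) \<in> excedances n \<pi> \<longleftrightarrow> i \<in> {1..n} \<and> i < \<pi> i \<and> j = \<pi> i - 1"
  unfolding excedances_def by auto

lemma excedances_antichain:
  assumes \<pi>: "\<pi> \<in> S321 n"
  shows "excedances n \<pi> \<in> antichains (root_poset_A (n - 1))"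
  unfolding antichains_def
proof (intro CollectI conjI ballI impI)
  show "excedances n \<pi> \<subseteq> root_poset_A (n - 1)"
    using S321_mem[OF \<pi>] unfolding excedances_def root_poset_A_def by fastforce
  fix a b assume ab: "a \<in> excedances n \<pi>" "b \<in> excedances n \<pi>" and le: "interval_le a b"
  obtain i k where i: "a = (i, \<pi> i - 1)" "i \<in> {1..n}" "i < \<pi> i"
    and k: "b = (k, \<pi> k - 1)" "k \<in> {1..n}" "k < \<pi> k"
    using ab unfolding excedances_def by blast
  have "i \<le> \<pi> i - 1" using i by simp
  then have "k \<le> i" "\<pi> i - 1 \<le> \<pi> k - 1" using le i k unfolding interval_le_def by auto
  moreover have "\<pi> k < \<pi> i" if "k < i" using S321_excedance_less[OF \<pi> k(2) i(2) that i(3)] .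
  ultimately have "k = i" using i k by (cases "k < i") auto
  then show "a = b" using i k by simp
qed

lemma fst_excedances: "fst ` excedances n \<pi> = {i \<in> {1..n}. i < \<pi> i}"
  unfolding excedances_def by force

lemma Suc_snd_excedances: "Suc ` snd ` excedances n \<pi> = \<pi> ` {i \<in> {1..n}. i < \<pi> i}"
proof -
  have "Suc ` snd ` excedances n \<pi> = (\<lambda>i. Suc (\<pi> i - 1)) ` {i \<in> {1..n}. i < \<pi> i}"
    unfolding excedances_def by force
  also have "\<dots> = \<pi> ` {i \<in> {1..n}. i < \<pi> i}" by (rule image_cong) auto
  finally show ?thesis .
qed

lemma S321_nonexcedance_bij:
  assumes \<pi>: "\<pi> \<in> S321 n"
  defines "A \<equiv> excedances n \<pi>"
  shows "bij_betw \<pi> ({1..n} - fst ` A) ({1..n} - Suc ` snd ` A)" "strict_mono_on ({1..n} - fst ` A) \<pi>"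
proof -
  have im: "\<pi> ` {1..n} = {1..n}" using permutes_image[OF S321_permutes[OF \<pi>]] .
  have inj: "inj_on \<pi> {1..n}" using S321_inj[OF \<pi>] by (rule inj_onI)
  have "\<pi> ` ({1..n} - fst ` A) = \<pi> ` {1..n} - \<pi> ` fst ` A"
    using inj by (intro inj_on_image_set_diff) (auto simp: A_def fst_excedances)
  also have "\<pi> ` fst ` A = Suc ` snd ` A" unfolding A_def fst_excedances Suc_snd_excedances ..
  finally show "bij_betw \<pi> ({1..n} - fst ` A) ({1..n} - Suc ` snd ` A)"
    unfolding bij_betw_def im by (intro conjI inj_on_subset[OF inj] Diff_subset)
  show "strict_mono_on ({1..n} - fst ` A) \<pi>"
    unfolding A_def fst_excedances
  proof (rule strict_mono_onI)
    fix i k assume "i \<in> {1..n} - {i \<in> {1..n}. i < \<pi> i}" "k \<in> {1..n} - {i \<in> {1..n}. i < \<pi> i}" "i < k"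
    then have "i \<in> {1..n}" "k \<in> {1..n}" "i < k" "\<pi> i \<le> i" by auto
    then show "\<pi> i < \<pi> k" by (rule S321_nonexcedance_less[OF \<pi>])
  qed
qed

text \<open>On the positions that are not excedances the permutation is the increasing bijection
  onto the values that remain, so ranks determine it.\<close>

lemma inj_on_excedances: "inj_on (excedances n) (S321 n)"
proof (rule inj_onI)
  fix \<pi> \<sigma> assume \<pi>: "\<pi> \<in> S321 n" and \<sigma>: "\<sigma> \<in> S321 n" and eq: "excedances n \<pi> = excedances n \<sigma>"
  let ?A = "excedances n \<pi>"
  note b\<pi> = S321_nonexcedance_bij[OF \<pi>] and b\<sigma> = S321_nonexcedance_bij[OF \<sigma>, folded eq]
  show "\<pi> = \<sigma>"
  proof
    fix x
    consider "x \<notin> {1..n}" | "x \<in> fst ` ?A" | "x \<in> {1..n} - fst ` ?A" by blast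
    then show "\<pi> x = \<sigma> x"
    proof cases
      case 1
      then show ?thesis
        using permutes_not_in[OF S321_permutes[OF \<pi>]] permutes_not_in[OF S321_permutes[OF \<sigma>]] by simp
    next
      case 2
      then obtain j where "(x, j) \<in> ?A" by auto
      then have "j = \<pi> x - 1" "x < \<pi> x" "j = \<sigma> x - 1" "x < \<sigma> x"
        using excedances_iff[of x j n \<pi>] excedances_iff[of x j n \<sigma>] eq by auto
      then show ?thesis by linarith
    next
      case 3
      let ?Y = "{1..n} - Suc ` snd ` ?A"
      have fin: "finite ?Y" by simp
      have mem: "\<pi> x \<in> ?Y" "\<sigma> x \<in> ?Y" using bij_betwE[OF b\<pi>(1)] bij_betwE[OF b\<sigma>(1)] 3 by blast+
      have "card {y \<in> ?Y. y < \<pi> x} = card {y \<in> ?Y. y < \<sigma> x}"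
        using strict_mono_bij_rank[OF b\<pi> 3] strict_mono_bij_rank[OF b\<sigma> 3] by simp
      then show ?thesis by (rule rank_inj[OF fin mem])
    qed
  qed
qed

text \<open>An interval [l, j] with j + 1 \<le> t contributes its start l \<le> j < t, and different
  intervals of an antichain have different starts.\<close>

lemma antichain_dominance:
  assumes A: "A \<in> antichains (root_poset_A (n - 1))"
  shows "card {v \<in> Suc ` snd ` A. v \<le> t} \<le> card {l \<in> fst ` A. l < t}"
proof -
  have fin: "finite A" using A finite_root_poset_A finite_subset unfolding antichains_def by blast
  have bounds: "1 \<le> i" "i \<le> j" "j < n" if "(i, j) \<in> A" for i j
    using A that unfolding antichains_def root_poset_A_def by auto
  let ?B = "{p \<in> A. Suc (snd p) \<le> t}"
  have finB: "finite ?B" using fin by simp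
  have "inj_on fst A" using antichain_unique[OF A] by (auto simp: inj_on_def)
  then have "inj_on fst ?B" by (rule inj_on_subset) blast
  have "{v \<in> Suc ` snd ` A. v \<le> t} \<subseteq> (Suc \<circ> snd) ` ?B" by force
  then have "card {v \<in> Suc ` snd ` A. v \<le> t} \<le> card ((Suc \<circ> snd) ` ?B)"
    using finB by (intro card_mono) simp_all
  also have "\<dots> \<le> card ?B" using finB by (rule card_image_le)
  also have "\<dots> = card (fst ` ?B)" using card_image[OF \<open>inj_on fst ?B\<close>] by simp
  also have "\<dots> \<le> card {l \<in> fst ` A. l < t}"
  proof (rule card_mono)
    show "finite {l \<in> fst ` A. l < t}" using fin by simp
    show "fst ` ?B \<subseteq> {l \<in> fst ` A. l < t}"
    proof
      fix l assume "l \<in> fst ` ?B"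
      then obtain j where j: "(l, j) \<in> A" "Suc j \<le> t" by auto
      then have "l < t" using bounds(2)[OF j(1)] by simp
      moreover have "l \<in> fst ` A" using imageI[OF j(1), of fst] by simp
      ultimately show "l \<in> {l \<in> fst ` A. l < t}" by simp
    qed
  qed
  finally show ?thesis .
qed

text \<open>The antichain prescribes the excedances, and the remaining positions receive the
  remaining values in increasing order. Of any three positions two belong to the same increasing
  sequence, which excludes 321.\<close>

lemma ex_S321_excedances:
  assumes A: "A \<in> antichains (root_poset_A (n - 1))"
  obtains \<pi> where "\<pi> \<in> S321 n" "excedances n \<pi> = A"
proof -
  have fin: "finite A" using A finite_root_poset_A finite_subset unfolding antichains_def by blast
  have bounds: "1 \<le> i" "i \<le> j" "j < n" if "(i, j) \<in> A" for i j
    using A that unfolding antichains_def root_poset_A_def by auto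
  let ?E = "fst ` A" and ?V = "Suc ` snd ` A"
  let ?N = "{1..n} - ?E" and ?W = "{1..n} - ?V"
  have sub: "?E \<subseteq> {1..n}" "?V \<subseteq> {1..n}" using bounds by fastforce+
  have "\<forall>i\<in>?E. \<exists>j. (i, j) \<in> A" by auto
  then obtain s where s: "\<And>i. i \<in> ?E \<Longrightarrow> (i, s i) \<in> A" by metis
  have s_eq: "s i = j" "i \<in> ?E" if "(i, j) \<in> A" for i j
  proof -
    show i: "i \<in> ?E" using imageI[OF that, of fst] by simp
    show "s i = j" using antichain_unique[OF A s[OF i] that] .
  qed
  define f where "f i = Suc (s i)" for i
  have fE: "f ` ?E = ?V"
  proof (intro equalityI subsetI)
    fix v assume "v \<in> f ` ?E"
    then obtain i where i: "i \<in> ?E" "v = Suc (s i)" unfolding f_def by blast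
    show "v \<in> ?V" using imageI[OF s[OF i(1)], of "\<lambda>p. Suc (snd p)"] i(2) by (simp add: image_image)
  next
    fix v assume "v \<in> ?V"
    then obtain i j where "(i, j) \<in> A" "v = Suc j" by auto
    then have "v = f i" "i \<in> ?E" using s_eq[of i j] unfolding f_def by simp_all
    then show "v \<in> f ` ?E" by blast
  qed
  have f_mono: "f i < f k" if "i \<in> ?E" "k \<in> ?E" "i < k" for i k
    using antichain_less[OF A s[OF that(1)] s[OF that(2)] that(3)] unfolding f_def by simp
  have "inj_on f ?E"
    by (rule inj_onI) (metis f_mono linorder_neqE_nat less_irrefl)
  then have f: "bij_betw f ?E ?V" using fE unfolding bij_betw_def by blast
  have cardEV: "card ?E = card ?V" using bij_betw_same_card[OF f] .
  have "card ?N = card ?W"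
    using cardEV sub fin by (simp add: card_Diff_subset)
  then obtain g where g: "bij_betw g ?N ?W" "strict_mono_on ?N g"
    using ex_strict_mono_bij_betw[of ?N ?W] by auto
  \<comment> \<open>If g x > x, all values up to x outside \<open>?V\<close> lie below g x. By
    dominance these are at least x minus the number of starts below x, whereas the rank of x among
    the remaining positions is x - 1 minus that number.\<close>
  have g_le: "g x \<le> x" if x: "x \<in> ?N" for x
  proof (rule ccontr)
    assume "\<not> g x \<le> x"
    have sx: "{z \<in> ?N. z < x} = {1..<x} - {l \<in> ?E. l < x}" using x by auto
    have "card {z \<in> ?N. z < x} = card {1..<x} - card {l \<in> ?E. l < x}"
      unfolding sx using sub fin by (intro card_Diff_subset) auto
    moreover have "card {l \<in> ?E. l < x} \<le> card {1..<x}" using sub by (intro card_mono) auto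
    moreover have "card ({1..x} - {v \<in> ?V. v \<le> x}) \<le> card {w \<in> ?W. w < g x}"
      using x \<open>\<not> g x \<le> x\<close> by (intro card_mono) auto
    moreover have "card ({1..x} - {v \<in> ?V. v \<le> x}) = card {1..x} - card {v \<in> ?V. v \<le> x}"
      using fin by (intro card_Diff_subset) auto
    moreover have "card {w \<in> ?W. w < g x} = card {z \<in> ?N. z < x}"
      using strict_mono_bij_rank[OF g x] .
    moreover have "1 \<le> x" using x by simp
    ultimately show False using antichain_dominance[OF A, of x] by simp
  qed
  define \<pi> where "\<pi> x = (if x \<in> ?E then f x else if x \<in> ?N then g x else x)" for x
  have \<pi>E: "\<pi> x = f x" if "x \<in> ?E" for x using that unfolding \<pi>_def by simp
  have \<pi>N: "\<pi> x = g x" if "x \<in> ?N" for x using that unfolding \<pi>_def by simp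
  have f_gt: "x < f x" if "x \<in> ?E" for x using bounds[OF s[OF that]] unfolding f_def by simp
  have "bij_betw \<pi> ?E ?V" using f by (rule bij_betw_cong[THEN iffD1, rotated]) (simp add: \<pi>E)
  moreover have "bij_betw \<pi> ?N ?W" using g(1) by (rule bij_betw_cong[THEN iffD1, rotated]) (simp add: \<pi>N)
  ultimately have "bij_betw \<pi> (?E \<union> ?N) (?V \<union> ?W)" by (rule bij_betw_combine) blast
  moreover have "?E \<union> ?N = {1..n}" "?V \<union> ?W = {1..n}" using sub by blast+
  ultimately have bij: "bij_betw \<pi> {1..n} {1..n}" by simp
  have perm: "\<pi> permutes {1..n}"
  proof (rule bij_imp_permutes[OF bij])
    fix x assume "x \<notin> {1..n}"
    then show "\<pi> x = x" using sub(1) unfolding \<pi>_def by auto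
  qed
  have exc_iff: "x \<in> ?E \<longleftrightarrow> x < \<pi> x" if "x \<in> {1..n}" for x
    using f_gt[of x] \<pi>E[of x] g_le[of x] \<pi>N[of x] that by fastforce
  have E_mono: "\<pi> i < \<pi> k" if "i \<in> ?E" "k \<in> ?E" "i < k" for i k using f_mono that \<pi>E by simp
  have N_mono: "\<pi> i < \<pi> k" if "i \<in> ?N" "k \<in> ?N" "i < k" for i k
    using strict_mono_onD[OF g(2) that] \<pi>N that by simp
  have "\<pi> \<in> S321 n"
    unfolding S321_def
  proof (intro CollectI conjI perm notI)
    assume "\<exists>i\<in>{1..n}. \<exists>j\<in>{1..n}. \<exists>k\<in>{1..n}. i < j \<and> j < k \<and> \<pi> j < \<pi> i \<and> \<pi> k < \<pi> j"
    then obtain i j k where ijk: "i \<in> {1..n}" "j \<in> {1..n}" "k \<in> {1..n}" "i < j" "j < k"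
      "\<pi> j < \<pi> i" "\<pi> k < \<pi> j" by blast
    have "\<not> (i \<in> ?E \<and> j \<in> ?E)" "\<not> (j \<in> ?E \<and> k \<in> ?E)" "\<not> (i \<in> ?E \<and> k \<in> ?E)"
      using E_mono[of i j] E_mono[of j k] E_mono[of i k] ijk by linarith+
    moreover have "\<not> (i \<in> ?N \<and> j \<in> ?N)" "\<not> (j \<in> ?N \<and> k \<in> ?N)" "\<not> (i \<in> ?N \<and> k \<in> ?N)"
      using N_mono[of i j] N_mono[of j k] N_mono[of i k] ijk by linarith+
    ultimately show False using ijk(1-3) by blast
  qed
  moreover have "excedances n \<pi> = A"
  proof (intro equalityI subrelI)
    fix i j
    show "(i, j) \<in> A" if "(i, j) \<in> excedances n \<pi>"
    proof -
      have ij: "i \<in> {1..n}" "i < \<pi> i" "j = \<pi> i - 1" using that unfolding excedances_iff by auto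
      then have "i \<in> ?E" using exc_iff by blast
      then have "j = s i" using ij(3) \<pi>E unfolding f_def by simp
      then show ?thesis using s[OF \<open>i \<in> ?E\<close>] by simp
    qed
    show "(i, j) \<in> excedances n \<pi>" if ij: "(i, j) \<in> A"
    proof -
      have i: "i \<in> ?E" using s_eq(2)[OF ij] .
      then have "i \<in> {1..n}" using sub by blast
      then show ?thesis using exc_iff i \<pi>E[OF i] s_eq(1)[OF ij] unfolding excedances_iff f_def by simp
    qed
  qed
  ultimately show ?thesis using that by blast
qed

lemma excedances_bij_betw: "bij_betw (excedances n) (S321 n) (antichains (root_poset_A (n - 1)))"
  unfolding bij_betw_def
proof
  show "excedances n ` S321 n = antichains (root_poset_A (n - 1))"
    using excedances_antichain ex_S321_excedances by (metis (no_types, lifting) equalityI imageI image_subset_iff subsetI)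
qed (rule inj_on_excedances)

section \<open>The inverse of the reverse-complement\<close>

lemma rev_compl_permutes:
  assumes "\<pi> permutes {1..n}"
  shows "rev_compl n \<pi> permutes {1..n}"
proof -
  define r where "r i = (if i \<in> {1..n} then n + 1 - i else i)" for i
  have "bij_betw r {1..n} {1..n}"
    by (rule bij_betw_byWitness[where f' = r]) (auto simp: r_def)
  then have r: "r permutes {1..n}" by (rule bij_imp_permutes) (auto simp: r_def)
  have "rev_compl n \<pi> = r \<circ> (\<pi> \<circ> r)"
  proof
    fix i
    show "rev_compl n \<pi> i = (r \<circ> (\<pi> \<circ> r)) i"
    proof (cases "i \<in> {1..n}")
      case True
      then have ri: "r i = n + 1 - i" "n + 1 - i \<in> {1..n}" unfolding r_def by auto
      then have "\<pi> (n + 1 - i) \<in> {1..n}" using permutes_in_image[OF assms] by blast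
      then show ?thesis using True ri(1) unfolding rev_compl_def r_def by simp
    next
      case False
      then show ?thesis using permutes_not_in[OF assms False] unfolding rev_compl_def r_def by auto
    qed
  qed
  then show ?thesis using permutes_compose[OF permutes_compose[OF r assms] r] by (simp add: comp_assoc)
qed

text \<open>The graph of \<sigma> is the graph of \<pi> reflected in the antidiagonal: the point (a,
  \<sigma> a) comes from (n + 1 - \<sigma> a, n + 1 - a).\<close>

lemma inv_rev_compl:
  assumes \<pi>: "\<pi> \<in> S321 n"
  defines "\<sigma> \<equiv> inv (rev_compl n \<pi>)"
  shows "\<sigma> permutes {1..n}" "a \<in> {1..n} \<Longrightarrow> \<pi> (n + 1 - \<sigma> a) = n + 1 - a"
proof -
  have rc: "rev_compl n \<pi> permutes {1..n}" using rev_compl_permutes[OF S321_permutes[OF \<pi>]] .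
  show s: "\<sigma> permutes {1..n}" unfolding \<sigma>_def by (rule permutes_inv[OF rc])
  assume a: "a \<in> {1..n}"
  then have sa: "\<sigma> a \<in> {1..n}" using permutes_in_image[OF s] by blast
  then have "n + 1 - \<sigma> a \<in> {1..n}" by auto
  then have "\<pi> (n + 1 - \<sigma> a) \<in> {1..n}" using S321_mem[OF \<pi>] by blast
  moreover have "a = rev_compl n \<pi> (\<sigma> a)" unfolding \<sigma>_def by (simp add: permutes_inverses[OF rc])
  then have "a = n + 1 - \<pi> (n + 1 - \<sigma> a)" using sa unfolding rev_compl_def by simp
  ultimately show "\<pi> (n + 1 - \<sigma> a) = n + 1 - a" by auto
qed

text \<open>Reflection in the antidiagonal keeps decreasing triples of graph points
  decreasing.\<close>

lemma inv_rev_compl_S321: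
  assumes \<pi>: "\<pi> \<in> S321 n"
  shows "inv (rev_compl n \<pi>) \<in> S321 n"
  unfolding S321_def
proof (intro CollectI conjI notI)
  let ?s = "inv (rev_compl n \<pi>)"
  note s = inv_rev_compl[OF \<pi>]
  show "?s permutes {1..n}" using s(1) .
  assume "\<exists>i\<in>{1..n}. \<exists>j\<in>{1..n}. \<exists>k\<in>{1..n}. i < j \<and> j < k \<and> ?s j < ?s i \<and> ?s k < ?s j"
  then obtain i j k where ijk: "i \<in> {1..n}" "j \<in> {1..n}" "k \<in> {1..n}" "i < j" "j < k"
    "?s j < ?s i" "?s k < ?s j" by blast
  have mem: "?s x \<in> {1..n}" if "x \<in> {1..n}" for x using permutes_in_image[OF s(1)] that by blast
  note m = mem[OF ijk(1)] mem[OF ijk(2)] mem[OF ijk(3)]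
  show False
  proof (rule S321_avoids[OF \<pi>])
    show "n + 1 - ?s i \<in> {1..n}" "n + 1 - ?s j \<in> {1..n}" "n + 1 - ?s k \<in> {1..n}" using m by auto
    show "n + 1 - ?s i < n + 1 - ?s j" "n + 1 - ?s j < n + 1 - ?s k" using m ijk by auto
    show "\<pi> (n + 1 - ?s j) < \<pi> (n + 1 - ?s i)" "\<pi> (n + 1 - ?s k) < \<pi> (n + 1 - ?s j)"
      using s(2)[OF ijk(1)] s(2)[OF ijk(2)] s(2)[OF ijk(3)] ijk by auto
  qed
qed

text \<open>The reflected point of (i, \<pi> i) is (n + 1 - \<pi> i, n + 1 - i). With j = \<pi> i -
  1 its interval is [n - j, n - i]: the shift by one in \<open>excedances\<close> turns n + 1 into
  n.\<close>

lemma excedances_inv_rev_compl: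
  assumes \<pi>: "\<pi> \<in> S321 n"
  shows "excedances n (inv (rev_compl n \<pi>)) = flip n (excedances n \<pi>)"
proof -
  let ?s = "inv (rev_compl n \<pi>)"
  note s = inv_rev_compl[OF \<pi>]
  have mem: "?s x \<in> {1..n}" if "x \<in> {1..n}" for x using permutes_in_image[OF s(1)] that by blast
  show ?thesis
  proof (intro equalityI subrelI)
    fix p q
    show "(p, q) \<in> flip n (excedances n \<pi>)" if "(p, q) \<in> excedances n ?s"
    proof -
      have pq: "p \<in> {1..n}" "p < ?s p" "q = ?s p - 1" using that unfolding excedances_iff by auto
      let ?i = "n + 1 - ?s p"
      have "(?i, n - p) \<in> excedances n \<pi>"
        using pq s(2)[OF pq(1)] mem[OF pq(1)] unfolding excedances_iff by auto
      then have "(n - (n - p), n - ?i) \<in> flip n (excedances n \<pi>)" unfolding flip_def by force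
      moreover have "n - (n - p) = p" "n - ?i = q" using pq mem[OF pq(1)] by auto
      ultimately show ?thesis by simp
    qed
    show "(p, q) \<in> excedances n ?s" if pq: "(p, q) \<in> flip n (excedances n \<pi>)"
    proof -
      obtain i j where ij: "(i, j) \<in> excedances n \<pi>" "p = n - j" "q = n - i"
        using pq unfolding flip_def by auto
      have i: "i \<in> {1..n}" "i < \<pi> i" "j = \<pi> i - 1" using ij(1) unfolding excedances_iff by auto
      have pi: "\<pi> i \<in> {1..n}" using S321_mem[OF \<pi> i(1)] .
      have p: "p = n + 1 - \<pi> i" "p \<in> {1..n}" using ij i pi by auto
      have "\<pi> (n + 1 - ?s p) = \<pi> i" using s(2)[OF p(2)] p pi by auto
      then have "n + 1 - ?s p = i" by (rule S321_inj[OF \<pi>])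
      then have "?s p = n + 1 - i" using mem[OF p(2)] by auto
      then show ?thesis using p ij i pi unfolding excedances_iff by auto
    qed
  qed
qed

lemma AST_excedances_bij_betw:
  "bij_betw (AST n \<circ> excedances n) {\<pi> \<in> S321 n. \<pi> = inv (rev_compl n \<pi>)} (symmetric_matchings n)"
proof -
  have "bij_betw (excedances n) {\<pi> \<in> S321 n. inv (rev_compl n \<pi>) = \<pi>}
      {A \<in> antichains (root_poset_A (n - 1)). flip n A = A}"
    by (rule bij_betw_fixed_points[where g' = "flip n", OF excedances_bij_betw])
      (fact inv_rev_compl_S321 excedances_inv_rev_compl)+
  moreover have "{\<pi> \<in> S321 n. inv (rev_compl n \<pi>) = \<pi>} = {\<pi> \<in> S321 n. \<pi> = inv (rev_compl n \<pi>)}"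
    by (intro Collect_cong conj_cong refl eq_commute)
  ultimately show ?thesis using bij_betw_trans[OF _ AST_bij_betw_symmetric] by simp
qed

section \<open>Tunnels\<close>

text \<open>Letter counts become cardinalities of sets of positions, to which the partner map of a
  matching applies. Positions z count from 1, list indices from 0.\<close>

lemma count_list_take_drop:
  "x + k \<le> length w \<Longrightarrow> count_list (take k (drop x w)) a = card {z \<in> {x<..x + k}. w ! (z - 1) = a}"
proof (induction k)
  case (Suc k)
  have "take (Suc k) (drop x w) = take k (drop x w) @ [w ! (x + k)]"
    using Suc.prems by (simp add: take_Suc_conv_app_nth)
  moreover have "{z \<in> {x<..x + Suc k}. w ! (z - 1) = a} =
      {z \<in> {x<..x + k}. w ! (z - 1) = a} \<union> (if w ! (x + k) = a then {x + Suc k} else {})"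
    by (auto simp: le_Suc_eq)
  ultimately show ?case using Suc by (simp add: card_insert_if)
qed simp

text \<open>With a second, later closing step the longer inner word would have a Dyck word followed
  by D as a prefix, which has one D too many.\<close>

lemma tunnel_unique:
  assumes "tunnel w x y" "tunnel w x y'"
  shows "y = y'"
proof -
  have "\<not> y < y'" if t: "tunnel w x y" "tunnel w x y'" for y y'
  proof
    assume "y < y'"
    obtain k where k: "take (y - x - 1) (drop x w) \<in> Dyck k" using t(1) unfolding tunnel_def by blast
    obtain k' where k': "take (y' - x - 1) (drop x w) \<in> Dyck k'" using t(2) unfolding tunnel_def by blast
    have b: "x < y" "y' \<le> length w" "w ! (y - 1) = D" using t unfolding tunnel_def by auto
    have "take (y - x) (take (y' - x - 1) (drop x w)) = take (y - x) (drop x w)"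
      using b \<open>y < y'\<close> by (simp add: min_def)
    moreover have "y - x \<le> length (take (y' - x - 1) (drop x w))" using b \<open>y < y'\<close> by simp
    ultimately have le: "count_list (take (y - x) (drop x w)) D \<le> count_list (take (y - x) (drop x w)) U"
      using k' unfolding Dyck_def by (metis (mono_tags, lifting) mem_Collect_eq)
    have "y - x = Suc (y - x - 1)" using b by simp
    then have "take (y - x) (drop x w) = take (y - x - 1) (drop x w) @ [drop x w ! (y - x - 1)]"
      using b \<open>y < y'\<close> by (metis take_Suc_conv_app_nth length_drop diff_less_mono less_imp_le_nat order_less_le_trans Suc_le_lessD order_refl)
    moreover have "drop x w ! (y - x - 1) = D" using b \<open>y < y'\<close> by simp
    ultimately have eq: "take (y - x) (drop x w) = take (y - x - 1) (drop x w) @ [D]" by simp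
    show False using le k unfolding eq Dyck_def by simp
  qed
  then show ?thesis using assms by (metis linorder_neqE_nat)
qed

text \<open>No edge leaves the span of {x, y}, and inside it every D is joined to a U on its left;
  this is the prefix condition. On the whole span the partner map also sends every U to a D, which
  gives balance.\<close>

lemma tunnel_of_edge:
  assumes M: "M \<in> noncrossing_matchings n" and len: "length w = 2 * n"
    and lab: "\<And>x y. {x, y} \<in> M \<Longrightarrow> x < y \<Longrightarrow> w ! (x - 1) = U \<and> w ! (y - 1) = D"
    and e: "{x, y} \<in> M" and less: "x < y"
  shows "tunnel w x y"
proof -
  have X: "x \<in> {1..2 * n}" "y \<in> {1..2 * n}" using noncrossing_mem[OF M e] by auto
  let ?s = "take (y - x - 1) (drop x w)"
  let ?L = "\<lambda>k a. {z \<in> {x<..x + k}. w ! (z - 1) = a}"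
  have ls: "length ?s = y - x - 1" using X len by (auto simp: min_def)
  have cnt: "count_list (take k ?s) a = card (?L k a)" if "k \<le> y - x - 1" for k a
    using count_list_take_drop[of x k w a] that X less len by (simp add: min_def)
  have partner: "x < z' \<and> z' < y" if z: "{z, z'} \<in> M" "x < z" "z < y" for z z'
  proof -
    have "z \<in> {1..2 * n}" using noncrossing_mem[OF M z(1)] by blast
    then obtain d where "{z, d} \<in> M" "x < d" "d < y"
      using nestedD[OF noncrossing_nested(1)[OF M] e] z by blast
    then show ?thesis using pairing_unique[OF noncrossing_pairing[OF M] z(1)] by blast
  qed
  have D: "z' < z \<and> w ! (z' - 1) = U" if z: "{z, z'} \<in> M" "w ! (z - 1) = D" for z z'
  proof -
    have "\<not> z < z'" using lab[OF z(1)] z(2) by auto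
    then have "z' < z" using noncrossing_mem(3)[OF M z(1)] by linarith
    moreover have "{z', z} \<in> M" using z(1) by (simp add: insert_commute)
    ultimately show ?thesis using lab by blast
  qed
  have U: "z < z' \<and> w ! (z' - 1) = D" if z: "{z, z'} \<in> M" "w ! (z - 1) = U" for z z'
  proof -
    have e': "{z', z} \<in> M" using z(1) by (simp add: insert_commute)
    have "\<not> z' < z" using lab[OF e'] z(2) by auto
    then have "z < z'" using noncrossing_mem(3)[OF M z(1)] by linarith
    then show ?thesis using lab z(1) by blast
  qed
  have sub: "?L k a \<subseteq> \<Union>M" if "k \<le> y - x - 1" for k a
    unfolding noncrossing_Union[OF M] using that X less by auto
  have DU: "card (?L k D) \<le> card (?L k U)" if k: "k \<le> y - x - 1" for k
  proof (rule pairing_card_le[OF noncrossing_pairing[OF M] sub[OF k]])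
    fix z z' assume z: "z \<in> ?L k D" "{z, z'} \<in> M"
    then have "x < z'" using partner[OF z(2)] k less by auto
    then show "z' \<in> ?L k U" using D[OF z(2)] z by auto
  qed simp
  have UD: "card (?L (y - x - 1) U) \<le> card (?L (y - x - 1) D)"
  proof (rule pairing_card_le[OF noncrossing_pairing[OF M] sub[OF order_refl]])
    fix z z' assume z: "z \<in> ?L (y - x - 1) U" "{z, z'} \<in> M"
    then have "x < z'" "z' < y" using partner[OF z(2)] less by auto
    then show "z' \<in> ?L (y - x - 1) D" using U[OF z(2)] z by auto
  qed simp
  have "?s \<in> Dyck (count_list ?s U)"
    unfolding Dyck_def
  proof (intro CollectI conjI allI impI refl)
    have "take (y - x - 1) ?s = ?s" by simp
    then show "count_list ?s D = count_list ?s U"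
      using cnt[OF order_refl, of U] cnt[OF order_refl, of D] DU[OF order_refl] UD by simp
    show "count_list (take k ?s) D \<le> count_list (take k ?s) U" if "k \<le> length ?s" for k
      using that DU unfolding ls by (simp only: cnt)
  qed
  then show ?thesis using X less len lab[OF e less] unfolding tunnel_def by auto
qed

text \<open>Reduces equality of matchings to a check of labels: it suffices that the word has U at
  every left and D at every right end point.\<close>

lemma Match_eqI:
  assumes M: "M \<in> noncrossing_matchings n" and len: "length w = 2 * n"
    and lab: "\<And>x y. {x, y} \<in> M \<Longrightarrow> x < y \<Longrightarrow> w ! (x - 1) = U \<and> w ! (y - 1) = D"
  shows "Match w = M"
proof (intro equalityI subsetI)
  fix e assume "e \<in> Match w"
  then obtain x y where xy: "e = {x, y}" "tunnel w x y" unfolding Match_def by blast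
  have x: "x \<in> {1..2 * n}" "w ! (x - 1) = U" using xy(2) len unfolding tunnel_def by auto
  obtain z where z: "{x, z} \<in> M"
    using pairing_partner[OF noncrossing_pairing[OF M], of x] x(1) noncrossing_Union[OF M] by blast
  have z': "{z, x} \<in> M" using z by (simp add: insert_commute)
  have "\<not> z < x" using lab[OF z'] x(2) by auto
  then have "x < z" using noncrossing_mem(3)[OF M z] by linarith
  then have "tunnel w x z" using tunnel_of_edge[OF M len lab z] by blast
  then have "y = z" using tunnel_unique[OF xy(2)] by blast
  then show "e \<in> M" using xy(1) z by simp
next
  fix e assume e: "e \<in> M"
  then obtain x y where xy: "e = {x, y}" "x \<noteq> y" using pairing_edge[OF noncrossing_pairing[OF M]] by metis
  have "\<exists>x y. e = {x, y} \<and> x < y"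
  proof (cases "x < y")
    case False
    then have "e = {y, x}" "y < x" using xy by (auto simp: insert_commute)
    then show ?thesis by blast
  qed (use xy in blast)
  then obtain x y where "e = {x, y}" "x < y" by blast
  then show "e \<in> Match w" using tunnel_of_edge[OF M len lab, of x y] e unfolding Match_def by blast
qed

section \<open>The first rows in the RSK correspondence\<close>

text \<open>Agrees with \<open>hd\<close> on nonempty tableaux and has a value at the empty start of
  the insertion.\<close>

definition top_row :: "'a list list \<Rightarrow> 'a list" where
  "top_row T = (case T of [] \<Rightarrow> [] | r # _ \<Rightarrow> r)"

lemma row_insert_sorted:
  assumes "sorted_wrt (<) r" "x \<notin> set r"
  shows "sorted_wrt (<) (fst (row_insert x r)) \<and>
    ((snd (row_insert x r) = None \<and> set (fst (row_insert x r)) = insert x (set r) \<and> (\<forall>y\<in>set r. y < x)) \<or>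
     (\<exists>w\<in>set r. snd (row_insert x r) = Some w \<and> x < w \<and> (\<forall>y\<in>set r. x < y \<longrightarrow> w \<le> y) \<and>
        set (fst (row_insert x r)) = insert x (set r - {w})))"
  using assms
proof (induction r)
  case (Cons y r)
  show ?case
  proof (cases "x < y")
    case True
    have "y \<notin> set r" using Cons.prems by auto
    then show ?thesis using True Cons.prems by (auto simp: less_imp_le)
  next
    case False
    then have less: "y < x" using Cons.prems by auto
    obtain r' b where rb: "row_insert x r = (r', b)" by fastforce
    have IH: "sorted_wrt (<) r' \<and> ((b = None \<and> set r' = insert x (set r) \<and> (\<forall>y\<in>set r. y < x)) \<or>
     (\<exists>w\<in>set r. b = Some w \<and> x < w \<and> (\<forall>y\<in>set r. x < y \<longrightarrow> w \<le> y) \<and> set r' = insert x (set r - {w})))"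
      using Cons rb by simp
    have ins: "row_insert x (y # r) = (y # r', b)" using False rb by simp
    have yr: "\<forall>z\<in>set r. y < z" using Cons.prems by simp
    then have "\<forall>z\<in>set r'. y < z" using IH less by auto
    then show ?thesis using IH less yr unfolding ins by auto
  qed
qed simp

text \<open>Lower rows never influence the first one, and the new cell lies in the first row exactly
  when nothing is bumped from it. So it suffices to follow the first rows of both tableaux.\<close>

lemma tab_insert_top:
  "top_row (fst (tab_insert x T)) = fst (row_insert x (top_row T))"
  "snd (tab_insert x T) = 0 \<longleftrightarrow> snd (row_insert x (top_row T)) = None"
  "fst (tab_insert x T) \<noteq> []"
  by (cases T; auto simp: top_row_def split: prod.splits option.splits)+

lemma append_to_row_top:
  assumes "T = [] \<Longrightarrow> d = 0"
  shows "top_row (append_to_row k d T) = (if d = 0 then top_row T @ [k] else top_row T)"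
    and "append_to_row k d T \<noteq> []"
  using assms by (cases T; cases d; auto simp: top_row_def append_to_row_def)+

definition rsk_state :: "nat \<Rightarrow> (nat \<Rightarrow> nat) \<Rightarrow> nat list list \<times> nat list list" where
  "rsk_state i \<pi> = fold (rsk_step \<pi>) [1..<i + 1] ([], [])"

definition top_P :: "(nat \<Rightarrow> nat) \<Rightarrow> nat \<Rightarrow> nat list" where
  "top_P \<pi> i = top_row (fst (rsk_state i \<pi>))"

definition top_Q :: "(nat \<Rightarrow> nat) \<Rightarrow> nat \<Rightarrow> nat list" where
  "top_Q \<pi> i = top_row (snd (rsk_state i \<pi>))"

lemma rsk_state_nonempty: "fst (rsk_state i \<pi>) = [] \<longleftrightarrow> i = 0" "snd (rsk_state i \<pi>) = [] \<longleftrightarrow> i = 0"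
  and top_P_Suc: "top_P \<pi> (Suc i) = fst (row_insert (\<pi> (Suc i)) (top_P \<pi> i))"
  and top_Q_Suc: "top_Q \<pi> (Suc i) =
    (if snd (row_insert (\<pi> (Suc i)) (top_P \<pi> i)) = None then top_Q \<pi> i @ [Suc i] else top_Q \<pi> i)"
proof -
  have step: "rsk_state (Suc i) \<pi> = rsk_step \<pi> (Suc i) (rsk_state i \<pi>)" for i
    unfolding rsk_state_def by simp
  have step': "fst (rsk_state (Suc i) \<pi>) = fst (tab_insert (\<pi> (Suc i)) (fst (rsk_state i \<pi>)))"
    "snd (rsk_state (Suc i) \<pi>) =
      append_to_row (Suc i) (snd (tab_insert (\<pi> (Suc i)) (fst (rsk_state i \<pi>)))) (snd (rsk_state i \<pi>))" for i
    unfolding step rsk_step_def by (simp_all add: case_prod_unfold Let_def)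
  have ne: "(fst (rsk_state i \<pi>) = [] \<longleftrightarrow> i = 0) \<and> (snd (rsk_state i \<pi>) = [] \<longleftrightarrow> i = 0)" for i
  proof (induction i)
    case 0
    then show ?case by (simp add: rsk_state_def)
  next
    case (Suc i)
    have "snd (tab_insert (\<pi> (Suc i)) (fst (rsk_state i \<pi>))) = 0" if "snd (rsk_state i \<pi>) = []"
      using that Suc by simp
    then show ?case unfolding step' using tab_insert_top(3) append_to_row_top(2) by simp
  qed
  then show "fst (rsk_state i \<pi>) = [] \<longleftrightarrow> i = 0" "snd (rsk_state i \<pi>) = [] \<longleftrightarrow> i = 0" by blast+
  show "top_P \<pi> (Suc i) = fst (row_insert (\<pi> (Suc i)) (top_P \<pi> i))"
    unfolding top_P_def step' by (rule tab_insert_top(1))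
  have "snd (tab_insert (\<pi> (Suc i)) (fst (rsk_state i \<pi>))) = 0" if "snd (rsk_state i \<pi>) = []"
    using that ne[of i] by simp
  then show "top_Q \<pi> (Suc i) =
    (if snd (row_insert (\<pi> (Suc i)) (top_P \<pi> i)) = None then top_Q \<pi> i @ [Suc i] else top_Q \<pi> i)"
    unfolding top_P_def top_Q_def step' by (simp add: append_to_row_top(1) tab_insert_top(2))
qed

lemma top_0: "top_P \<pi> 0 = []" "top_Q \<pi> 0 = []"
  unfolding top_P_def top_Q_def rsk_state_def top_row_def by simp_all

text \<open>The point bar k has list index 2n + 1 - k - 1 = 2n - k, which is where the reversed
  second half of the word records k.\<close>

lemma RSK_hat_nth:
  assumes "n \<ge> 1"
  shows "length (RSK_hat n \<pi>) = 2 * n"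
    and "x \<in> {1..n} \<Longrightarrow> RSK_hat n \<pi> ! (x - 1) = (if x \<in> set (top_P \<pi> n) then U else D)"
    and "k \<in> {1..n} \<Longrightarrow> RSK_hat n \<pi> ! (2 * n - k) = (if k \<in> set (top_Q \<pi> n) then D else U)"
proof -
  have "RSK n \<pi> = rsk_state n \<pi>" unfolding RSK_def rsk_state_def ..
  moreover have "hd T = top_row T" if "T \<noteq> []" for T :: "nat list list"
    using that by (cases T) (auto simp: top_row_def)
  ultimately have eq: "RSK_hat n \<pi> =
      map (\<lambda>i. if i \<in> set (top_P \<pi> n) then U else D) [1..<n + 1] @
      map (\<lambda>i. if i \<in> set (top_Q \<pi> n) then D else U) (rev [1..<n + 1])"
    using rsk_state_nonempty[of n \<pi>] assms
    unfolding RSK_hat_def top_P_def top_Q_def by (simp add: case_prod_unfold Let_def)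
  show "length (RSK_hat n \<pi>) = 2 * n" unfolding eq by simp
  show "RSK_hat n \<pi> ! (x - 1) = (if x \<in> set (top_P \<pi> n) then U else D)" if "x \<in> {1..n}"
    using that unfolding eq by (auto simp: nth_append simp del: upt_Suc)
  show "RSK_hat n \<pi> ! (2 * n - k) = (if k \<in> set (top_Q \<pi> n) then D else U)" if "k \<in> {1..n}"
  proof -
    have "rev [1..<n + 1] ! (n - k) = k" using that by (auto simp: rev_nth simp del: upt_Suc)
    then show ?thesis using that unfolding eq by (auto simp: nth_append simp del: upt_Suc)
  qed
qed

section \<open>Row insertion along the Armstrong--Stump--Thomas algorithm\<close>

text \<open>The values marked for bumping. Such an edge is placed in the round that reads c, since a
  round without excedance always uses a bar.\<close>

definition value_closers :: "nat \<Rightarrow> nat set set \<Rightarrow> nat set" where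
  "value_closers n M = {c. c \<le> n \<and> (\<exists>v<c. {v, c} \<in> M)}"

text \<open>A round that bumps joins its own bar to one of these; the invariant keeps their number
  equal to that of the pending bumps.\<close>

definition free_bars :: "nat \<Rightarrow> nat \<Rightarrow> nat set set \<Rightarrow> nat set" where
  "free_bars n i M = {k \<in> {1..i}. 2 * n + 1 - k \<notin> \<Union>M}"

text \<open>
  The entries of the first row that would still be bumped if no further excedance were inserted.
  The two counting conditions in \<open>rsk_inv\<close> say that these are exactly the entries reached when the
  values \<open>y\<close> still to come are paired greedily with larger entries of the row.
\<close>

definition bumpable :: "nat \<Rightarrow> (nat \<Rightarrow> nat) \<Rightarrow> nat \<Rightarrow> nat set set \<Rightarrow> nat set" where
  "bumpable n \<pi> i M = value_closers n M \<inter> set (top_P \<pi> i)"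

definition rsk_inv :: "nat \<Rightarrow> (nat \<Rightarrow> nat) \<Rightarrow> nat \<Rightarrow> nat set set \<Rightarrow> bool" where
  "rsk_inv n \<pi> i M \<longleftrightarrow>
     sorted_wrt (<) (top_P \<pi> i) \<and> set (top_P \<pi> i) \<subseteq> \<pi> ` {1..i} \<and>
     value_closers n M \<subseteq> \<pi> ` {1..i} \<and> \<pi> ` {1..i} - set (top_P \<pi> i) \<subseteq> value_closers n M \<and>
     card (bumpable n \<pi> i M) = card (free_bars n i M) \<and>
     (\<forall>c\<in>bumpable n \<pi> i M. card {b \<in> bumpable n \<pi> i M. b \<le> c} \<le> card {y \<in> \<pi> ` {i<..n}. y < c}) \<and>
     (\<forall>l\<in>{1..i}. l < \<pi> l \<longrightarrow> \<pi> l \<in> set (top_P \<pi> i) \<longrightarrow> \<pi> l \<notin> value_closers n M \<longrightarrow>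
        card {y \<in> \<pi> ` {i<..n}. y < \<pi> l} \<le> card {b \<in> bumpable n \<pi> i M. b < \<pi> l}) \<and>
     set (top_Q \<pi> i) \<subseteq> {1..i} \<and>
     (\<forall>k\<in>{1..i}. k \<in> set (top_Q \<pi> i) \<longleftrightarrow> (\<forall>k'\<in>{1..<k}. {2 * n + 1 - k', 2 * n + 1 - k} \<notin> M))"

lemma value_closers_insert:
  assumes "x \<noteq> u"
  shows "value_closers n (insert {x, u} M) =
    value_closers n M \<union> (if x \<le> n \<and> u \<le> n then {max x u} else {})"
proof -
  have new: "(\<exists>v<c. {v, c} = {x, u}) \<longleftrightarrow> c = max x u" for c
    using assms by (auto simp: doubleton_eq_iff max_def)
  show ?thesis
  proof (rule set_eqI)
    fix c
    have "c \<in> value_closers n (insert {x, u} M) \<longleftrightarrow> c \<le> n \<and> (c = max x u \<or> (\<exists>v<c. {v, c} \<in> M))"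
      unfolding value_closers_def using new[of c] by blast
    also have "\<dots> \<longleftrightarrow> c \<in> value_closers n M \<union> (if x \<le> n \<and> u \<le> n then {max x u} else {})"
      unfolding value_closers_def by auto
    finally show "c \<in> value_closers n (insert {x, u} M) \<longleftrightarrow>
      c \<in> value_closers n M \<union> (if x \<le> n \<and> u \<le> n then {max x u} else {})" .
  qed
qed

lemma value_closers_Union: "value_closers n M \<subseteq> \<Union>M"
  unfolding value_closers_def by blast

lemma atLeastAtMost_image_Suc: "\<pi> ` {1..Suc i} = insert (\<pi> (Suc i)) (\<pi> ` {1..i})"
  by (simp add: atLeastAtMostSuc_conv)

lemma image_greaterThanAtMost_Suc:
  assumes "i < n" "inj \<pi>"
  shows "\<pi> ` {Suc i<..n} = \<pi> ` {i<..n} - {\<pi> (Suc i)}"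
proof -
  have "{i<..n} = insert (Suc i) {Suc i<..n}" using assms(1) by auto
  moreover have "\<pi> (Suc i) \<notin> \<pi> ` {Suc i<..n}" using injD[OF assms(2)] by fastforce
  ultimately show ?thesis by auto
qed

text \<open>The value j exceeds everything read before, so it is appended to the row, and bar (i+1)
  remains free. If AST joins j to a value, then j is a new pending bump, balanced by the new free
  bar; if it joins j to a bar, the new free bar replaces the one used up.\<close>

lemma rsk_inv_excedance:
  assumes \<pi>: "\<pi> \<in> S321 n" and i: "i < n" and exc: "Suc i < \<pi> (Suc i)"
    and ainv: "ast_inv n (excedances n \<pi>) i M" and rinv: "rsk_inv n \<pi> i M"
  shows "rsk_inv n \<pi> (Suc i) (ast_step n (excedances n \<pi>) (Suc i) M)"
proof -
  define A where "A = excedances n \<pi>"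
  define j where "j = \<pi> (Suc i)"
  have A: "A \<in> antichains (root_poset_A (n - 1))" using excedances_antichain[OF \<pi>] unfolding A_def .
  have inj: "inj \<pi>" using permutes_inj[OF S321_permutes[OF \<pi>]] .
  have Si: "Suc i \<in> {1..n}" using i by simp
  have jb: "Suc i < j" "j \<le> n" using exc S321_mem[OF \<pi> Si] unfolding j_def by auto
  have jA: "(Suc i, j - 1) \<in> A" using Si exc unfolding A_def excedances_iff j_def by simp
  let ?bar = "\<lambda>k. 2 * n + 1 - k"
  obtain u where u: "ast_step n A (Suc i) M = insert {j, u} M" "u \<in> {1..2 * n}" "u \<notin> \<Union>M" "j \<notin> \<Union>M"
      "half_turn n u < half_turn n j"
    and between: "\<And>c. c \<in> {1..2 * n} \<Longrightarrow> half_turn n u < half_turn n c \<Longrightarrow> half_turn n c < half_turn n j \<Longrightarrow> c \<in> \<Union>M"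
    and ubar: "n < u \<Longrightarrow> 2 * n + 1 - i \<le> u"
    using ast_step_start[OF A ainv[folded A_def] i jA] by metis
  define M' where "M' = insert {j, u} M"
  have a: "finite M" "pairing M" "card M = i" "\<Union>M \<subseteq> {1..2 * n}"
    "\<forall>x\<in>\<Union>M. n < x \<longrightarrow> 2 * n + 1 - i \<le> x"
    "\<forall>x\<in>\<Union>M. x \<le> n \<longrightarrow> x \<le> i \<or> (\<exists>l j. l \<le> i \<and> (l, j - 1) \<in> A \<and> x \<le> j)"
    using ainv unfolding ast_inv_def A_def by simp_all
  have r: "sorted_wrt (<) (top_P \<pi> i)" "set (top_P \<pi> i) \<subseteq> \<pi> ` {1..i}"
    "value_closers n M \<subseteq> \<pi> ` {1..i}" "\<pi> ` {1..i} - set (top_P \<pi> i) \<subseteq> value_closers n M"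
    "card (bumpable n \<pi> i M) = card (free_bars n i M)"
    "\<forall>c\<in>bumpable n \<pi> i M. card {b \<in> bumpable n \<pi> i M. b \<le> c} \<le> card {y \<in> \<pi> ` {i<..n}. y < c}"
    "\<forall>l\<in>{1..i}. l < \<pi> l \<longrightarrow> \<pi> l \<in> set (top_P \<pi> i) \<longrightarrow> \<pi> l \<notin> value_closers n M \<longrightarrow>
        card {y \<in> \<pi> ` {i<..n}. y < \<pi> l} \<le> card {b \<in> bumpable n \<pi> i M. b < \<pi> l}"
    "set (top_Q \<pi> i) \<subseteq> {1..i}"
    "\<forall>k\<in>{1..i}. k \<in> set (top_Q \<pi> i) \<longleftrightarrow> (\<forall>k'\<in>{1..<k}. {?bar k', ?bar k} \<notin> M)"
    using rinv unfolding rsk_inv_def by blast+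
  have low: "\<pi> l < j" if "l \<in> {1..i}" for l
    using S321_excedance_less[OF \<pi> _ Si _ exc, of l] that i unfolding j_def by simp
  then have rowlow: "y < j" if "y \<in> set (top_P \<pi> i)" for y using r(2) that by blast
  have jR: "j \<notin> set (top_P \<pi> i)" using rowlow by blast
  have ins: "snd (row_insert j (top_P \<pi> i)) = None" "sorted_wrt (<) (fst (row_insert j (top_P \<pi> i)))"
    "set (fst (row_insert j (top_P \<pi> i))) = insert j (set (top_P \<pi> i))"
    using row_insert_sorted[OF r(1) jR] rowlow by (metis less_asym)+
  have P': "sorted_wrt (<) (top_P \<pi> (Suc i))" "set (top_P \<pi> (Suc i)) = insert j (set (top_P \<pi> i))"
    and Q': "set (top_Q \<pi> (Suc i)) = insert (Suc i) (set (top_Q \<pi> i))"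
    using ins unfolding top_P_Suc top_Q_Suc j_def by simp_all
  have uj: "u < j" if "u \<le> n" using u(5) that jb unfolding half_turn_def by simp
  have ju: "j \<noteq> u" using u(5) by auto
  let ?T = "bumpable n \<pi> i M" and ?T' = "bumpable n \<pi> (Suc i) M'"
  have C': "value_closers n M' = value_closers n M \<union> (if u \<le> n then {j} else {})"
    unfolding M'_def value_closers_insert[OF ju] using jb uj by (cases "u \<le> n") (simp_all add: less_imp_le)
  have jC: "j \<notin> value_closers n M" using value_closers_Union u(4) by blast
  have T': "?T' = ?T \<union> (if u \<le> n then {j} else {})"
    unfolding bumpable_def C' P'(2) using jC jR by auto
  have Tlow: "b < j" if "b \<in> ?T" for b using that rowlow unfolding bumpable_def by blast
  have finT: "finite ?T" unfolding bumpable_def by simp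
  have Y': "{y \<in> \<pi> ` {Suc i<..n}. y < c} = {y \<in> \<pi> ` {i<..n}. y < c}" if "c \<le> j" for c
    using that unfolding image_greaterThanAtMost_Suc[OF i inj] j_def by auto
  have F: "free_bars n i M \<subseteq> {1..i}" "finite (free_bars n i M)" unfolding free_bars_def by auto
  have barSi: "?bar (Suc i) \<notin> \<Union>M'"
  proof
    assume "?bar (Suc i) \<in> \<Union>M'"
    then consider "?bar (Suc i) = j" | "?bar (Suc i) = u" | "?bar (Suc i) \<in> \<Union>M" unfolding M'_def by auto
    then show False
    proof cases
      case 3
      then show False using a(5) i by fastforce
    next
      case 2
      then have "n < u" using i by linarith
      then show False using ubar 2 i by linarith
    qed (use jb i in linarith)
  qed
  have fb: "k \<in> free_bars n (Suc i) M' \<longleftrightarrow> k = Suc i \<or> (k \<in> free_bars n i M \<and> ?bar k \<noteq> u)" for k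
  proof (cases "k = Suc i")
    case True
    then show ?thesis using barSi unfolding free_bars_def by simp
  next
    case False
    have "?bar k \<noteq> j" if "k \<in> {1..i}" using jb that i by auto
    then show ?thesis using False unfolding free_bars_def M'_def by (auto simp: le_Suc_eq)
  qed
  text \<open>The points below \<open>j\<close> on the two half circles are the matched ones and the free ones.\<close>
  let ?W = "{1..<j} - \<Union>M"
  have cardY: "card {y \<in> \<pi> ` {i<..n}. y < j} = card ?W + card (free_bars n i M)"
  proof -
    have "{1..n} = {1..i} \<union> {i<..n}" using i by auto
    then have "\<pi> ` {1..n} = \<pi> ` {1..i} \<union> \<pi> ` {i<..n}" by (simp only: image_Un)
    then have n_eq: "{1..n} = \<pi> ` {1..i} \<union> \<pi> ` {i<..n}"
      using permutes_image[OF S321_permutes[OF \<pi>]] by simp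
    have "{1..<j} = \<pi> ` {1..i} \<union> {y \<in> \<pi> ` {i<..n}. y < j}"
    proof (intro equalityI subsetI)
      fix v assume v: "v \<in> {1..<j}"
      then have "v \<in> {1..n}" using jb by simp
      then show "v \<in> \<pi> ` {1..i} \<union> {y \<in> \<pi> ` {i<..n}. y < j}" using v unfolding n_eq by simp
    next
      fix v assume v: "v \<in> \<pi> ` {1..i} \<union> {y \<in> \<pi> ` {i<..n}. y < j}"
      then have "v \<in> {1..n}" unfolding n_eq by blast
      moreover have "v < j" using v low by blast
      ultimately show "v \<in> {1..<j}" by simp
    qed
    moreover have "\<pi> ` {1..i} \<inter> {y \<in> \<pi> ` {i<..n}. y < j} = {}" using injD[OF inj] by fastforce
    moreover have "card (\<pi> ` {1..i}) = i" using card_image[OF inj_on_subset[OF inj], of "{1..i}"] by simp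
    ultimately have 1: "card {1..<j} = i + card {y \<in> \<pi> ` {i<..n}. y < j}"
      using card_Un_disjoint[of "\<pi> ` {1..i}" "{y \<in> \<pi> ` {i<..n}. y < j}"] by simp
    have injb: "inj_on ?bar {1..i}" using i by (auto simp: inj_on_def)
    \<comment> \<open>A matched value above i is bounded by the excedance value of an earlier round,
      and all earlier values are below j.\<close>
    have UM: "\<Union>M \<subseteq> {1..<j} \<union> ?bar ` {1..i}"
    proof
      fix x assume x: "x \<in> \<Union>M"
      then have xX: "x \<in> {1..2 * n}" using a(4) by blast
      show "x \<in> {1..<j} \<union> ?bar ` {1..i}"
      proof (cases "x \<le> n")
        case True
        then consider "x \<le> i" | l j' where "l \<le> i" "(l, j' - 1) \<in> A" "x \<le> j'" using a(6) x by blast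
        then have "x < j"
        proof cases
          case 2
          note lb = root_poset_A_bounds[OF A 2(2)]
          have "\<pi> l = j'" using 2(2) lb unfolding A_def excedances_iff by auto
          then show ?thesis using low[of l] 2 lb by auto
        qed (use jb in simp)
        then show ?thesis using xX by simp
      next
        case False
        then have "2 * n + 1 - i \<le> x" using a(5) x by auto
        then have "2 * n + 1 - x \<in> {1..i}" "x = ?bar (2 * n + 1 - x)" using xX by auto
        then show ?thesis by blast
      qed
    qed
    \<comment> \<open>The left side has (j - 1) + i points; the right side has 2i matched points,
      the free values \<open>?W\<close> and the free bars. Combined with j - 1 = i + (values to come
      below j) this is the claim.\<close>
    have eq: "{1..<j} \<union> ?bar ` {1..i} = \<Union>M \<union> (?W \<union> ?bar ` free_bars n i M)"
      using UM unfolding free_bars_def by auto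
    have finM: "finite (\<Union>M)" using finite_subset[OF a(4)] by simp
    have "card ({1..<j} \<union> ?bar ` {1..i}) = card {1..<j} + i"
      using jb i card_image[OF injb] by (subst card_Un_disjoint) auto
    moreover have "card (\<Union>M \<union> (?W \<union> ?bar ` free_bars n i M)) = 2 * i + card (?W \<union> ?bar ` free_bars n i M)"
      using finM F(2) pairing_card[OF a(2,1)] a(3) by (subst card_Un_disjoint) (auto simp: free_bars_def)
    moreover have "card (?W \<union> ?bar ` free_bars n i M) = card ?W + card (free_bars n i M)"
    proof -
      have "card (?bar ` free_bars n i M) = card (free_bars n i M)"
        by (rule card_image[OF inj_on_subset[OF injb F(1)]])
      moreover have "?bar k \<notin> {1..<j}" if "k \<in> {1..i}" for k using that jb i by auto
      then have "?W \<inter> ?bar ` free_bars n i M = {}" using F(1) by blast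
      ultimately show ?thesis using F(2) by (simp add: card_Un_disjoint)
    qed
    ultimately show ?thesis using 1 eq by simp
  qed
  have key: "card ?T' = card (free_bars n (Suc i) M') \<and>
    (\<forall>c\<in>?T'. card {b \<in> ?T'. b \<le> c} \<le> card {y \<in> \<pi> ` {i<..n}. y < c}) \<and>
    (j \<notin> value_closers n M' \<longrightarrow> card {y \<in> \<pi> ` {i<..n}. y < j} \<le> card {b \<in> ?T'. b < j})"
  proof (cases "u \<le> n")
    case True
    have "j \<notin> ?T" using Tlow by blast
    then have cT': "card ?T' = Suc (card ?T)" unfolding T' using True finT by simp
    have "?bar k \<noteq> u" if "k \<in> free_bars n i M" for k
    proof -
      have "k \<le> i" using that F(1) by auto
      then show ?thesis using True i by linarith
    qed
    then have "free_bars n (Suc i) M' = insert (Suc i) (free_bars n i M)" using fb by blast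
    moreover have "Suc i \<notin> free_bars n i M" using F(1) by auto
    ultimately have "card (free_bars n (Suc i) M') = Suc (card (free_bars n i M))" using F(2) by simp
    \<comment> \<open>The partner of j is itself a free value below j; it supplies the extra unit
      that the enlarged set of pending bumps requires.\<close>
    moreover have "u \<in> ?W" using u(2,3) uj[OF True] by simp
    then have "card {u} \<le> card ?W" by (intro card_mono) auto
    then have "card ?T' \<le> card {y \<in> \<pi> ` {i<..n}. y < j}" using cardY r(5) cT' by simp
    moreover have "{b \<in> ?T'. b \<le> j} = ?T'" using Tlow unfolding T' by (auto simp: less_imp_le)
    moreover have "{b \<in> ?T'. b \<le> c} = {b \<in> ?T. b \<le> c}" if "c \<in> ?T" for c
      using Tlow[OF that] unfolding T' by auto
    moreover have "j \<in> value_closers n M'" using True unfolding C' by simp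
    ultimately show ?thesis using r(5,6) cT' True unfolding T' by auto
  next
    case False
    have T'T: "?T' = ?T" using False unfolding T' by simp
    define k0 where "k0 = 2 * n + 1 - u"
    have k0: "k0 \<in> {1..i}" "?bar k0 = u" using ubar False u(2) i unfolding k0_def by auto
    have k0F: "k0 \<in> free_bars n i M" using k0 u(3) unfolding free_bars_def by simp
    have "?bar k \<noteq> u" if "k \<in> {1..i}" "k \<noteq> k0" for k using k0 that i by auto
    then have "free_bars n (Suc i) M' = insert (Suc i) (free_bars n i M - {k0})"
      using fb k0 F(1) by blast
    moreover have "Suc i \<notin> free_bars n i M" using F(1) by auto
    ultimately have "card (free_bars n (Suc i) M') = card (free_bars n i M)"
      using F(2) k0F by (metis card.insert card.remove finite_Diff DiffE)
    \<comment> \<open>A search from j that ends at a bar has passed all values below j, so none of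
      them is free and the values to come below j are as many as the pending bumps.\<close>
    moreover have "?W = {}"
    proof -
      have "v \<in> \<Union>M" if v: "v \<in> {1..<j}" for v
        by (rule between) (use v jb False u(2) in \<open>auto simp: half_turn_def\<close>)
      then show ?thesis by blast
    qed
    then have "card {y \<in> \<pi> ` {i<..n}. y < j} = card ?T" using cardY r(5) by (metis card.empty add_0)
    moreover have "{b \<in> ?T. b < j} = ?T" using Tlow by blast
    ultimately show ?thesis using r(5,6) unfolding T'T by simp
  qed
  have T'j: "c \<le> j" if "c \<in> ?T'" for c using that Tlow unfolding T' by (auto simp: less_imp_le split: if_splits)
  have "rsk_inv n \<pi> (Suc i) M'"
    unfolding rsk_inv_def
  proof (intro conjI)
    show "sorted_wrt (<) (top_P \<pi> (Suc i))" using P'(1) .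
    show "set (top_P \<pi> (Suc i)) \<subseteq> \<pi> ` {1..Suc i}"
      unfolding P'(2) atLeastAtMost_image_Suc j_def using r(2) by blast
    show "value_closers n M' \<subseteq> \<pi> ` {1..Suc i}"
      unfolding C' atLeastAtMost_image_Suc j_def using r(3) by auto
    show "\<pi> ` {1..Suc i} - set (top_P \<pi> (Suc i)) \<subseteq> value_closers n M'"
      unfolding P'(2) atLeastAtMost_image_Suc j_def C' using r(4) by blast
    show "card ?T' = card (free_bars n (Suc i) M')" using key by blast
    show "\<forall>c\<in>?T'. card {b \<in> ?T'. b \<le> c} \<le> card {y \<in> \<pi> ` {Suc i<..n}. y < c}"
      using key Y' T'j by simp
    show "\<forall>l\<in>{1..Suc i}. l < \<pi> l \<longrightarrow> \<pi> l \<in> set (top_P \<pi> (Suc i)) \<longrightarrow> \<pi> l \<notin> value_closers n M' \<longrightarrow>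
        card {y \<in> \<pi> ` {Suc i<..n}. y < \<pi> l} \<le> card {b \<in> ?T'. b < \<pi> l}"
    proof (intro ballI impI)
      fix l assume l: "l \<in> {1..Suc i}" "l < \<pi> l" "\<pi> l \<in> set (top_P \<pi> (Suc i))" "\<pi> l \<notin> value_closers n M'"
      show "card {y \<in> \<pi> ` {Suc i<..n}. y < \<pi> l} \<le> card {b \<in> ?T'. b < \<pi> l}"
      proof (cases "l = Suc i")
        case True
        then have "\<pi> l = j" unfolding j_def by simp
        then show ?thesis using key l(4) Y'[of j] by simp
      next
        case False
        then have l': "l \<in> {1..i}" using l(1) by auto
        have "\<pi> l < j" using low[OF l'] .
        then have "\<pi> l \<in> set (top_P \<pi> i)" "\<pi> l \<notin> value_closers n M" using l(3,4) unfolding P'(2) C' by auto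
        then have "card {y \<in> \<pi> ` {i<..n}. y < \<pi> l} \<le> card {b \<in> ?T. b < \<pi> l}" using r(7) l' l(2) by blast
        moreover have "{b \<in> ?T'. b < \<pi> l} = {b \<in> ?T. b < \<pi> l}" using \<open>\<pi> l < j\<close> unfolding T' by auto
        ultimately show ?thesis using Y'[of "\<pi> l"] \<open>\<pi> l < j\<close> by simp
      qed
    qed
    show "set (top_Q \<pi> (Suc i)) \<subseteq> {1..Suc i}" unfolding Q' using r(8) by auto
    show "\<forall>k\<in>{1..Suc i}. k \<in> set (top_Q \<pi> (Suc i)) \<longleftrightarrow> (\<forall>k'\<in>{1..<k}. {?bar k', ?bar k} \<notin> M')"
    proof
      fix k assume k: "k \<in> {1..Suc i}"
      show "k \<in> set (top_Q \<pi> (Suc i)) \<longleftrightarrow> (\<forall>k'\<in>{1..<k}. {?bar k', ?bar k} \<notin> M')"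
      proof (cases "k = Suc i")
        case True
        then show ?thesis using barSi unfolding Q' by blast
      next
        case False
        then have k': "k \<in> {1..i}" using k by auto
        have "{?bar k', ?bar k} \<in> M' \<longleftrightarrow> {?bar k', ?bar k} \<in> M" if "k' \<in> {1..<k}" for k'
          using that k' i jb unfolding M'_def by (auto simp: doubleton_eq_iff)
        then show ?thesis using r(9) k' False unfolding Q' by auto
      qed
    qed
  qed
  then show ?thesis using u(1) unfolding A_def M'_def by simp
qed

text \<open>The value x is the least one still to come. The search from bar (i+1) meets the bars of
  smaller index first, so it ends at a bar exactly if some bar is free, that is, if a bump is
  pending; x then bumps the least pending entry. Otherwise no row entry exceeds x.\<close>

lemma rsk_inv_other:
  assumes \<pi>: "\<pi> \<in> S321 n" and i: "i < n" and other: "\<pi> (Suc i) \<le> Suc i"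
    and ainv: "ast_inv n (excedances n \<pi>) i M" and rinv: "rsk_inv n \<pi> i M"
  shows "rsk_inv n \<pi> (Suc i) (ast_step n (excedances n \<pi>) (Suc i) M)"
proof -
  define A where "A = excedances n \<pi>"
  define x where "x = \<pi> (Suc i)"
  have A: "A \<in> antichains (root_poset_A (n - 1))" using excedances_antichain[OF \<pi>] unfolding A_def .
  have inj: "inj \<pi>" using permutes_inj[OF S321_permutes[OF \<pi>]] .
  have Si: "Suc i \<in> {1..n}" using i by simp
  have noA: "(Suc i, j) \<notin> A" for j using other unfolding A_def excedances_iff by simp
  let ?bar = "\<lambda>k. 2 * n + 1 - k"
  obtain u where u: "ast_step n A (Suc i) M = insert {?bar (Suc i), u} M" "u \<in> {1..2 * n}" "u \<notin> \<Union>M"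
      "?bar (Suc i) \<notin> \<Union>M" "half_turn n (?bar (Suc i)) < half_turn n u"
    and between: "\<And>c. c \<in> {1..2 * n} \<Longrightarrow> half_turn n (?bar (Suc i)) < half_turn n c \<Longrightarrow>
        half_turn n c < half_turn n u \<Longrightarrow> c \<in> \<Union>M"
    using ast_step_other[OF A ainv[folded A_def] i noA] by metis
  define M' where "M' = insert {?bar (Suc i), u} M"
  have r: "sorted_wrt (<) (top_P \<pi> i)" "set (top_P \<pi> i) \<subseteq> \<pi> ` {1..i}"
    "value_closers n M \<subseteq> \<pi> ` {1..i}" "\<pi> ` {1..i} - set (top_P \<pi> i) \<subseteq> value_closers n M"
    "card (bumpable n \<pi> i M) = card (free_bars n i M)"
    "\<forall>c\<in>bumpable n \<pi> i M. card {b \<in> bumpable n \<pi> i M. b \<le> c} \<le> card {y \<in> \<pi> ` {i<..n}. y < c}"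
    "\<forall>l\<in>{1..i}. l < \<pi> l \<longrightarrow> \<pi> l \<in> set (top_P \<pi> i) \<longrightarrow> \<pi> l \<notin> value_closers n M \<longrightarrow>
        card {y \<in> \<pi> ` {i<..n}. y < \<pi> l} \<le> card {b \<in> bumpable n \<pi> i M. b < \<pi> l}"
    "set (top_Q \<pi> i) \<subseteq> {1..i}"
    "\<forall>k\<in>{1..i}. k \<in> set (top_Q \<pi> i) \<longleftrightarrow> (\<forall>k'\<in>{1..<k}. {?bar k', ?bar k} \<notin> M)"
    using rinv unfolding rsk_inv_def by blast+
  let ?Y = "\<pi> ` {i<..n}" and ?T = "bumpable n \<pi> i M" and ?T' = "bumpable n \<pi> (Suc i) M'"
  have xY: "x \<in> ?Y" unfolding x_def using i by auto
  have Ymin: "x \<le> y" if "y \<in> ?Y" for y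
  proof -
    obtain k where k: "k \<in> {i<..n}" "y = \<pi> k" using \<open>y \<in> ?Y\<close> by blast
    show ?thesis
    proof (cases "k = Suc i")
      case False
      then have "Suc i < k" "k \<in> {1..n}" using k by auto
      then show ?thesis using S321_nonexcedance_less[OF \<pi> Si _ _ other, of k] k unfolding x_def by simp
    qed (use k x_def in simp)
  qed
  have Y': "\<pi> ` {Suc i<..n} = ?Y - {x}" using image_greaterThanAtMost_Suc[OF i inj] unfolding x_def .
  have finY: "finite ?Y" by simp
  have finT: "finite ?T" unfolding bumpable_def by simp
  have xold: "x \<notin> \<pi> ` {1..i}" using injD[OF inj] unfolding x_def by fastforce
  then have xR: "x \<notin> set (top_P \<pi> i)" and xC: "x \<notin> value_closers n M" using r(2,3) by blast+
  have row_exc: "\<exists>l\<in>{1..i}. w = \<pi> l \<and> l < \<pi> l" if w: "w \<in> set (top_P \<pi> i)" "x < w" for w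
  proof -
    obtain l where l: "l \<in> {1..i}" "w = \<pi> l" using r(2) w(1) by blast
    have "l < \<pi> l"
    proof (rule ccontr)
      assume "\<not> l < \<pi> l"
      then have "\<pi> l < x" using S321_nonexcedance_less[OF \<pi> _ Si, of l] l i unfolding x_def by simp
      then show False using w(2) l by simp
    qed
    then show ?thesis using l by blast
  qed
  have C': "value_closers n M' = value_closers n M"
    unfolding M'_def using i u(5) by (subst value_closers_insert) auto
  have F: "free_bars n i M \<subseteq> {1..i}" "finite (free_bars n i M)" unfolding free_bars_def by auto
  have fb: "k \<in> free_bars n (Suc i) M' \<longleftrightarrow> k \<in> free_bars n i M \<and> ?bar k \<noteq> u" for k
  proof (cases "k = Suc i")
    case True
    then show ?thesis unfolding free_bars_def M'_def by simp
  next
    case False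
    have "?bar k \<noteq> ?bar (Suc i)" if "k \<in> {1..i}" using that i by auto
    then show ?thesis using False unfolding free_bars_def M'_def by (auto simp: le_Suc_eq)
  qed
  have uk: "2 * n + 1 - u \<in> free_bars n i M" if "n < u"
  proof -
    have nb: "\<not> ?bar (Suc i) \<le> n" "\<not> u \<le> n" using i that by linarith+
    then have "?bar (Suc i) - n < u - n" using u(5) unfolding half_turn_def by (simp only: if_False)
    then have "?bar (Suc i) < u" by linarith
    then have "2 * n + 1 - u \<in> {1..i}" "?bar (2 * n + 1 - u) = u" using u(2) i by auto
    then show ?thesis using u(3) unfolding free_bars_def by simp
  qed
  have bars_edge: "{?bar k', ?bar k} \<in> M' \<longleftrightarrow> {?bar k', ?bar k} \<in> M" if "k' \<in> {1..<k}" "k \<in> {1..i}" for k k'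
    using that i unfolding M'_def by (auto simp: doubleton_eq_iff)
  have main: "(\<exists>w\<in>?T. x < w \<and> (\<forall>b\<in>?T. w \<le> b) \<and> n < u \<and> set (top_P \<pi> (Suc i)) = insert x (set (top_P \<pi> i) - {w}) \<and>
        (\<forall>y\<in>set (top_P \<pi> i). x < y \<longrightarrow> w \<le> y) \<and> top_Q \<pi> (Suc i) = top_Q \<pi> i) \<or>
      (?T = {} \<and> u \<le> n \<and> set (top_P \<pi> (Suc i)) = insert x (set (top_P \<pi> i)) \<and> top_Q \<pi> (Suc i) = top_Q \<pi> i @ [Suc i])"
  proof (cases "n < u")
    case True
    \<comment> \<open>The partner u is a free bar, and free bars and pending bumps are equal in
      number.\<close>
    have "?T \<noteq> {}" using uk[OF True] F(2) r(5) by (metis card.empty card_0_eq empty_iff)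
    then obtain c0 where c0: "c0 \<in> ?T" "\<forall>b\<in>?T. c0 \<le> b" using finT Min_in Min_le by metis
    have "card {b \<in> ?T. b \<le> c0} > 0" using c0(1) finT by (auto simp: card_gt_0_iff)
    \<comment> \<open>Some value to come lies below the least pending entry, hence x, the least
      value to come, does too.\<close>
    then have "card {y \<in> ?Y. y < c0} > 0" using r(6) c0(1) by (metis less_le_trans)
    then obtain y where "y \<in> ?Y" "y < c0" by (auto simp: card_gt_0_iff)
    then have xc0: "x < c0" using Ymin by fastforce
    have c0R: "c0 \<in> set (top_P \<pi> i)" using c0(1) unfolding bumpable_def by blast
    have "\<not> (\<forall>y\<in>set (top_P \<pi> i). y < x)" using xc0 c0R by (meson less_asym)
    then obtain w where w: "w \<in> set (top_P \<pi> i)" "snd (row_insert x (top_P \<pi> i)) = Some w" "x < w"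
      "\<forall>y\<in>set (top_P \<pi> i). x < y \<longrightarrow> w \<le> y"
      "set (fst (row_insert x (top_P \<pi> i))) = insert x (set (top_P \<pi> i) - {w})"
      using row_insert_sorted[OF r(1) xR] by blast
    \<comment> \<open>An unmarked w is an excedance value with x to come below it, so the second
      counting condition yields a pending entry below w. Then c0 < w, although w is the least row
      entry above x.\<close>
    have "w \<in> value_closers n M"
    proof (rule ccontr)
      assume wC: "w \<notin> value_closers n M"
      obtain l where l: "l \<in> {1..i}" "w = \<pi> l" "l < \<pi> l" using row_exc[OF w(1,3)] by blast
      have "x \<in> {y \<in> ?Y. y < w}" using xY w(3) by simp
      then have "card {y \<in> ?Y. y < w} > 0" using finY by (auto simp: card_gt_0_iff)
      moreover have "card {y \<in> ?Y. y < w} \<le> card {b \<in> ?T. b < w}" using r(7) l w(1) wC by blast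
      ultimately have "card {b \<in> ?T. b < w} > 0" by linarith
      then obtain b where "b \<in> ?T" "b < w" by (auto simp: card_gt_0_iff)
      then have "c0 < w" using c0(2) by fastforce
      then show False using w(4) c0R xc0 by fastforce
    qed
    then have wT: "w \<in> ?T" using w(1) unfolding bumpable_def by blast
    have "w \<le> c0" using w(4) c0R xc0 by blast
    then have "\<forall>b\<in>?T. w \<le> b" using c0(2) by fastforce
    then show ?thesis using wT w True unfolding top_P_Suc top_Q_Suc x_def[symmetric] by auto
  next
    case False
    \<comment> \<open>The bars of index at most i lie between bar (i+1) and the value u in the cut
      order, so the search has found all of them matched.\<close>
    have "free_bars n i M = {}"
    proof (rule ccontr)
      assume "free_bars n i M \<noteq> {}"
      then obtain k where k: "k \<in> {1..i}" "?bar k \<notin> \<Union>M" unfolding free_bars_def by blast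
      have "?bar k \<in> \<Union>M"
        by (rule between) (use k(1) i False u(2) in \<open>auto simp: half_turn_def\<close>)
      then show False using k by blast
    qed
    then have T0: "?T = {}" using r(5) finT by simp
    have "\<not> x < w" if w: "w \<in> set (top_P \<pi> i)" for w
    proof
      assume "x < w"
      obtain l where l: "l \<in> {1..i}" "w = \<pi> l" "l < \<pi> l" using row_exc[OF w \<open>x < w\<close>] by blast
      have "x \<in> {y \<in> ?Y. y < w}" using xY \<open>x < w\<close> by simp
      then have "card {y \<in> ?Y. y < w} > 0" using finY by (auto simp: card_gt_0_iff)
      moreover have "w \<notin> value_closers n M" using T0 w unfolding bumpable_def by blast
      then have "card {y \<in> ?Y. y < w} \<le> card {b \<in> ?T. b < w}" using r(7) l w by blast
      moreover have "card {b \<in> ?T. b < w} = 0" unfolding T0 by simp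
      ultimately show False by linarith
    qed
    then have "snd (row_insert x (top_P \<pi> i)) = None \<and>
        set (fst (row_insert x (top_P \<pi> i))) = insert x (set (top_P \<pi> i))"
      using row_insert_sorted[OF r(1) xR] by blast
    then show ?thesis using T0 False unfolding top_P_Suc top_Q_Suc x_def[symmetric] by auto
  qed
  have im: "\<pi> ` {1..Suc i} = insert x (\<pi> ` {1..i})" unfolding atLeastAtMost_image_Suc x_def ..
  have old: "\<pi> l \<in> set (top_P \<pi> i)" "l \<in> {1..i}"
    if "l \<in> {1..Suc i}" "l < \<pi> l" "\<pi> l \<in> set (top_P \<pi> (Suc i))" for l
  proof -
    have "l \<noteq> Suc i" using that(2) other by auto
    then show "l \<in> {1..i}" using that(1) by auto
    then have "\<pi> l \<noteq> x" using xold by blast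
    then show "\<pi> l \<in> set (top_P \<pi> i)" using that(3) main by auto
  qed
  have sorted: "sorted_wrt (<) (top_P \<pi> (Suc i))"
    using row_insert_sorted[OF r(1) xR] unfolding top_P_Suc x_def by blast
  from main have "rsk_inv n \<pi> (Suc i) M'"
  proof (elim disjE bexE conjE)
    fix w assume w: "w \<in> ?T" "x < w" "\<forall>b\<in>?T. w \<le> b" and nu: "n < u"
      and P': "set (top_P \<pi> (Suc i)) = insert x (set (top_P \<pi> i) - {w})"
      and wmin: "\<forall>y\<in>set (top_P \<pi> i). x < y \<longrightarrow> w \<le> y" and Q': "top_Q \<pi> (Suc i) = top_Q \<pi> i"
    have T': "?T' = ?T - {w}" unfolding bumpable_def C' P' using xC by auto
    have wC: "w \<in> value_closers n M" "w \<in> set (top_P \<pi> i)" using w(1) unfolding bumpable_def by auto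
    show ?thesis
      unfolding rsk_inv_def
    proof (intro conjI)
      show "sorted_wrt (<) (top_P \<pi> (Suc i))" using sorted .
      show "set (top_P \<pi> (Suc i)) \<subseteq> \<pi> ` {1..Suc i}" unfolding P' im using r(2) by blast
      show "value_closers n M' \<subseteq> \<pi> ` {1..Suc i}" unfolding C' im using r(3) by blast
      show "\<pi> ` {1..Suc i} - set (top_P \<pi> (Suc i)) \<subseteq> value_closers n M'"
        unfolding C' im P' using r(4) wC(1) by blast
      show "card ?T' = card (free_bars n (Suc i) M')"
      proof -
        have "?bar k \<noteq> u" if "k \<in> {1..i}" "k \<noteq> 2 * n + 1 - u" for k using that u(2) i by auto
        then have "free_bars n (Suc i) M' = free_bars n i M - {2 * n + 1 - u}"
          using fb F(1) u(2) nu by auto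
        then have "card (free_bars n (Suc i) M') = card (free_bars n i M) - 1"
          using uk[OF nu] F(2) by simp
        then show ?thesis using w(1) finT r(5) unfolding T' by simp
      qed
      show "\<forall>c\<in>?T'. card {b \<in> ?T'. b \<le> c} \<le> card {y \<in> \<pi> ` {Suc i<..n}. y < c}"
      proof
        fix c assume "c \<in> ?T'"
        then have c: "c \<in> ?T" "c \<noteq> w" unfolding T' by auto
        then have wc: "w < c" using w(3) by (metis le_neq_implies_less)
        \<comment> \<open>The bumped w and the inserted x are both below c, so both counts drop by
          one.\<close>
        have "{b \<in> ?T'. b \<le> c} = {b \<in> ?T. b \<le> c} - {w}" unfolding T' by blast
        then have "card {b \<in> ?T'. b \<le> c} = card {b \<in> ?T. b \<le> c} - 1" using w(1) wc finT by simp
        moreover have "{y \<in> \<pi> ` {Suc i<..n}. y < c} = {y \<in> ?Y. y < c} - {x}" unfolding Y' by blast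
        then have "card {y \<in> \<pi> ` {Suc i<..n}. y < c} = card {y \<in> ?Y. y < c} - 1"
          using xY w(2) wc finY by simp
        ultimately show "card {b \<in> ?T'. b \<le> c} \<le> card {y \<in> \<pi> ` {Suc i<..n}. y < c}"
          using diff_le_mono[OF bspec[OF r(6) c(1)], of 1] by simp
      qed
      show "\<forall>l\<in>{1..Suc i}. l < \<pi> l \<longrightarrow> \<pi> l \<in> set (top_P \<pi> (Suc i)) \<longrightarrow> \<pi> l \<notin> value_closers n M' \<longrightarrow>
        card {y \<in> \<pi> ` {Suc i<..n}. y < \<pi> l} \<le> card {b \<in> ?T'. b < \<pi> l}"
      proof (intro ballI impI)
        fix l assume l: "l \<in> {1..Suc i}" "l < \<pi> l" "\<pi> l \<in> set (top_P \<pi> (Suc i))" "\<pi> l \<notin> value_closers n M'"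
        note lo = old[OF l(1-3)]
        have lC: "\<pi> l \<notin> value_closers n M" using l(4) unfolding C' .
        show "card {y \<in> \<pi> ` {Suc i<..n}. y < \<pi> l} \<le> card {b \<in> ?T'. b < \<pi> l}"
        proof (cases "x < \<pi> l")
          case True
          then have "w \<le> \<pi> l" using wmin lo(1) by blast
          moreover have "w \<noteq> \<pi> l" using wC(1) lC by blast
          ultimately have wl: "w < \<pi> l" by simp
          have "{b \<in> ?T'. b < \<pi> l} = {b \<in> ?T. b < \<pi> l} - {w}" unfolding T' by blast
          then have "card {b \<in> ?T'. b < \<pi> l} = card {b \<in> ?T. b < \<pi> l} - 1" using w(1) wl finT by simp
          moreover have "{y \<in> \<pi> ` {Suc i<..n}. y < \<pi> l} = {y \<in> ?Y. y < \<pi> l} - {x}" unfolding Y' by blast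
          then have "card {y \<in> \<pi> ` {Suc i<..n}. y < \<pi> l} = card {y \<in> ?Y. y < \<pi> l} - 1"
            using xY True finY by simp
          moreover have "card {y \<in> ?Y. y < \<pi> l} \<le> card {b \<in> ?T. b < \<pi> l}" using r(7) lo l(2) lC by blast
          ultimately show ?thesis using diff_le_mono by simp
        next
          case False
          \<comment> \<open>The least value to come was x, which is not below \<pi> l, so no value
            to come is.\<close>
          have "{y \<in> \<pi> ` {Suc i<..n}. y < \<pi> l} = {}" unfolding Y' using Ymin False by fastforce
          then show ?thesis by (simp only: card.empty le0)
        qed
      qed
      show "set (top_Q \<pi> (Suc i)) \<subseteq> {1..Suc i}" unfolding Q' using r(8) by auto
      show "\<forall>k\<in>{1..Suc i}. k \<in> set (top_Q \<pi> (Suc i)) \<longleftrightarrow> (\<forall>k'\<in>{1..<k}. {?bar k', ?bar k} \<notin> M')"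
      proof
        fix k assume k: "k \<in> {1..Suc i}"
        show "k \<in> set (top_Q \<pi> (Suc i)) \<longleftrightarrow> (\<forall>k'\<in>{1..<k}. {?bar k', ?bar k} \<notin> M')"
        proof (cases "k = Suc i")
          case True
          \<comment> \<open>This round bumps, so i+1 stays out of the first row of Q; the witness on
            the other side is the index of the free bar u.\<close>
          define k' where "k' = 2 * n + 1 - u"
          have "k' \<in> {1..<k}" using uk[OF nu] F(1) True unfolding k'_def by auto
          moreover have "?bar k' = u" using u(2) nu unfolding k'_def by auto
          then have "{?bar k', ?bar k} \<in> M'" using True unfolding M'_def by (simp add: insert_commute)
          moreover have "k \<notin> set (top_Q \<pi> (Suc i))" using r(8) True unfolding Q' by auto
          ultimately show ?thesis by blast
        next
          case False
          then have k': "k \<in> {1..i}" using k by auto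
          show ?thesis unfolding Q' using r(9) k' bars_edge[OF _ k'] by blast
        qed
      qed
    qed
  next
    assume T0: "?T = {}" and un: "u \<le> n" and P': "set (top_P \<pi> (Suc i)) = insert x (set (top_P \<pi> i))"
      and Q': "top_Q \<pi> (Suc i) = top_Q \<pi> i @ [Suc i]"
    have T': "?T' = {}" using T0 xC unfolding bumpable_def C' P' by auto
    show ?thesis
      unfolding rsk_inv_def
    proof (intro conjI)
      show "sorted_wrt (<) (top_P \<pi> (Suc i))" using sorted .
      show "set (top_P \<pi> (Suc i)) \<subseteq> \<pi> ` {1..Suc i}" unfolding P' im using r(2) by blast
      show "value_closers n M' \<subseteq> \<pi> ` {1..Suc i}" unfolding C' im using r(3) by blast
      show "\<pi> ` {1..Suc i} - set (top_P \<pi> (Suc i)) \<subseteq> value_closers n M'"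
        unfolding C' im P' using r(4) by blast
      have "free_bars n i M = {}" using r(5) F(2) unfolding T0 by simp
      then have "free_bars n (Suc i) M' = {}" using fb by blast
      then show "card ?T' = card (free_bars n (Suc i) M')" unfolding T' by simp
      show "\<forall>c\<in>?T'. card {b \<in> ?T'. b \<le> c} \<le> card {y \<in> \<pi> ` {Suc i<..n}. y < c}" unfolding T' by simp
      show "\<forall>l\<in>{1..Suc i}. l < \<pi> l \<longrightarrow> \<pi> l \<in> set (top_P \<pi> (Suc i)) \<longrightarrow> \<pi> l \<notin> value_closers n M' \<longrightarrow>
        card {y \<in> \<pi> ` {Suc i<..n}. y < \<pi> l} \<le> card {b \<in> ?T'. b < \<pi> l}"
      proof (intro ballI impI)
        fix l assume l: "l \<in> {1..Suc i}" "l < \<pi> l" "\<pi> l \<in> set (top_P \<pi> (Suc i))" "\<pi> l \<notin> value_closers n M'"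
        note lo = old[OF l(1-3)]
        have lC: "\<pi> l \<notin> value_closers n M" using l(4) unfolding C' .
        have "card {y \<in> \<pi> ` {Suc i<..n}. y < \<pi> l} \<le> card {y \<in> ?Y. y < \<pi> l}"
          unfolding Y' using finY by (intro card_mono) auto
        also have "\<dots> \<le> card {b \<in> ?T. b < \<pi> l}" using r(7) lo l(2) lC by blast
        finally show "card {y \<in> \<pi> ` {Suc i<..n}. y < \<pi> l} \<le> card {b \<in> ?T'. b < \<pi> l}" unfolding T0 T' .
      qed
      show "set (top_Q \<pi> (Suc i)) \<subseteq> {1..Suc i}" unfolding Q' using r(8) by auto
      show "\<forall>k\<in>{1..Suc i}. k \<in> set (top_Q \<pi> (Suc i)) \<longleftrightarrow> (\<forall>k'\<in>{1..<k}. {?bar k', ?bar k} \<notin> M')"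
      proof
        fix k assume k: "k \<in> {1..Suc i}"
        show "k \<in> set (top_Q \<pi> (Suc i)) \<longleftrightarrow> (\<forall>k'\<in>{1..<k}. {?bar k', ?bar k} \<notin> M')"
        proof (cases "k = Suc i")
          case True
          have "{?bar k', ?bar k} \<notin> M'" if "k' \<in> {1..<k}" for k'
          proof -
            have "{?bar k', ?bar k} \<notin> M" using u(4) True by blast
            moreover have "?bar k' \<noteq> u" "?bar k' \<noteq> ?bar (Suc i)" using that un i True by auto
            ultimately show ?thesis unfolding M'_def by (auto simp: doubleton_eq_iff)
          qed
          then show ?thesis using True unfolding Q' by simp
        next
          case False
          then have k': "k \<in> {1..i}" using k by auto
          show ?thesis unfolding Q' using r(9) k' bars_edge[OF _ k'] False by auto
        qed
      qed
    qed
  qed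
  then show ?thesis using u(1) unfolding A_def M'_def by simp
qed

lemma ast_state_rsk_inv:
  assumes \<pi>: "\<pi> \<in> S321 n"
  shows "i \<le> n \<Longrightarrow> rsk_inv n \<pi> i (ast_state n (excedances n \<pi>) i)"
proof (induction i)
  case 0
  show ?case
    unfolding ast_state_0 by (simp add: rsk_inv_def value_closers_def bumpable_def free_bars_def top_0)
next
  case (Suc i)
  then have "i < n" "rsk_inv n \<pi> i (ast_state n (excedances n \<pi>) i)" by auto
  moreover have "ast_inv n (excedances n \<pi>) i (ast_state n (excedances n \<pi>) i)"
    using ast_state_inv[OF excedances_antichain[OF \<pi>]] Suc.prems by simp
  ultimately show ?case
    using rsk_inv_excedance[OF \<pi>] rsk_inv_other[OF \<pi>] unfolding ast_state_Suc by (meson not_le)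
qed

text \<open>In the end no bump is pending, so the first row of P consists of the values that are not
  joined to a smaller one, and k is in the first row of Q exactly if bar k is a right end point.
  These are the labels that \<open>Match_eqI\<close> asks for.\<close>

lemma Match_RSK_hat:
  assumes \<pi>: "\<pi> \<in> S321 n" and n: "n \<ge> 1"
  shows "Match (RSK_hat n \<pi>) = AST n (excedances n \<pi>)"
proof -
  let ?M = "AST n (excedances n \<pi>)" and ?w = "RSK_hat n \<pi>" and ?bar = "\<lambda>k. 2 * n + 1 - k"
  have M: "?M \<in> noncrossing_matchings n" using AST_closers(1)[OF excedances_antichain[OF \<pi>]] .
  note uniq = pairing_unique[OF noncrossing_pairing[OF M]]
  have "?M = ast_state n (excedances n \<pi>) n" unfolding AST_def ast_state_def by simp
  then have "rsk_inv n \<pi> n ?M" using ast_state_rsk_inv[OF \<pi> order_refl] by simp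
  then have r: "set (top_P \<pi> n) \<subseteq> \<pi> ` {1..n}" "\<pi> ` {1..n} - set (top_P \<pi> n) \<subseteq> value_closers n ?M"
    "\<forall>c\<in>bumpable n \<pi> n ?M. card {b \<in> bumpable n \<pi> n ?M. b \<le> c} \<le> card {y \<in> \<pi> ` {n<..n}. y < c}"
    "\<forall>k\<in>{1..n}. k \<in> set (top_Q \<pi> n) \<longleftrightarrow> (\<forall>k'\<in>{1..<k}. {?bar k', ?bar k} \<notin> ?M)"
    unfolding rsk_inv_def by blast+
  \<comment> \<open>For i = n no values are left to come, so the first counting condition would
    bound a positive number by 0.\<close>
  have "bumpable n \<pi> n ?M = {}"
  proof (rule ccontr)
    assume "bumpable n \<pi> n ?M \<noteq> {}"
    then obtain c where c: "c \<in> bumpable n \<pi> n ?M" by blast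
    then have "card {b \<in> bumpable n \<pi> n ?M. b \<le> c} = 0" using r(3) by fastforce
    then have "{b \<in> bumpable n \<pi> n ?M. b \<le> c} = {}" by (simp add: bumpable_def)
    then show False using c by blast
  qed
  then have P: "v \<in> set (top_P \<pi> n) \<longleftrightarrow> v \<notin> value_closers n ?M" if "v \<in> {1..n}" for v
    using r(2) that permutes_image[OF S321_permutes[OF \<pi>]] unfolding bumpable_def by blast
  show ?thesis
  proof (rule Match_eqI[OF M RSK_hat_nth(1)[OF n]])
    fix x y assume e: "{x, y} \<in> ?M" and less: "x < y"
    have X: "x \<in> {1..2 * n}" "y \<in> {1..2 * n}" using noncrossing_mem[OF M e] by auto
    have e': "{y, x} \<in> ?M" using e by (simp add: insert_commute)
    have "?w ! (x - 1) = U"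
    proof (cases "x \<le> n")
      case True
      have "x \<notin> value_closers n ?M"
      proof
        assume "x \<in> value_closers n ?M"
        then obtain v where "v < x" "{x, v} \<in> ?M" unfolding value_closers_def by (auto simp: insert_commute)
        then show False using uniq[OF e, of v] less by simp
      qed
      then show ?thesis using RSK_hat_nth(2)[OF n, of x] P[of x] X True by simp
    next
      case False
      define k where "k = 2 * n + 1 - x"
      define k' where "k' = 2 * n + 1 - y"
      have k: "k \<in> {1..n}" "x - 1 = 2 * n - k" "k' \<in> {1..<k}" "?bar k = x" "?bar k' = y"
        using False X less unfolding k_def k'_def by auto
      then have "k \<notin> set (top_Q \<pi> n)" using r(4) e' by metis
      then show ?thesis using RSK_hat_nth(3)[OF n k(1)] k(2) by simp
    qed
    moreover have "?w ! (y - 1) = D"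
    proof (cases "y \<le> n")
      case True
      then have "y \<in> value_closers n ?M" using e less unfolding value_closers_def by blast
      then show ?thesis using RSK_hat_nth(2)[OF n, of y] P[of y] X True by simp
    next
      case False
      define k where "k = 2 * n + 1 - y"
      have k: "k \<in> {1..n}" "y - 1 = 2 * n - k" "?bar k = y" using False X unfolding k_def by auto
      have "{?bar k', ?bar k} \<notin> ?M" if "k' \<in> {1..<k}" for k'
      proof
        assume "{?bar k', ?bar k} \<in> ?M"
        then have "{y, ?bar k'} \<in> ?M" using k(3) by (simp add: insert_commute)
        then have "?bar k' = x" using uniq[OF e'] by simp
        then show False using that k less by auto
      qed
      then have "k \<in> set (top_Q \<pi> n)" using r(4) k(1) by blast
      then show ?thesis using RSK_hat_nth(3)[OF n k(1)] k(2) by simp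
    qed
    ultimately show "?w ! (x - 1) = U \<and> ?w ! (y - 1) = D" ..
  qed
qed

theorem theorem5p6:
  shows "(\<forall>n::nat. n \<ge> 1 \<longrightarrow>
            bij_betw (Match \<circ> RSK_hat n)
              {\<pi> \<in> S321 n. \<pi> = inv (rev_compl n \<pi>)} (symmetric_matchings n)) \<and>
         (\<forall>m::nat. m \<ge> 1 \<longrightarrow>
            bij_betw (AST_B m) (antichains (root_poset_B m)) (symmetric_matchings (2 * m)))"
proof (intro conjI allI impI)
  fix n :: nat assume "n \<ge> 1"
  then show "bij_betw (Match \<circ> RSK_hat n) {\<pi> \<in> S321 n. \<pi> = inv (rev_compl n \<pi>)} (symmetric_matchings n)"
    by (intro bij_betw_cong[THEN iffD1, OF _ AST_excedances_bij_betw]) (simp add: Match_RSK_hat)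
qed (rule AST_B_bij_betw)

end
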